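(* Let $n\ge 0$ be an integer and let $\lambda \in \mathrm{CRS}^e(\mathcal{A}_n)$. Then there is a unique pair $(m,[F])$, where $m\ge 0$ is an integer and $[F]$ is the isomorphism class of a finite abelian group $F$ over $m$, such that $m\mid n$, $nF=0$, and the random subgroup $m\mathcal{A}_n\cap\mathrm{Ker}(h)$ of $\mathcal{A}_n$ has law $\lambda$, where $h\in\mathrm{Hom}(\mathcal{A}_n,F)$ is a random homomorphism with law equal to the (normalized) Haar measure on the compact group $\mathrm{Hom}(\mathcal{A}_n,F)$.
   Context: $\mathbb{N}=\{1,2,\dots\}$. Let $\mathcal{A}=\bigoplus_{\mathbb{N}}\mathbb{Z}$ (discrete) and, for an integer $n\ge 0$, $\mathcal{A}_n=\mathcal{A}/n\mathcal{A}\cong\bigoplus_{\mathbb{N}}\mathbb{Z}/n\mathbb{Z}$ (so $\mathcal{A}_0=\mathcal{A}$ and $\mathcal{A}_1$ is trivial). Divisibility convention: for $m,n\in\mathbb{N}$, $m\mid n$ has the usual meaning; $m\mid 0$ for every $m\ge 0$; and $0\nmid n$ for $n\in \mathbb{N}$. For an integer $m\ge0$, a finite abelian group $F$ is "over $m$" if either $F=0$ or every nontrivial direct summand $F_1$ of $F$ satisfies $mF_1\ne 0$. (Every $F$ is over $1$; only the trivial group is over $0$.) $[F]$ denotes the isomorphism class of $F$. For a countable discrete group $G$, $\mathrm{Sub}(G)$ is the compact metrizable space of subgroups of $G$ (topology induced from the product topology on $\{0,1\}^G$). $\mathrm{Aut}(G)$ acts on $\mathrm{Sub}(G)$ by $(\phi,H)\mapsto\phi(H)$.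 $\mathrm{CRS}(G)$ is the convex set of $\mathrm{Aut}(G)$-invariant Borel probability measures on $\mathrm{Sub}(G)$, and $\mathrm{CRS}^e(G)$ is its set of extreme points. $\mathrm{Hom}(\mathcal{A}_n,F)$ is a group under pointwise addition with the topology of pointwise convergence. *)

theory Defs
  imports "HOL-Algebra.Algebra" "HOL-Probability.Probability"
begin

text \<open>The library writes all groups multiplicatively, so \<open>multiples G m S\<close> is the set
  \<open>m S\<close> of additive notation.\<close>

definition multiples :: "('a, 'b) monoid_scheme \<Rightarrow> nat \<Rightarrow> 'a set \<Rightarrow> 'a set"
  where "multiples G m S = (\<lambda>x. x [^]\<^bsub>G\<^esub> m) ` S"

definition AA :: "(nat \<Rightarrow> int) monoid"
  where "AA = sum_group {1..} (\<lambda>_. integer_group)"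

definition AAn :: "nat \<Rightarrow> (nat \<Rightarrow> int) set monoid"
  where "AAn n = AA Mod multiples AA n (carrier AA)"

definition direct_summand :: "'a set \<Rightarrow> ('a, 'b) monoid_scheme \<Rightarrow> bool"
  where "direct_summand H G \<longleftrightarrow> subgroup H G \<and>
    (\<exists>K. subgroup K G \<and> H \<inter> K = {\<one>\<^bsub>G\<^esub>} \<and> H <#>\<^bsub>G\<^esub> K = carrier G)"

definition is_over :: "('a, 'b) monoid_scheme \<Rightarrow> nat \<Rightarrow> bool"
  where "is_over F m \<longleftrightarrow> carrier F = {\<one>\<^bsub>F\<^esub>} \<or>
    (\<forall>F1. direct_summand F1 F \<and> F1 \<noteq> {\<one>\<^bsub>F\<^esub>} \<longrightarrow> multiples F m F1 \<noteq> {\<one>\<^bsub>F\<^esub>})"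

text \<open>Finite groups are represented by groups with carrier in \<open>nat\<close>; by the lemma below
  no isomorphism type is lost.\<close>

definition iso_class :: "nat monoid \<Rightarrow> nat monoid set"
  where "iso_class F = {G. group G \<and> G \<cong> F}"

lemma finite_comm_group_iso_nat:
  fixes G :: "('a, 'b) monoid_scheme"
  assumes "comm_group G" "finite (carrier G)"
  shows "\<exists>F :: nat monoid. comm_group F \<and> finite (carrier F) \<and> G \<cong> F"
proof -
  interpret comm_group G by fact
  obtain f :: "'a \<Rightarrow> nat" where f: "inj_on f (carrier G)"
    using finite_imp_inj_to_nat_seg[OF assms(2)] by blast
  define g where "g = inv_into (carrier G) f"
  define F :: "nat monoid" where
    "F = \<lparr>carrier = f ` carrier G, monoid.mult = (\<lambda>x y. f (g x \<otimes>\<^bsub>G\<^esub> g y)), one = f \<one>\<^bsub>G\<^esub>\<rparr>"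
  have g: "g (f x) = x" if "x \<in> carrier G" for x
    using f that by (simp add: g_def)
  have "comm_group F"
  proof (rule comm_groupI)
    fix y assume "y \<in> carrier F"
    then obtain x where "x \<in> carrier G" "y = f x" by (auto simp: F_def)
    then show "\<exists>z\<in>carrier F. z \<otimes>\<^bsub>F\<^esub> y = \<one>\<^bsub>F\<^esub>"
      by (intro bexI[of _ "f (inv\<^bsub>G\<^esub> x)"]) (auto simp: F_def g)
  qed (auto simp: F_def g m_assoc m_comm m_lcomm)
  moreover have "f \<in> iso G F"
    using f by (auto simp: iso_def hom_def F_def g bij_betw_def)
  ultimately show ?thesis
    using assms(2) by (intro exI[of _ F]) (auto simp: is_iso_def F_def)
qed

definition borel_of :: "'a topology \<Rightarrow> 'a measure"
  where "borel_of T = sigma (topspace T) {U. openin T U}"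

text \<open>The topology on \<open>Sub(G)\<close>: subgroups are identified with their indicator functions
  in \<open>{False, True}\<^sup>G\<close>.\<close>

definition Sub :: "('a, 'b) monoid_scheme \<Rightarrow> 'a set topology"
  where "Sub G = pullback_topology {H. subgroup H G} (\<lambda>H. \<lambda>x\<in>carrier G. x \<in> H)
    (product_topology (\<lambda>_. discrete_topology (UNIV :: bool set)) (carrier G))"

definition CRS :: "('a, 'b) monoid_scheme \<Rightarrow> 'a set measure set"
  where "CRS G = {\<mu>. prob_space \<mu> \<and> sets \<mu> = sets (borel_of (Sub G)) \<and>
    (\<forall>\<phi>\<in>auto G. distr \<mu> (borel_of (Sub G)) (\<lambda>H. \<phi> ` H) = \<mu>)}"

text \<open>Measures do not form a type of class \<open>real_vector\<close>, so the library's
  \<open>extreme_point_of\<close> does not apply.\<close>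

definition CRSe :: "('a, 'b) monoid_scheme \<Rightarrow> 'a set measure set"
  where "CRSe G = {lam \<in> CRS G. \<forall>\<mu>\<in>CRS G. \<forall>\<nu>\<in>CRS G. \<forall>t\<in>{0<..<1}.
    (\<forall>E\<in>sets (borel_of (Sub G)).
       measure lam E = (1 - t) * measure \<mu> E + t * measure \<nu> E) \<longrightarrow> \<mu> = \<nu>}"

text \<open>Homomorphisms are taken extensional, so that they are determined by their values on
  the carrier.\<close>

definition Hom_group :: "('a, 'c) monoid_scheme \<Rightarrow> ('b, 'd) monoid_scheme \<Rightarrow> ('a \<Rightarrow> 'b) monoid"
  where "Hom_group G F = \<lparr>carrier = hom G F \<inter> extensional (carrier G),
    monoid.mult = (\<lambda>h k. \<lambda>x\<in>carrier G. h x \<otimes>\<^bsub>F\<^esub> k x),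
    one = (\<lambda>x\<in>carrier G. \<one>\<^bsub>F\<^esub>)\<rparr>"

definition Hom_topology ::
    "('a, 'c) monoid_scheme \<Rightarrow> ('b, 'd) monoid_scheme \<Rightarrow> ('a \<Rightarrow> 'b) topology"
  where "Hom_topology G F = subtopology
    (product_topology (\<lambda>_. discrete_topology (carrier F)) (carrier G))
    (carrier (Hom_group G F))"

text \<open>Normalized Haar measure of a compact metrizable group \<open>K\<close> with topology \<open>T\<close>: the
  translation-invariant Borel probability measure. Regularity is automatic by metrizability,
  which holds for \<open>Hom(G, F)\<close> with \<open>G\<close> countable and \<open>F\<close> finite.\<close>

definition haar_prob :: "('a, 'b) monoid_scheme \<Rightarrow> 'a topology \<Rightarrow> 'a measure \<Rightarrow> bool"
  where "haar_prob K T \<mu> \<longleftrightarrow> prob_space \<mu> \<and> sets \<mu> = sets (borel_of T) \<and>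
    (\<forall>k\<in>carrier K. distr \<mu> (borel_of T) (\<lambda>h. k \<otimes>\<^bsub>K\<^esub> h) = \<mu>)"

end

theory Submission
  imports Defs
begin

text \<open>Write \<open>A = \<A>\<^sub>n\<close> with basis \<open>e\<^sub>i\<close>, let \<open>H\<close> be a random subgroup with law \<open>lam\<close>, and call an event local
  over \<open>J\<close> if it depends only on finitely many elements of the span of \<open>e\<^sub>j\<close>, \<open>j \<in> J\<close>. Invariance and
  extremality make local events over disjoint index sets independent. Therefore the set of \<open>d\<close> such that
  \<open>d e\<^sub>0 \<in> H\<close> has positive probability consists of the multiples of one number \<open>m\<close>, and \<open>H \<subseteq> m A\<close> almost surely.
  Let \<open>a\<close> be the probability that \<open>m e\<^sub>0 \<in> H\<close>. By shear automorphisms, \<open>m (e\<^sub>i - w) \<in> H\<close> also has probability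
  \<open>a\<close>, independently of \<open>H\<close> near \<open>w\<close>. If the elements \<open>m w\<close>, \<open>w \<in> W\<close>, are distinct modulo \<open>H\<close>, these
  events are disjoint, so \<open>|W| a \<le> 1\<close>; for \<open>W\<close> of maximal size there is equality, \<open>m A / H\<close> has order \<open>1 / a\<close>, and
  the images of the \<open>m e\<^sub>i\<close> in it are independent and uniform. This identifies the law of \<open>H\<close> with the Haar
  model built from one typical \<open>H\<close>: extend \<open>m A / H\<close> to a finite quotient \<open>F = A / B\<close> over \<open>m\<close>, where \<open>B\<close> is
  maximal with \<open>m A \<inter> B = H\<close>.

  Conversely the law determines \<open>m\<close> and \<open>m F\<close>, and a finite group \<open>F\<close> over \<open>m\<close> is determined by \<open>m F\<close> because
  all its elements of prime order lie in \<open>m F\<close>.\<close>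

text \<open>Extremality is used once. Condition on a far translate of a finite set lying in
  \<open>H\<close>, and on it not lying in \<open>H\<close>: the two limiting laws are invariant and
  \<open>lam\<close> is a mixture of them, so they agree. The obstacle is that an automorphism may
  move the far coordinates; on the finitely many elements that matter it is replaced by one that
  fixes almost all basis vectors. Uniformity in \<open>m A / H\<close> does not yet give the law,
  since \<open>H\<close> is random. But once \<open>S\<close> is moved to fresh coordinates, the
  event that it lies in \<open>H\<close> is independent of the trace of \<open>H\<close> on a finite
  set, and conditionally on that trace its probability is a count that the trace determines. So
  almost every \<open>H\<close> with enough separated elements determines the whole law, and
  \<open>B\<close> and \<open>F\<close> can be built from one fixed subgroup. \<open>A / H\<close>
  is infinite unless \<open>m = 1\<close>, so it cannot serve as \<open>F\<close>; enlarging
  \<open>H\<close> to a maximal \<open>B\<close> keeps \<open>m A / H\<close> and discards what it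
  does not control. The notion of being over \<open>m\<close> is handled through elements of prime
  order: they must all be \<open>m\<close>-multiples. This is what maximality of \<open>B\<close>
  yields and what the uniqueness proof consumes.\<close>

hide_const (open) Divisibility.prime

section \<open>Subgroups of abelian groups\<close>

lemma mem_multiples: "x \<in> multiples G m S \<longleftrightarrow> (\<exists>y\<in>S. x = y [^]\<^bsub>G\<^esub> m)"
  by (auto simp: multiples_def)

lemma multiplesI: "y \<in> S \<Longrightarrow> y [^]\<^bsub>G\<^esub> m \<in> multiples G m S"
  by (auto simp: multiples_def)

lemma mem_set_mult: "x \<in> A <#>\<^bsub>G\<^esub> B \<longleftrightarrow> (\<exists>a\<in>A. \<exists>b\<in>B. x = a \<otimes>\<^bsub>G\<^esub> b)"
  by (auto simp: set_mult_def)

lemma (in group) mem_set_mult_left: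
  "subgroup B G \<Longrightarrow> c \<in> C \<Longrightarrow> c \<in> carrier G \<Longrightarrow> c \<in> C <#> B"
  unfolding mem_set_mult by (metis r_one subgroup.one_closed)

lemma (in group) multiples_subset: "S \<subseteq> carrier G \<Longrightarrow> multiples G m S \<subseteq> carrier G"
  by (auto simp: multiples_def)

lemma (in comm_group) subgroup_multiples:
  assumes "subgroup S G"
  shows "subgroup (multiples G m S) G"
proof (rule subgroupI)
  note S = subgroup.mem_carrier[OF assms]
  show "multiples G m S \<subseteq> carrier G"
    by (rule multiples_subset[OF subgroup.subset[OF assms]])
  show "multiples G m S \<noteq> {}"
    using subgroup.one_closed[OF assms] by (auto simp: multiples_def)
  fix a assume "a \<in> multiples G m S"
  then obtain y where y: "y \<in> S" "a = y [^] m" by (auto simp: mem_multiples)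
  have "inv a = (inv y) [^] m" using y S[OF y(1)] by (simp add: nat_pow_inv)
  then show "inv a \<in> multiples G m S"
    using subgroup.m_inv_closed[OF assms y(1)] by (auto simp: mem_multiples)
  fix b assume "b \<in> multiples G m S"
  then obtain z where z: "z \<in> S" "b = z [^] m" by (auto simp: mem_multiples)
  have "a \<otimes> b = (y \<otimes> z) [^] m" using y z S[OF y(1)] S[OF z(1)] by (simp add: nat_pow_distrib)
  then show "a \<otimes> b \<in> multiples G m S"
    using subgroup.m_closed[OF assms y(1) z(1)] by (auto simp: mem_multiples)
qed

lemma (in group) subgroup_pow_closed:
  assumes "subgroup H G" "x \<in> H"
  shows "x [^] (k::nat) \<in> H"
  by (induct k) (use assms in \<open>auto simp: subgroup.one_closed subgroup.m_closed\<close>)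

lemma (in group) int_pow_int_mult:
  "x \<in> carrier G \<Longrightarrow> x [^] (int p * j) = (x [^] p) [^] j"
  by (metis int_pow_int int_pow_pow)

text \<open>Both conditions on \<open>B\<close> pass to unions of chains, so Zorn's lemma applies.
  The complement in \<open>prime_order_mem_multiples\<close>, the quotient in
  \<open>exists_over_quotient\<close> and the gluing in \<open>is_over_iso\<close> all start from
  such a \<open>B\<close>.\<close>

lemma (in group) maximal_subgroup:
  assumes K: "subgroup K G"
  shows "\<exists>B. subgroup B G \<and> K \<subseteq> B \<and> B \<inter> D = K \<inter> D \<and>
    (\<forall>L. subgroup L G \<and> B \<subseteq> L \<and> L \<inter> D = K \<inter> D \<longrightarrow> L = B)"
proof -
  define S where "S = {B. subgroup B G \<and> K \<subseteq> B \<and> B \<inter> D = K \<inter> D}"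
  have "\<exists>M\<in>S. \<forall>L\<in>S. M \<subseteq> L \<longrightarrow> L = M"
  proof (rule subset_Zorn_nonempty)
    show "S \<noteq> {}" using K by (auto simp: S_def)
    fix C assume C: "C \<noteq> {}" "subset.chain S C"
    then have CS: "C \<subseteq> S" and lin: "\<And>A B. A \<in> C \<Longrightarrow> B \<in> C \<Longrightarrow> A \<subseteq> B \<or> B \<subseteq> A"
      by (auto simp: subset.chain_def)
    have "subgroup (\<Union>C) G"
    proof (rule subgroupI)
      show "\<Union>C \<subseteq> carrier G" using CS subgroup.subset by (fastforce simp: S_def)
      show "\<Union>C \<noteq> {}" using CS C(1) subgroup.one_closed by (fastforce simp: S_def)
      fix a assume "a \<in> \<Union>C"
      then obtain A where A: "A \<in> C" "a \<in> A" by blast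
      then have sA: "subgroup A G" using CS by (auto simp: S_def)
      then show "inv a \<in> \<Union>C" using A subgroup.m_inv_closed[OF sA] by blast
      fix b assume "b \<in> \<Union>C"
      then obtain B where B: "B \<in> C" "b \<in> B" by blast
      then have sB: "subgroup B G" using CS by (auto simp: S_def)
      show "a \<otimes> b \<in> \<Union>C"
        using lin[OF A(1) B(1)]
      proof
        assume "A \<subseteq> B"
        then have "a \<in> B" using A by blast
        then show ?thesis using B subgroup.m_closed[OF sB] by blast
      next
        assume "B \<subseteq> A"
        then have "b \<in> A" using B by blast
        then show ?thesis using A subgroup.m_closed[OF sA] by blast
      qed
    qed
    moreover have "K \<subseteq> \<Union>C" using C CS by (auto simp: S_def)
    moreover have "\<Union>C \<inter> D = K \<inter> D"
    proof -
      have "A \<inter> D = K \<inter> D" if "A \<in> C" for A using that CS by (auto simp: S_def)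
      then show ?thesis using C(1) by blast
    qed
    ultimately show "\<Union>C \<in> S" by (simp add: S_def)
  qed
  then obtain B where B: "B \<in> S" "\<forall>L\<in>S. B \<subseteq> L \<longrightarrow> L = B" by blast
  have "L = B" if "subgroup L G" "B \<subseteq> L" "L \<inter> D = K \<inter> D" for L
  proof -
    have "L \<in> S" using that B(1) unfolding S_def by blast
    then show ?thesis using B(2) that(2) by blast
  qed
  then show ?thesis using B(1) unfolding S_def by blast
qed

text \<open>If \<open>w\<close> is not in \<open>B\<close>, adjoining it must enlarge the
  intersection with \<open>D\<close>, which yields \<open>d = b w^k\<close> in \<open>D\<close> but
  not in \<open>B\<close>. As \<open>w^p\<close> lies in \<open>B\<close>, \<open>k\<close> is prime
  to \<open>p\<close>, and Bezout coefficients express \<open>w\<close> through \<open>d\<close> and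
  \<open>B\<close>. Thus elements of prime order modulo \<open>B\<close> are represented in
  \<open>D\<close>.\<close>

lemma (in comm_group) prime_pow_mem_maximal_subgroup:
  assumes B: "subgroup B G" and D: "subgroup D G"
    and max: "\<And>L. subgroup L G \<Longrightarrow> B \<subseteq> L \<Longrightarrow> L \<inter> D = B \<inter> D \<Longrightarrow> L = B"
    and p: "prime p" and w: "w \<in> carrier G" "w [^] (p::nat) \<in> B"
  shows "w \<in> D <#> B"
proof (cases "w \<in> B")
  case True
  then show ?thesis
    using subgroup.one_closed[OF D] w(1) by (force simp: mem_set_mult)
next
  case False
  define L where "L = B <#> generate G {w}"
  have sg: "subgroup (generate G {w}) G" using w by (intro generate_is_subgroup) auto
  have L: "subgroup L G" unfolding L_def by (rule mult_subgroups[OF B sg])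
  have BL: "B \<subseteq> L"
  proof
    fix b assume b: "b \<in> B"
    then have "b = b \<otimes> \<one>" using subgroup.mem_carrier[OF B] by simp
    then show "b \<in> L" using b subgroup.one_closed[OF sg] unfolding L_def mem_set_mult by blast
  qed
  have wL: "w \<in> L"
  proof -
    have "w = \<one> \<otimes> w" using w by simp
    moreover have "w \<in> generate G {w}" by (auto intro: generate.incl)
    ultimately show ?thesis using subgroup.one_closed[OF B] unfolding L_def mem_set_mult by blast
  qed
  have "L \<inter> D \<noteq> B \<inter> D" using max[OF L BL] wL False by blast
  then obtain d where d: "d \<in> L" "d \<in> D" "d \<notin> B" using BL by blast
  then obtain b k where b: "b \<in> B" and dk: "d = b \<otimes> w [^] (k::int)"
    unfolding L_def mem_set_mult generate_pow[OF w(1)] by blast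
  note bc = subgroup.mem_carrier[OF B b] and dc = subgroup.mem_carrier[OF D d(2)]
  have wp: "w [^] (int p * j) \<in> B" for j
    using subgroup_int_pow_closed[OF B w(2), of j] w by (simp add: int_pow_int_mult)
  have "\<not> int p dvd k"
  proof
    assume "int p dvd k"
    then obtain j where "k = int p * j" by blast
    then have "d \<in> B" using wp[of j] b dk subgroup.m_closed[OF B] by simp
    then show False using d by simp
  qed
  then have "coprime k (int p)"
    using p by (metis coprime_commute prime_imp_coprime prime_nat_int_transfer)
  then obtain u v where uv: "u * k + v * int p = 1"
    by (metis bezout_int coprime_imp_gcd_eq_1)
  have wk: "w [^] k = inv b \<otimes> d" using dk bc dc w by (simp add: inv_solve_left)
  have "w = w [^] (k * u + int p * v)" using uv w by (simp add: mult.commute)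
  also have "\<dots> = (w [^] k) [^] u \<otimes> w [^] (int p * v)"
    using w by (simp add: int_pow_mult int_pow_pow)
  also have "\<dots> = d [^] u \<otimes> ((inv b) [^] u \<otimes> w [^] (int p * v))"
    unfolding wk using bc dc w by (simp add: int_pow_distrib m_ac)
  finally have "w = d [^] u \<otimes> ((inv b) [^] u \<otimes> w [^] (int p * v))" .
  moreover have "d [^] u \<in> D" by (rule subgroup_int_pow_closed[OF D d(2)])
  moreover have "(inv b) [^] u \<otimes> w [^] (int p * v) \<in> B"
    by (intro subgroup.m_closed[OF B] wp subgroup_int_pow_closed[OF B] subgroup.m_inv_closed[OF B] b)
  ultimately show ?thesis unfolding mem_set_mult by blast
qed

text \<open>The induction runs over the divisors of \<open>M\<close>: one prime at a time is removed from the
  exponent, and the correcting element of \<open>C\<close> is always divisible enough to be moved to the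
  other side.\<close>

lemma (in comm_group) mem_set_mult_of_pow_mem:
  assumes C: "subgroup C G" and K: "subgroup K G" and "M > 0"
    and step: "\<And>p w. prime p \<Longrightarrow> p dvd M \<Longrightarrow> w \<in> carrier G \<Longrightarrow> w [^] p \<in> K \<Longrightarrow>
      w \<in> multiples G (M div p) C <#> K"
    and z: "z \<in> carrier G" "z [^] (M::nat) \<in> K"
  shows "z \<in> C <#> K"
proof -
  have "\<forall>z\<in>carrier G. z [^] k \<in> K \<longrightarrow> z \<in> C <#> K" if "k dvd M" "k > 0" for k :: nat
    using that
  proof (induct k rule: less_induct)
    case (less k)
    show ?case
    proof (intro ballI impI)
      fix z assume z: "z \<in> carrier G" "z [^] k \<in> K"
      show "z \<in> C <#> K"
      proof (cases "k = 1")
        case True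
        then have "z = \<one> \<otimes> z" "z \<in> K" using z by auto
        then show ?thesis using subgroup.one_closed[OF C] unfolding mem_set_mult by blast
      next
        case False
        then obtain p where p: "prime p" "p dvd k" using prime_factor_nat by blast
        then obtain k' where k': "k = p * k'" by blast
        have pos: "p > 1" using p prime_gt_1_nat by blast
        have k'pos: "k' > 0" "k' < k" "k' dvd M" "p dvd M"
          using less.prems k' pos by (auto intro: dvd_trans)
        have "(z [^] k') [^] p \<in> K" using z k' by (simp add: nat_pow_pow mult.commute)
        then have "z [^] k' \<in> multiples G (M div p) C <#> K"
          by (intro step) (use p k'pos z in auto)
        then obtain c b where c: "c \<in> C" and b: "b \<in> K" and eq: "z [^] k' = c [^] (M div p) \<otimes> b"
          by (auto simp: mem_set_mult mem_multiples)
        note cc = subgroup.mem_carrier[OF C c] and bc = subgroup.mem_carrier[OF K b]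
        \<comment> \<open>Hence the correcting element is the \<open>k'\<close>-th power of some
          \<open>c'\<close> in \<open>C\<close>, and \<open>inv c' \<otimes> z\<close> satisfies the
          induction hypothesis for \<open>k'\<close>.\<close>
        have "k' dvd M div p"
          using less.prems(1) k' pos by (metis dvd_mult_imp_div mult.commute)
        then obtain q where q: "M div p = q * k'" by (metis dvd_div_mult_self)
        define c' where "c' = c [^] q"
        have c': "c' \<in> C" "c' \<in> carrier G" "c [^] (M div p) = c' [^] k'"
          using subgroup_pow_closed[OF C c] cc by (auto simp: c'_def nat_pow_pow q)
        have "(inv c' \<otimes> z) [^] k' = b"
          using c' z bc cc eq by (simp add: nat_pow_distrib nat_pow_inv inv_solve_left')
        then have "inv c' \<otimes> z \<in> C <#> K"
          using less.hyps[of k'] k'pos b c' z by auto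
        then obtain a f where af: "a \<in> C" "f \<in> K" "inv c' \<otimes> z = a \<otimes> f"
          unfolding mem_set_mult by blast
        note ac = subgroup.mem_carrier[OF C af(1)] and fc = subgroup.mem_carrier[OF K af(2)]
        have "z = c' \<otimes> (inv c' \<otimes> z)" using c' z by (simp add: m_assoc[symmetric])
        also have "\<dots> = (c' \<otimes> a) \<otimes> f" using af c' ac fc by (simp add: m_assoc)
        finally show ?thesis using subgroup.m_closed[OF C c'(1) af(1)] af(2)
          unfolding mem_set_mult by blast
      qed
    qed
  qed
  from this[of M] show ?thesis using z \<open>M > 0\<close> by auto
qed

text \<open>The two hypotheses say that \<open>h\<close> followed by the quotient map has trivial
  kernel and full image. In the application \<open>h\<close> is the inclusion of one factor of a
  product.\<close>

lemma (in comm_group) iso_quotient_of_complement: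
  assumes F: "group F" and h: "h \<in> hom F G" and B: "subgroup B G"
    and inj: "\<And>x. x \<in> carrier F \<Longrightarrow> h x \<in> B \<Longrightarrow> x = \<one>\<^bsub>F\<^esub>"
    and sur: "\<And>z. z \<in> carrier G \<Longrightarrow> z \<in> h ` carrier F <#> B"
  shows "F \<cong> G Mod B"
proof -
  have nB: "B \<lhd> G" using B by (rule subgroup_imp_normal)
  interpret N: normal B G by fact
  have Q: "group (G Mod B)" by (rule N.factorgroup_is_group)
  define f where "f = (\<lambda>x. B #> h x)"
  have hx: "h x \<in> carrier G" if "x \<in> carrier F" for x using that h by (auto simp: hom_def)
  have f: "f \<in> hom F (G Mod B)"
    using Group.hom_compose[OF h N.r_coset_hom_Mod] by (simp add: f_def comp_def)
  interpret f: group_hom F "G Mod B" f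
    using F Q f by (simp add: group_hom_def group_hom_axioms_def)
  have "inj_on f (carrier F)"
  proof (unfold f.inj_on_one_iff, intro allI impI)
    fix x assume x: "x \<in> carrier F" "f x = \<one>\<^bsub>G Mod B\<^esub>"
    then have "h x \<in> B" using rcos_self[OF hx[OF x(1)] B] by (auto simp: f_def)
    then show "x = \<one>\<^bsub>F\<^esub>" using inj x by blast
  qed
  moreover have "f ` carrier F = carrier (G Mod B)"
  proof
    show "f ` carrier F \<subseteq> carrier (G Mod B)" using f by (auto simp: hom_def)
    show "carrier (G Mod B) \<subseteq> f ` carrier F"
    proof
      fix c assume "c \<in> carrier (G Mod B)"
      then obtain z where z: "z \<in> carrier G" "c = B #> z" by (auto simp: carrier_FactGroup)
      obtain x b where xb: "x \<in> carrier F" "b \<in> B" "z = h x \<otimes> b"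
        using sur[OF z(1)] by (auto simp: mem_set_mult)
      have "z \<in> B #> h x"
        using xb hx[OF xb(1)] subgroup.mem_carrier[OF B xb(2)] by (auto simp: r_coset_def m_comm)
      then have "c = f x" using repr_independence[OF _ hx[OF xb(1)] B] z by (simp add: f_def)
      then show "c \<in> f ` carrier F" using xb by blast
    qed
  qed
  ultimately have "f \<in> iso F (G Mod B)" using f by (simp add: iso_def bij_betw_def)
  then show ?thesis by (auto simp: is_iso_def)
qed

text \<open>A suitable power of any nontrivial element of \<open>H\<close> will do.\<close>

lemma (in group) finite_prime_order:
  assumes "finite (carrier G)" "subgroup H G" "H \<noteq> {\<one>}"
  shows "\<exists>p x. prime p \<and> x \<in> H \<and> x \<noteq> \<one> \<and> x [^] (p::nat) = \<one>"
proof -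
  obtain y where y: "y \<in> H" "y \<noteq> \<one>" using assms subgroup.one_closed by blast
  have yc: "y \<in> carrier G" using y subgroup.mem_carrier[OF assms(2)] by blast
  have pos: "ord y > 0" using ord_ge_1[OF assms(1) yc] by simp
  have "ord y \<noteq> 1" using y yc ord_eq_1 by blast
  then obtain p where p: "prime p" "p dvd ord y" using prime_factor_nat by blast
  then obtain q where q: "ord y = p * q" by blast
  have "y [^] q \<noteq> \<one>"
  proof
    assume "y [^] q = \<one>"
    then have "ord y dvd q" using yc pow_eq_id by blast
    then have "p * q \<le> q" using q pos by (intro dvd_imp_le) auto
    then show False using q pos p prime_gt_1_nat[OF p(1)] by auto
  qed
  moreover have "(y [^] q) [^] p = \<one>"
    using yc pow_ord_eq_1[OF yc] q by (simp add: nat_pow_pow mult.commute)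
  ultimately show ?thesis using p subgroup_pow_closed[OF assms(2) y(1)] by blast
qed

section \<open>Groups over \<open>m\<close>\<close>

text \<open>A nontrivial summand killed by \<open>m\<close> contains some \<open>x\<close> of prime
  order. Writing \<open>x = y^m\<close> and splitting \<open>y\<close> along the summand and its
  complement leaves only the part in the complement, so \<open>x\<close> lies in both. The converse
  is \<open>prime_order_mem_multiples\<close>.\<close>

lemma (in comm_group) is_over_of_prime_order:
  assumes fin: "finite (carrier G)"
    and tor: "\<And>p x. prime (p::nat) \<Longrightarrow> x \<in> carrier G \<Longrightarrow> x [^] p = \<one> \<Longrightarrow> x \<in> multiples G m (carrier G)"
  shows "is_over G m"
proof -
  have False if F1: "direct_summand F1 G" "F1 \<noteq> {\<one>}" "multiples G m F1 = {\<one>}" for F1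
  proof -
    obtain K where s: "subgroup F1 G" and K: "subgroup K G" "F1 \<inter> K = {\<one>}" "F1 <#> K = carrier G"
      using F1(1) by (auto simp: direct_summand_def)
    obtain p x where px: "prime p" "x \<in> F1" "x \<noteq> \<one>" "x [^] (p::nat) = \<one>"
      using finite_prime_order[OF fin s F1(2)] by blast
    have "x \<in> multiples G m (carrier G)" using tor px subgroup.mem_carrier[OF s] by blast
    then obtain y where y: "y \<in> carrier G" "x = y [^] m" by (auto simp: mem_multiples)
    then obtain f k where fk: "f \<in> F1" "k \<in> K" "y = f \<otimes> k" using K(3) by (metis mem_set_mult)
    have "f [^] m = \<one>" using F1(3) multiplesI[OF fk(1), of G m] by auto
    then have "x = k [^] m"
      using y fk subgroup.mem_carrier[OF s fk(1)] subgroup.mem_carrier[OF K(1) fk(2)]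
      by (simp add: nat_pow_distrib)
    then have "x \<in> K" using subgroup_pow_closed[OF K(1) fk(2)] by simp
    then show False using px K by blast
  qed
  then show ?thesis by (auto simp: is_over_def)
qed

lemma (in group) is_over_0:
  assumes "is_over G 0"
  shows "carrier G = {\<one>}"
proof (rule ccontr)
  assume ne: "carrier G \<noteq> {\<one>}"
  have "direct_summand (carrier G) G"
    unfolding direct_summand_def using subgroup_self
    by (intro conjI exI[of _ "{\<one>}"]) (auto simp: triv_subgroup mem_set_mult)
  moreover have "multiples G 0 (carrier G) = {\<one>}" by (auto simp: multiples_def)
  ultimately show False using assms ne unfolding is_over_def by blast
qed

text \<open>If an element \<open>x\<close> of prime order \<open>p\<close> fails to lie in \<open>m G\<close>, write \<open>x = p\<^sup>h y\<close> with \<open>h\<close> maximal;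
  then \<open>y\<close> generates a direct summand that is killed by \<open>m\<close>.\<close>

lemma (in comm_group) prime_order_mem_multiples:
  assumes fin: "finite (carrier G)" and m: "m > 0" and over: "is_over G m"
    and p: "prime (p::nat)" and x: "x \<in> carrier G" "x [^] p = \<one>"
  shows "x \<in> multiples G m (carrier G)"
proof (rule ccontr)
  assume notin: "x \<notin> multiples G m (carrier G)"
  have x1: "x \<noteq> \<one>"
  proof
    assume "x = \<one>"
    then have "x = \<one> [^] m" by simp
    then show False using notin multiplesI[of \<one> "carrier G" G m] by simp
  qed
  define v where "v = multiplicity p m"
  have p1: "p > 1" using p prime_gt_1_nat by blast
  obtain m' where m': "m = p ^ v * m'" "\<not> p dvd m'"
    using multiplicity_decompose'[of m p] m p1 unfolding v_def by auto
  \<comment> \<open>The factor \<open>m'\<close> is prime to \<open>p\<close>, hence acts invertibly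
    on \<open>x\<close>: a \<open>p^v\<close>-th power of order \<open>p\<close> would already be an
    \<open>m\<close>-th power.\<close>
  have "x \<notin> multiples G (p ^ v) (carrier G)"
  proof
    assume "x \<in> multiples G (p ^ v) (carrier G)"
    then obtain y where y: "y \<in> carrier G" "x = y [^] (p ^ v)" by (auto simp: mem_multiples)
    have "coprime (int m') (int p)"
      using p m'(2) by (metis coprime_commute coprime_int_iff prime_imp_coprime)
    then obtain s t where st: "s * int m' + t * int p = 1"
      by (metis bezout_int coprime_imp_gcd_eq_1)
    have "x = x [^] (int m' * s + int p * t)" using st x by (simp add: mult.commute)
    also have "\<dots> = (x [^] m') [^] s"
      using x by (simp add: int_pow_mult int_pow_int flip: int_pow_pow)
    also have "\<dots> = (y [^] s) [^] m"
      using y m' by (simp add: int_pow_pow mult.commute mult.left_commute flip: int_pow_int)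
    finally have "x = (y [^] s) [^] m" .
    then show False using notin multiplesI[of "y [^] s" "carrier G" G m] y by simp
  qed
  moreover have "x \<in> multiples G (p ^ 0) (carrier G)"
    using x by (auto simp: multiples_def)
  ultimately have "\<exists>h<v. x \<in> multiples G (p ^ h) (carrier G) \<and> x \<notin> multiples G (p ^ Suc h) (carrier G)"
    using ex_least_nat_less[of "\<lambda>k. x \<notin> multiples G (p ^ k) (carrier G)" v] by auto
  then obtain h where h: "h < v" "x \<in> multiples G (p ^ h) (carrier G)"
    "x \<notin> multiples G (p ^ Suc h) (carrier G)" by blast
  obtain y where y: "y \<in> carrier G" "x = y [^] (p ^ h)" using h(2) by (auto simp: mem_multiples)
  define M where "M = p ^ Suc h"
  have yM: "y [^] M = \<one>"
  proof -
    have "y [^] M = x [^] p" using y by (simp add: M_def nat_pow_pow mult.commute)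
    then show ?thesis using x by simp
  qed
  define C where "C = generate G {y}"
  define D where "D = generate G {x}"
  have C: "subgroup C G" and D: "subgroup D G"
    unfolding C_def D_def using x y by (auto intro!: generate_is_subgroup)
  have Ck: "C = {y [^] (k::int) |k. k \<in> UNIV}" and Dk: "D = {x [^] (k::int) |k. k \<in> UNIV}"
    unfolding C_def D_def using x y by (auto simp: generate_pow)
  \<comment> \<open>A complement of \<open>C\<close> is sought above \<open>K0\<close>: every
    \<open>M\<close>-th power lies in it, so each \<open>z\<close> can be treated by removing primes
    from \<open>M\<close>, and it avoids \<open>x\<close> by the choice of \<open>h\<close>.\<close>
  define K0 where "K0 = multiples G M (carrier G)"
  have K0: "subgroup K0 G" unfolding K0_def by (rule subgroup_multiples[OF subgroup_self])
  have gen: "x \<in> S" if S: "subgroup S G" and k: "x [^] (k::int) \<in> S" "x [^] k \<noteq> \<one>" for S k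
  proof -
    have "\<not> int p dvd k"
    proof
      assume "int p dvd k"
      then obtain j where "k = int p * j" by blast
      then have "x [^] k = (x [^] p) [^] j" using x by (simp add: int_pow_int_mult)
      then show False using k x by simp
    qed
    then have "coprime k (int p)"
      using p by (metis coprime_commute prime_imp_coprime prime_nat_int_transfer)
    then obtain s t where st: "s * k + t * int p = 1"
      by (metis bezout_int coprime_imp_gcd_eq_1)
    have "x = x [^] (k * s + int p * t)" using st x by (simp add: mult.commute)
    also have "\<dots> = (x [^] k) [^] s"
      using x by (simp add: int_pow_mult int_pow_int flip: int_pow_pow)
    finally show ?thesis using subgroup_int_pow_closed[OF S k(1), of s] by simp
  qed
  have KD: "K0 \<inter> D = {\<one>}"
  proof -
    have "d = \<one>" if "d \<in> K0" "d \<in> D" for d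
      using that gen[OF K0] h(3) unfolding Dk K0_def M_def by blast
    then show ?thesis using subgroup.one_closed[OF K0] subgroup.one_closed[OF D] by blast
  qed
  obtain K where K: "subgroup K G" "K0 \<subseteq> K" "K \<inter> D = K0 \<inter> D"
    and max: "\<forall>L. subgroup L G \<and> K \<subseteq> L \<and> L \<inter> D = K0 \<inter> D \<longrightarrow> L = K"
    using maximal_subgroup[OF K0, of D] by blast
  have xD: "x \<in> D" unfolding D_def by (auto intro: generate.incl)
  have xK: "x \<notin> K" using K(3) KD xD x1 by blast
  have CK: "C <#> K = carrier G"
  proof
    show "C <#> K \<subseteq> carrier G"
      by (rule set_mult_closed[OF subgroup.subset[OF C] subgroup.subset[OF K(1)]])
    show "carrier G \<subseteq> C <#> K"
    proof
      fix z assume z: "z \<in> carrier G"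
      show "z \<in> C <#> K"
      proof (rule mem_set_mult_of_pow_mem[OF C K(1), of M])
        show "M > 0" using p1 by (simp add: M_def)
        show "z [^] M \<in> K" using K(2) multiplesI[OF z, of G M] by (auto simp: K0_def)
        fix q w assume q: "prime q" "q dvd M" and w: "w \<in> carrier G" "w [^] q \<in> K"
        have qp: "q = p" using q p by (metis M_def prime_dvd_power primes_dvd_imp_eq)
        have "w \<in> D <#> K"
          by (rule prime_pow_mem_maximal_subgroup[OF K(1) D _ q(1) w]) (use max K(3) in blast)
        moreover have "D \<subseteq> multiples G (M div q) C"
        proof
          fix d assume "d \<in> D"
          then obtain k where "d = x [^] (k::int)" unfolding Dk by blast
          then have "d = (y [^] k) [^] (M div q)"
            using y p1 by (simp add: qp M_def int_pow_pow mult.commute flip: int_pow_int)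
          then show "d \<in> multiples G (M div q) C" unfolding Ck mem_multiples by blast
        qed
        ultimately show "w \<in> multiples G (M div q) C <#> K" unfolding mem_set_mult by blast
      qed (rule z)
    qed
  qed
  \<comment> \<open>\<open>C\<close> is cyclic of order \<open>p^(h+1)\<close>, and \<open>D\<close>
    is its smallest nontrivial subgroup: every nontrivial \<open>c\<close> has \<open>x\<close>
    among its powers, and \<open>x\<close> is not in \<open>K\<close>.\<close>
  have "c = \<one>" if c: "c \<in> C" "c \<in> K" for c
  proof (rule ccontr)
    assume c1: "c \<noteq> \<one>"
    obtain k where k: "c = y [^] (k::int)" using c(1) unfolding Ck by blast
    then have "k \<noteq> 0" using c1 by auto
    moreover have "\<not> is_unit (int p)" using p1 by simp
    ultimately obtain j u where ju: "k = int p ^ j * u" "\<not> int p dvd u"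
      using multiplicity_decompose'[of k "int p"] by metis
    have "j \<le> h"
    proof (rule ccontr)
      assume "\<not> j \<le> h"
      then have "M dvd p ^ j" by (simp add: M_def le_imp_power_dvd del: power_Suc)
      then obtain i where "p ^ j = M * i" by blast
      then have "int p ^ j = int M * int i" by (metis of_nat_mult of_nat_power)
      then have "c = (y [^] M) [^] (int i * u)"
        using y by (simp add: k ju int_pow_pow mult.assoc flip: int_pow_int)
      then show False using c1 yM by simp
    qed
    have "k * int p ^ (h - j) = u * int p ^ h"
      using \<open>j \<le> h\<close> by (simp add: ju mult.commute flip: power_add)
    then have "c [^] (int p ^ (h - j)) = y [^] (u * int p ^ h)"
      using y by (simp add: k int_pow_pow)
    also have "\<dots> = x [^] u"
      using y by (simp add: int_pow_pow mult.commute flip: int_pow_int)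
    finally have e: "c [^] (int p ^ (h - j)) = x [^] u" .
    have "x [^] u \<noteq> \<one>"
    proof
      assume u1: "x [^] u = \<one>"
      have "coprime u (int p)"
        using p ju(2) by (metis coprime_commute prime_imp_coprime prime_nat_int_transfer)
      then obtain s t where st: "s * u + t * int p = 1"
        by (metis bezout_int coprime_imp_gcd_eq_1)
      have "x = x [^] (u * s + int p * t)" using st x by (simp add: mult.commute)
      also have "\<dots> = (x [^] u) [^] s"
        using x by (simp add: int_pow_mult int_pow_int flip: int_pow_pow)
      finally show False using u1 x1 by simp
    qed
    then have "x \<in> K"
      using gen[OF K(1), of u] subgroup_int_pow_closed[OF K(1) c(2), of "int p ^ (h - j)"] e by simp
    then show False using xK by simp
  qed
  then have "C \<inter> K = {\<one>}" using subgroup.one_closed[OF C] subgroup.one_closed[OF K(1)] by blast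
  then have "direct_summand C G" unfolding direct_summand_def using C K(1) CK by blast
  moreover have "C \<noteq> {\<one>}"
  proof
    assume "C = {\<one>}"
    moreover have "y \<in> C" unfolding C_def by (auto intro: generate.incl)
    ultimately show False using y x1 by simp
  qed
  moreover have "multiples G m C = {\<one>}"
  proof -
    have "M dvd m" using h(1) unfolding M_def m'(1) by (metis Suc_leI dvd_mult2 le_imp_power_dvd)
    then obtain i where i: "m = M * i" by blast
    have "c [^] m = \<one>" if c: "c \<in> C" for c
    proof -
      obtain k where k: "c = y [^] (k::int)" using c unfolding Ck by blast
      have "c [^] m = (y [^] M) [^] (int i * k)"
        using y by (simp add: k i int_pow_pow mult.commute mult.left_commute flip: int_pow_int)
      then show ?thesis using yM by simp
    qed
    then show ?thesis using subgroup.one_closed[OF C] by (force simp: multiples_def)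
  qed
  moreover have "carrier G \<noteq> {\<one>}" using x x1 by blast
  ultimately show False using over unfolding is_over_def by blast
qed

section \<open>Finiteness of torsion, and finite quotients over \<open>m\<close>\<close>

lemma (in comm_group) finite_pow_fibre:
  assumes "finite {x \<in> carrier G. x [^] (p::nat) = \<one>}"
  shows "finite {x \<in> carrier G. x [^] p = a}"
proof (cases "\<exists>x0 \<in> carrier G. x0 [^] p = a")
  case True
  then obtain x0 where x0: "x0 \<in> carrier G" "x0 [^] p = a" by blast
  have "{x \<in> carrier G. x [^] p = a} \<subseteq> (\<lambda>t. x0 \<otimes> t) ` {x \<in> carrier G. x [^] p = \<one>}"
  proof
    fix x assume "x \<in> {x \<in> carrier G. x [^] p = a}"
    then have x: "x \<in> carrier G" "x [^] p = a" by auto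
    have "(inv x0 \<otimes> x) [^] p = \<one>"
      using x x0 by (simp add: nat_pow_distrib nat_pow_inv) (metis l_inv nat_pow_closed)
    moreover have "x = x0 \<otimes> (inv x0 \<otimes> x)" using x x0 by (simp flip: m_assoc)
    ultimately show "x \<in> (\<lambda>t. x0 \<otimes> t) ` {x \<in> carrier G. x [^] p = \<one>}" using x x0 by blast
  qed
  then show ?thesis using assms finite_surj by blast
next
  case False
  then have "{x \<in> carrier G. x [^] p = a} = {}" by blast
  then show ?thesis by (metis finite.emptyI)
qed

lemma (in comm_group) finite_torsion:
  assumes "\<And>p. prime p \<Longrightarrow> finite {x \<in> carrier G. x [^] (p::nat) = \<one>}" and "k > 0"
  shows "finite {x \<in> carrier G. x [^] (k::nat) = \<one>}"
  using \<open>k > 0\<close>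
proof (induct k rule: less_induct)
  case (less k)
  show ?case
  proof (cases "k = 1")
    case True
    have "{x \<in> carrier G. x [^] (1::nat) = \<one>} \<subseteq> {\<one>}" by auto
    then show ?thesis using True finite_subset by blast
  next
    case False
    then obtain p where p: "prime p" "p dvd k" using prime_factor_nat by blast
    then obtain k' where k': "k = p * k'" by blast
    have fin: "finite {x \<in> carrier G. x [^] k' = \<one>}"
      using less p k' prime_gt_1_nat[OF p(1)] by (intro less.hyps) auto
    have "finite {x \<in> carrier G. x [^] p = a}" for a
      by (rule finite_pow_fibre[OF assms(1)[OF p(1)]])
    then have "finite (\<Union>a\<in>{x \<in> carrier G. x [^] k' = \<one>}. {x \<in> carrier G. x [^] p = a})"
      using fin by blast
    moreover have "{x \<in> carrier G. x [^] k = \<one>} \<subseteq>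
        (\<Union>a\<in>{x \<in> carrier G. x [^] k' = \<one>}. {x \<in> carrier G. x [^] p = a})"
      by (auto simp: k' nat_pow_pow)
    ultimately show ?thesis by (rule rev_finite_subset)
  qed
qed

text \<open>Take \<open>B\<close> maximal among the subgroups that meet the
  \<open>m\<close>-multiples in \<open>H\<close>. Maximality makes every element of prime order in
  the quotient an \<open>m\<close>-multiple, so the quotient is over \<open>m\<close>. Its
  \<open>m\<close>-multiples are covered by \<open>W\<close>; hence its \<open>p\<close>-torsion is
  finite for each prime \<open>p\<close>, then its \<open>m\<close>-torsion, and finally the whole
  quotient. For \<open>m = 0\<close> everything is \<open>m\<close>-torsion, and \<open>B\<close> is
  the whole group.\<close>

lemma (in comm_group) exists_over_quotient:
  assumes H: "subgroup H G" "H \<subseteq> multiples G m (carrier G)"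
    and W: "finite W" "W \<subseteq> carrier G" "multiples G m (carrier G) \<subseteq> W <#> H"
  shows "\<exists>B. subgroup B G \<and> multiples G m (carrier G) \<inter> B = H \<and>
    finite (carrier (G Mod B)) \<and> is_over (G Mod B) m"
proof (cases "m = 0")
  case True
  have D: "multiples G m (carrier G) = {\<one>}"
    using True by (auto simp: multiples_def)
  have "carrier (G Mod carrier G) = {\<one>\<^bsub>G Mod carrier G\<^esub>}"
    using coset_join2[OF _ subgroup_self] by (auto simp: carrier_FactGroup)
  moreover have "H = {\<one>}" using H D subgroup.one_closed[OF H(1)] by blast
  ultimately show ?thesis
    using D subgroup_self by (intro exI[of _ "carrier G"]) (auto simp: is_over_def)
next
  case False
  define D where "D = multiples G m (carrier G)"
  have D: "subgroup D G" unfolding D_def by (rule subgroup_multiples[OF subgroup_self])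
  have HD: "H \<inter> D = H" using H by (auto simp: D_def)
  obtain B where B: "subgroup B G" "H \<subseteq> B" "B \<inter> D = H \<inter> D"
    and max: "\<forall>L. subgroup L G \<and> B \<subseteq> L \<and> L \<inter> D = H \<inter> D \<longrightarrow> L = B"
    using maximal_subgroup[OF H(1), of D] by blast
  have nB: "B \<lhd> G" using B(1) by (rule subgroup_imp_normal)
  interpret N: normal B G by fact
  interpret E: comm_group "G Mod B" by (rule abelian_FactGroup[OF B(1)])
  let ?E = "G Mod B"
  have tor: "x \<in> multiples ?E m (carrier ?E)"
    if p: "prime (p::nat)" "x \<in> carrier ?E" "x [^]\<^bsub>?E\<^esub> p = \<one>\<^bsub>?E\<^esub>" for p x
  proof -
    obtain w where w: "w \<in> carrier G" "x = B #> w" using p(2) by (auto simp: carrier_FactGroup)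
    have "B #> (w [^] p) = B" using p(3) w by (simp add: N.FactGroup_pow)
    then have wp: "w [^] p \<in> B" using w rcos_self[OF _ B(1), of "w [^] p"] by auto
    have "w \<in> D <#> B"
      by (rule prime_pow_mem_maximal_subgroup[OF B(1) D _ p(1) w(1) wp]) (use max B(3) in blast)
    then obtain y b where y: "y \<in> carrier G" and b: "b \<in> B" and wy: "w = y [^] m \<otimes> b"
      by (auto simp: D_def mem_set_mult mem_multiples)
    have "w \<in> B #> (y [^] m)"
      using y b subgroup.mem_carrier[OF B(1) b] wy by (auto simp: r_coset_def m_comm)
    then have "x = B #> (y [^] m)" using repr_independence[OF _ _ B(1)] w y by simp
    also have "\<dots> = (B #> y) [^]\<^bsub>?E\<^esub> m" using y by (simp add: N.FactGroup_pow)
    finally show ?thesis using y by (auto simp: carrier_FactGroup mem_multiples)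
  qed
  have "multiples ?E m (carrier ?E) \<subseteq> (\<lambda>w. B #> w) ` W"
  proof
    fix x assume "x \<in> multiples ?E m (carrier ?E)"
    then obtain y where y: "y \<in> carrier G" "x = (B #> y) [^]\<^bsub>?E\<^esub> m"
      by (auto simp: mem_multiples carrier_FactGroup)
    then have xm: "x = B #> (y [^] m)" by (simp add: N.FactGroup_pow)
    have "y [^] m \<in> W <#> H" using W(3) multiplesI[OF y(1)] by blast
    then obtain w h where wh: "w \<in> W" "h \<in> H" "y [^] m = w \<otimes> h"
      by (auto simp: mem_set_mult)
    have wc: "w \<in> carrier G" using wh W(2) by blast
    have "h \<in> B" "h \<in> carrier G" using wh B subgroup.mem_carrier[OF B(1)] by auto
    then have "y [^] m \<in> B #> w" using wh wc by (auto simp: r_coset_def m_comm)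
    then have "x = B #> w" using repr_independence[OF _ wc B(1)] xm by simp
    then show "x \<in> (\<lambda>w. B #> w) ` W" using wh by blast
  qed
  then have finm: "finite (multiples ?E m (carrier ?E))" using W(1) finite_surj by blast
  have finp: "finite {x \<in> carrier ?E. x [^]\<^bsub>?E\<^esub> (p::nat) = \<one>\<^bsub>?E\<^esub>}" if "prime p" for p
    by (rule finite_subset[OF _ finm]) (auto intro: tor[OF that])
  have fint: "finite {x \<in> carrier ?E. x [^]\<^bsub>?E\<^esub> m = \<one>\<^bsub>?E\<^esub>}"
    by (rule E.finite_torsion[OF finp]) (use False in simp_all)
  have "finite (carrier ?E)"
  proof -
    have "finite {x \<in> carrier ?E. x [^]\<^bsub>?E\<^esub> m = a}" for a
      by (rule E.finite_pow_fibre[OF fint])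
    then have "finite (\<Union>a\<in>multiples ?E m (carrier ?E). {x \<in> carrier ?E. x [^]\<^bsub>?E\<^esub> m = a})"
      using finm by blast
    moreover have "carrier ?E \<subseteq> (\<Union>a\<in>multiples ?E m (carrier ?E). {x \<in> carrier ?E. x [^]\<^bsub>?E\<^esub> m = a})"
      by (auto simp: mem_multiples)
    ultimately show ?thesis by (rule rev_finite_subset)
  qed
  moreover have "is_over ?E m" using \<open>finite (carrier ?E)\<close> tor by (rule E.is_over_of_prime_order)
  ultimately show ?thesis using B HD D_def by (intro exI[of _ B]) auto
qed

section \<open>Gluing two groups over \<open>m\<close>\<close>

lemma (in group_hom) subgroup_vimage:
  assumes "subgroup B H"
  shows "subgroup {x \<in> carrier G. h x \<in> B} G"
  by (rule G.subgroupI)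
     (auto simp: subgroup.one_closed[OF assms] subgroup.m_closed[OF assms]
        subgroup.m_inv_closed[OF assms] intro!: exI[of _ "\<one>\<^bsub>G\<^esub>"])

lemma pow_DirProd:
  assumes "group G" "group H" "x \<in> carrier G" "y \<in> carrier H"
  shows "(x, y) [^]\<^bsub>G \<times>\<times> H\<^esub> (k::nat) = (x [^]\<^bsub>G\<^esub> k, y [^]\<^bsub>H\<^esub> k)"
  by (induct k) auto

text \<open>\<open>F1\<close> and \<open>F2\<close> are glued along \<open>m F1 \<cong> m F2\<close>; in a maximal quotient of the product
  in which \<open>m F1\<close> survives, both factors become everything.\<close>

lemma is_over_iso:
  fixes F1 :: "('a, 'b) monoid_scheme" and F2 :: "('c, 'd) monoid_scheme"
  assumes F1: "comm_group F1" "finite (carrier F1)" "is_over F1 m"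
    and F2: "comm_group F2" "finite (carrier F2)" "is_over F2 m" and m: "m > 0"
    and k: "k \<in> hom F1 F2" and ker: "\<And>x. x \<in> carrier F1 \<Longrightarrow> k x = \<one>\<^bsub>F2\<^esub> \<longleftrightarrow> x [^]\<^bsub>F1\<^esub> m = \<one>\<^bsub>F1\<^esub>"
    and im: "k ` carrier F1 = multiples F2 m (carrier F2)"
  shows "F1 \<cong> F2"
proof -
  interpret F1: comm_group F1 by fact
  interpret F2: comm_group F2 by fact
  let ?P = "F1 \<times>\<times> F2"
  have gP: "group ?P" by (rule DirProd_group[OF F1.is_group F2.is_group])
  interpret P: comm_group ?P
    by (intro group.group_comm_groupI gP) (auto simp: F1.m_comm F2.m_comm)
  interpret k: group_hom F1 F2 k using k by (simp add: group_hom_def group_hom_axioms_def F1.is_group F2.is_group)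
  \<comment> \<open>Modulo \<open>\<Gamma>\<close> the element \<open>x^m\<close> of the first
    factor is identified with \<open>k x\<close> in the second.\<close>
  define \<Gamma> where "\<Gamma> = (\<lambda>x. (x [^]\<^bsub>F1\<^esub> m, inv\<^bsub>F2\<^esub> k x)) ` carrier F1"
  have G: "subgroup \<Gamma> ?P"
  proof -
    have "(\<lambda>x. (x [^]\<^bsub>F1\<^esub> m, inv\<^bsub>F2\<^esub> k x)) \<in> hom F1 ?P"
      by (auto simp: hom_def F1.nat_pow_distrib F2.inv_mult)
    then have "group_hom F1 ?P (\<lambda>x. (x [^]\<^bsub>F1\<^esub> m, inv\<^bsub>F2\<^esub> k x))"
      using F1.is_group gP by (simp add: group_hom_def group_hom_axioms_def)
    then show ?thesis unfolding \<Gamma>_def by (rule group_hom.img_is_subgroup)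
  qed
  define D where "D = (\<lambda>x. (x [^]\<^bsub>F1\<^esub> m, \<one>\<^bsub>F2\<^esub>)) ` carrier F1"
  have i1: "(\<lambda>x. (x, \<one>\<^bsub>F2\<^esub>)) \<in> hom F1 ?P" and i2: "(\<lambda>y. (\<one>\<^bsub>F1\<^esub>, y)) \<in> hom F2 ?P"
    by (auto simp: hom_def)
  have gh1: "group_hom F1 ?P (\<lambda>x. (x, \<one>\<^bsub>F2\<^esub>))"
    using F1.is_group gP i1 by (simp add: group_hom_def group_hom_axioms_def)
  have gh2: "group_hom F2 ?P (\<lambda>y. (\<one>\<^bsub>F1\<^esub>, y))"
    using F2.is_group gP i2 by (simp add: group_hom_def group_hom_axioms_def)
  define C1 where "C1 = (\<lambda>x. (x, \<one>\<^bsub>F2\<^esub>)) ` carrier F1"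
  define C2 where "C2 = (\<lambda>y. (\<one>\<^bsub>F1\<^esub>, y)) ` carrier F2"
  have C1: "subgroup C1 ?P" unfolding C1_def by (rule group_hom.img_is_subgroup[OF gh1])
  have C2: "subgroup C2 ?P" unfolding C2_def by (rule group_hom.img_is_subgroup[OF gh2])
  have D: "subgroup D ?P"
  proof -
    have "D = multiples ?P m C1"
      unfolding D_def C1_def multiples_def image_image
      by (intro image_cong refl) (simp add: pow_DirProd F1.is_group F2.is_group)
    then show ?thesis using P.subgroup_multiples[OF C1] by simp
  qed
  obtain B where B: "subgroup B ?P" "\<Gamma> \<subseteq> B" "B \<inter> D = \<Gamma> \<inter> D"
    and max: "\<forall>L. subgroup L ?P \<and> B \<subseteq> L \<and> L \<inter> D = \<Gamma> \<inter> D \<longrightarrow> L = B"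
    using group.maximal_subgroup[OF gP G, of D] by blast
  \<comment> \<open>An element of \<open>\<Gamma>\<close> with trivial second coordinate comes from
    the kernel of \<open>k\<close>, that is from \<open>m\<close>-torsion, so its first coordinate
    is trivial as well.\<close>
  have BD: "x = \<one>\<^bsub>F1\<^esub>" if x: "(x, \<one>\<^bsub>F2\<^esub>) \<in> B" "x \<in> multiples F1 m (carrier F1)" for x
  proof -
    obtain y where y: "y \<in> carrier F1" "x = y [^]\<^bsub>F1\<^esub> m" using x(2) by (auto simp: mem_multiples)
    then have "(x, \<one>\<^bsub>F2\<^esub>) \<in> D" by (auto simp: D_def)
    then have "(x, \<one>\<^bsub>F2\<^esub>) \<in> \<Gamma>" using x(1) B(3) by blast
    then obtain z where z: "z \<in> carrier F1" "(x, \<one>\<^bsub>F2\<^esub>) = (z [^]\<^bsub>F1\<^esub> m, inv\<^bsub>F2\<^esub> k z)"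
      unfolding \<Gamma>_def by blast
    then have xz: "x = z [^]\<^bsub>F1\<^esub> m" and "inv\<^bsub>F2\<^esub> k z = \<one>\<^bsub>F2\<^esub>" by simp_all
    then have "k z = \<one>\<^bsub>F2\<^esub>" using F2.inv_eq_1_iff[OF k.hom_closed[OF z(1)]] by blast
    then show ?thesis using ker[OF z(1)] xz by simp
  qed
  have inj1: "x = \<one>\<^bsub>F1\<^esub>" if x: "x \<in> carrier F1" "(x, \<one>\<^bsub>F2\<^esub>) \<in> B" for x
  proof -
    define N where "N = {x \<in> carrier F1. (x, \<one>\<^bsub>F2\<^esub>) \<in> B}"
    have N: "subgroup N F1" unfolding N_def
      by (rule group_hom.subgroup_vimage[OF gh1 B(1)])
    have "N = {\<one>\<^bsub>F1\<^esub>}"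
    proof (rule ccontr)
      assume "N \<noteq> {\<one>\<^bsub>F1\<^esub>}"
      then obtain p y where y: "prime p" "y \<in> N" "y \<noteq> \<one>\<^bsub>F1\<^esub>" "y [^]\<^bsub>F1\<^esub> (p::nat) = \<one>\<^bsub>F1\<^esub>"
        using F1.finite_prime_order[OF F1(2) N] by blast
      then have "y \<in> multiples F1 m (carrier F1)"
        by (intro F1.prime_order_mem_multiples[OF F1(2) m F1(3)]) (auto simp: N_def)
      then show False using BD y by (auto simp: N_def)
    qed
    then show ?thesis using x by (auto simp: N_def)
  qed
  have inj2: "y = \<one>\<^bsub>F2\<^esub>" if y: "y \<in> carrier F2" "(\<one>\<^bsub>F1\<^esub>, y) \<in> B" for y
  proof -
    define N where "N = {y \<in> carrier F2. (\<one>\<^bsub>F1\<^esub>, y) \<in> B}"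
    have N: "subgroup N F2" unfolding N_def
      by (rule group_hom.subgroup_vimage[OF gh2 B(1)])
    have "N = {\<one>\<^bsub>F2\<^esub>}"
    proof (rule ccontr)
      assume "N \<noteq> {\<one>\<^bsub>F2\<^esub>}"
      then obtain p y where y: "prime p" "y \<in> N" "y \<noteq> \<one>\<^bsub>F2\<^esub>" "y [^]\<^bsub>F2\<^esub> (p::nat) = \<one>\<^bsub>F2\<^esub>"
        using F2.finite_prime_order[OF F2(2) N] by blast
      then have "y \<in> multiples F2 m (carrier F2)"
        by (intro F2.prime_order_mem_multiples[OF F2(2) m F2(3)]) (auto simp: N_def)
      \<comment> \<open>Elements of prime order in \<open>F2\<close> lie in the image of
        \<open>k\<close>, so \<open>\<Gamma>\<close> carries them to \<open>m\<close>-multiples of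
        the first factor, where \<open>BD\<close> applies.\<close>
      then obtain x where x: "x \<in> carrier F1" "y = k x" using im by blast
      have "(x [^]\<^bsub>F1\<^esub> m, inv\<^bsub>F2\<^esub> k x) \<in> B" using B(2) x by (auto simp: \<Gamma>_def)
      then have "(x [^]\<^bsub>F1\<^esub> m, inv\<^bsub>F2\<^esub> k x) \<otimes>\<^bsub>?P\<^esub> (\<one>\<^bsub>F1\<^esub>, y) \<in> B"
        using subgroup.m_closed[OF B(1)] y by (auto simp: N_def)
      then have "(x [^]\<^bsub>F1\<^esub> m, \<one>\<^bsub>F2\<^esub>) \<in> B" using x by simp
      then have "x [^]\<^bsub>F1\<^esub> m = \<one>\<^bsub>F1\<^esub>" by (rule BD) (use x in \<open>auto simp: multiplesI\<close>)
      then show False using ker x y by simp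
    qed
    then show ?thesis using y by (auto simp: N_def)
  qed
  have DB: "w \<in> D <#>\<^bsub>?P\<^esub> B" if "prime (p::nat)" "w \<in> carrier ?P" "w [^]\<^bsub>?P\<^esub> p \<in> B" for p w
    by (rule P.prime_pow_mem_maximal_subgroup[OF B(1) D _ that]) (use max B(3) in blast)
  have sur1: "z \<in> C1 <#>\<^bsub>?P\<^esub> B" if z: "z \<in> carrier ?P" for z
  proof -
    obtain x y where xy: "z = (x, y)" "x \<in> carrier F1" "y \<in> carrier F2" using z by auto
    have "y [^]\<^bsub>F2\<^esub> m \<in> k ` carrier F1" using im xy multiplesI[OF xy(3), of F2 m] by simp
    then obtain x' where x': "x' \<in> carrier F1" "y [^]\<^bsub>F2\<^esub> m = k x'" by blast
    \<comment> \<open>By the choice of \<open>x'\<close> the \<open>m\<close>-th power of this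
      element lies in \<open>\<Gamma>\<close>; modulo \<open>C1\<close> the element itself is the
      inverse of \<open>z\<close>.\<close>
    have "(x', inv\<^bsub>F2\<^esub> y) \<in> C1 <#>\<^bsub>?P\<^esub> B"
    proof (rule P.mem_set_mult_of_pow_mem[OF C1 B(1) m])
      show "(x', inv\<^bsub>F2\<^esub> y) \<in> carrier ?P" using x' xy by simp
      have "(x', inv\<^bsub>F2\<^esub> y) [^]\<^bsub>?P\<^esub> m = (x' [^]\<^bsub>F1\<^esub> m, inv\<^bsub>F2\<^esub> k x')"
        using x' xy by (simp add: pow_DirProd F1.is_group F2.is_group F2.nat_pow_inv)
      then show "(x', inv\<^bsub>F2\<^esub> y) [^]\<^bsub>?P\<^esub> m \<in> B" using B(2) x' by (auto simp: \<Gamma>_def)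
      fix p w assume p: "prime p" "p dvd m" and w: "w \<in> carrier ?P" "w [^]\<^bsub>?P\<^esub> p \<in> B"
      have "D \<subseteq> multiples ?P (m div p) C1"
      proof
        fix d assume "d \<in> D"
        then obtain a where a: "a \<in> carrier F1" "d = (a [^]\<^bsub>F1\<^esub> m, \<one>\<^bsub>F2\<^esub>)" by (auto simp: D_def)
        then have "d = (a [^]\<^bsub>F1\<^esub> p, \<one>\<^bsub>F2\<^esub>) [^]\<^bsub>?P\<^esub> (m div p)"
          using p by (simp add: pow_DirProd F1.is_group F2.is_group F1.nat_pow_pow)
        then show "d \<in> multiples ?P (m div p) C1" using a by (auto simp: C1_def mem_multiples)
      qed
      then show "w \<in> multiples ?P (m div p) C1 <#>\<^bsub>?P\<^esub> B"
        using DB[OF p(1) w] unfolding mem_set_mult by blast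
    qed
    then have i: "inv\<^bsub>?P\<^esub> (x', inv\<^bsub>F2\<^esub> y) \<in> C1 <#>\<^bsub>?P\<^esub> B"
      by (rule subgroup.m_inv_closed[OF P.mult_subgroups[OF C1 B(1)]])
    have "(x \<otimes>\<^bsub>F1\<^esub> x', \<one>\<^bsub>F2\<^esub>) \<in> C1 <#>\<^bsub>?P\<^esub> B"
      using P.mem_set_mult_left[OF B(1), of "(x \<otimes>\<^bsub>F1\<^esub> x', \<one>\<^bsub>F2\<^esub>)" C1] xy(2) x'(1)
      unfolding C1_def by simp
    from subgroup.m_closed[OF P.mult_subgroups[OF C1 B(1)] this i]
    moreover have "(x \<otimes>\<^bsub>F1\<^esub> x', \<one>\<^bsub>F2\<^esub>) \<otimes>\<^bsub>?P\<^esub> inv\<^bsub>?P\<^esub> (x', inv\<^bsub>F2\<^esub> y) = z"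
    proof -
      have "inv\<^bsub>?P\<^esub> (x', inv\<^bsub>F2\<^esub> y) = (inv\<^bsub>F1\<^esub> x', y)"
        using inv_DirProd[OF F1.is_group F2.is_group x'(1) F2.inv_closed[OF xy(3)]] F2.inv_inv[OF xy(3)]
        by simp
      moreover have "x \<otimes>\<^bsub>F1\<^esub> x' \<otimes>\<^bsub>F1\<^esub> inv\<^bsub>F1\<^esub> x' = x"
        using xy(2) x'(1) by (simp add: F1.m_assoc)
      ultimately show ?thesis using xy by simp
    qed
    ultimately show ?thesis by simp
  qed
  have sur2: "z \<in> C2 <#>\<^bsub>?P\<^esub> B" if z: "z \<in> carrier ?P" for z
  proof -
    obtain x y where xy: "z = (x, y)" "x \<in> carrier F1" "y \<in> carrier F2" using z by auto
    have "k x \<in> multiples F2 m (carrier F2)" using im xy by blast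
    then obtain y' where y': "y' \<in> carrier F2" "k x = y' [^]\<^bsub>F2\<^esub> m" by (auto simp: mem_multiples)
    have h: "(x, inv\<^bsub>F2\<^esub> y') \<in> C2 <#>\<^bsub>?P\<^esub> B"
    proof (rule P.mem_set_mult_of_pow_mem[OF C2 B(1) m])
      show "(x, inv\<^bsub>F2\<^esub> y') \<in> carrier ?P" using y' xy by simp
      have "(x, inv\<^bsub>F2\<^esub> y') [^]\<^bsub>?P\<^esub> m = (x [^]\<^bsub>F1\<^esub> m, inv\<^bsub>F2\<^esub> k x)"
        using y' xy by (simp add: pow_DirProd F1.is_group F2.is_group F2.nat_pow_inv)
      then show "(x, inv\<^bsub>F2\<^esub> y') [^]\<^bsub>?P\<^esub> m \<in> B" using B(2) xy by (auto simp: \<Gamma>_def)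
      fix p w assume p: "prime p" "p dvd m" and w: "w \<in> carrier ?P" "w [^]\<^bsub>?P\<^esub> p \<in> B"
      obtain d b where db: "d \<in> D" "b \<in> B" "w = d \<otimes>\<^bsub>?P\<^esub> b"
        using DB[OF p(1) w] unfolding mem_set_mult by blast
      obtain a where a: "a \<in> carrier F1" "d = (a [^]\<^bsub>F1\<^esub> m, \<one>\<^bsub>F2\<^esub>)" using db(1) by (auto simp: D_def)
      have "k a \<in> multiples F2 m (carrier F2)" using im a by blast
      then obtain c where c: "c \<in> carrier F2" "k a = c [^]\<^bsub>F2\<^esub> m" by (auto simp: mem_multiples)
      \<comment> \<open>\<open>D\<close> sits in the first factor, but here a power from
        \<open>C2\<close> is required: \<open>d\<close> is rewritten along \<open>\<Gamma>\<close>
        as \<open>k a\<close>, placed in the second factor, times \<open>?g\<close>, and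
        \<open>k a\<close> is the \<open>m\<close>-th power of \<open>c\<close>.\<close>
      let ?g = "(a [^]\<^bsub>F1\<^esub> m, inv\<^bsub>F2\<^esub> k a)" and ?c = "(\<one>\<^bsub>F1\<^esub>, c [^]\<^bsub>F2\<^esub> p)"
      have "d = ?c [^]\<^bsub>?P\<^esub> (m div p) \<otimes>\<^bsub>?P\<^esub> ?g"
        using a c p by (simp add: pow_DirProd F1.is_group F2.is_group F2.nat_pow_pow)
      then have wd: "w = (?c [^]\<^bsub>?P\<^esub> (m div p) \<otimes>\<^bsub>?P\<^esub> ?g) \<otimes>\<^bsub>?P\<^esub> b"
        using db(3) by (simp only:)
      have g: "?g \<in> B" using B(2) a by (auto simp: \<Gamma>_def)
      have cc: "?c [^]\<^bsub>?P\<^esub> (m div p) \<in> carrier ?P" using c by (intro P.nat_pow_closed) simp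
      have "w = ?c [^]\<^bsub>?P\<^esub> (m div p) \<otimes>\<^bsub>?P\<^esub> (?g \<otimes>\<^bsub>?P\<^esub> b)"
        unfolding wd by (rule P.m_assoc[OF cc subgroup.mem_carrier[OF B(1) g] subgroup.mem_carrier[OF B(1) db(2)]])
      moreover have "?c [^]\<^bsub>?P\<^esub> (m div p) \<in> multiples ?P (m div p) C2"
        using c by (intro multiplesI) (auto simp: C2_def)
      ultimately show "w \<in> multiples ?P (m div p) C2 <#>\<^bsub>?P\<^esub> B"
        using subgroup.m_closed[OF B(1) g db(2)] unfolding mem_set_mult by blast
    qed
    have "(\<one>\<^bsub>F1\<^esub>, y' \<otimes>\<^bsub>F2\<^esub> y) \<in> C2 <#>\<^bsub>?P\<^esub> B"
      using P.mem_set_mult_left[OF B(1), of "(\<one>\<^bsub>F1\<^esub>, y' \<otimes>\<^bsub>F2\<^esub> y)" C2] xy(3) y'(1)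
      unfolding C2_def by simp
    from subgroup.m_closed[OF P.mult_subgroups[OF C2 B(1)] h this]
    moreover have "(x, inv\<^bsub>F2\<^esub> y') \<otimes>\<^bsub>?P\<^esub> (\<one>\<^bsub>F1\<^esub>, y' \<otimes>\<^bsub>F2\<^esub> y) = z"
      using xy y' by (simp flip: F2.m_assoc)
    ultimately show ?thesis by simp
  qed
  have "F1 \<cong> ?P Mod B"
    using P.iso_quotient_of_complement[OF F1.is_group i1 B(1) inj1] sur1 by (simp add: C1_def)
  moreover have "F2 \<cong> ?P Mod B"
    using P.iso_quotient_of_complement[OF F2.is_group i2 B(1) inj2] sur2 by (simp add: C2_def)
  ultimately show ?thesis using F2.iso_sym iso_trans by blast
qed

section \<open>The groups \<open>\<A>\<^sub>n\<close> and their automorphisms\<close>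

lemma hom_eq_on_generate:
  assumes "group G" "group H" and g: "g \<in> hom G H" and h: "h \<in> hom G H"
    and S: "S \<subseteq> carrier G" "\<And>x. x \<in> S \<Longrightarrow> g x = h x" and x: "x \<in> generate G S"
  shows "g x = h x"
proof -
  have g: "group_hom G H g" and h: "group_hom G H h"
    using assms by (auto simp: group_hom_def group_hom_axioms_def)
  show ?thesis
    using x
  proof (induct rule: generate.induct)
    case one
    then show ?case by (simp add: group_hom.hom_one[OF g] group_hom.hom_one[OF h])
  next
    case (incl x)
    then show ?case by (rule S(2))
  next
    case (inv x)
    then have "x \<in> carrier G" using S(1) by blast
    then show ?case by (simp add: group_hom.hom_inv[OF g] group_hom.hom_inv[OF h] S(2) inv)
  next
    case (eng x y)
    then have "x \<in> carrier G" "y \<in> carrier G"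
      using group.generate_incl[OF assms(1) S(1)] by auto
    then show ?case by (simp add: group_hom.hom_mult[OF g] group_hom.hom_mult[OF h] eng)
  qed
qed

lemma (in group) autoD:
  assumes "\<phi> \<in> auto G"
  shows "\<phi> \<in> hom G G" "bij_betw \<phi> (carrier G) (carrier G)" "group_hom G G \<phi>"
  using assms by (auto simp: auto_def Bij_def group_hom_def group_hom_axioms_def)

lemma (in group) countable_generate:
  assumes "countable S" "S \<subseteq> carrier G"
  shows "countable (generate G S)"
proof -
  define val where "val = (\<lambda>l :: (bool \<times> 'a) list. foldr (\<lambda>(b, x) y. (if b then x else inv x) \<otimes> y) l \<one>)"
  define L where "L = lists ((UNIV :: bool set) \<times> S)"
  have closed: "val l \<in> carrier G" if "l \<in> L" for l
    using that assms(2) unfolding L_def by (induct l) (auto simp: val_def)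
  have app: "val (l @ l') = val l \<otimes> val l'" if "l \<in> L" "l' \<in> L" for l l'
    using that(1)
  proof (induct l)
    case Nil
    then show ?case using closed[OF that(2)] by (simp add: val_def)
  next
    case (Cons a l)
    then have "l \<in> L" "snd a \<in> carrier G" using assms(2) by (auto simp: L_def)
    moreover have "val (a # k) = (if fst a then snd a else inv (snd a)) \<otimes> val k" for k
      by (simp add: val_def split_beta)
    ultimately show ?case using Cons closed[OF \<open>l \<in> L\<close>] closed[OF that(2)] by (simp add: m_assoc)
  qed
  have "generate G S \<subseteq> val ` L"
  proof
    fix x assume "x \<in> generate G S"
    then show "x \<in> val ` L"
    proof (induct rule: generate.induct)
      case one
      have "val [] = \<one>" "[] \<in> L" by (auto simp: val_def L_def)
      then show ?case by (metis imageI)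
    next
      case (incl x)
      then have "val [(True, x)] = x" "[(True, x)] \<in> L" using assms(2) by (auto simp: val_def L_def)
      then show ?case by (metis imageI)
    next
      case (inv x)
      then have "val [(False, x)] = inv x" "[(False, x)] \<in> L" using assms(2) by (auto simp: val_def L_def)
      then show ?case by (metis imageI)
    next
      case (eng x y)
      then obtain l l' where "l \<in> L" "l' \<in> L" "x = val l" "y = val l'" by blast
      moreover then have "l @ l' \<in> L" by (simp add: L_def)
      ultimately show ?case using app by (metis imageI)
    qed
  qed
  moreover have "countable L" unfolding L_def using assms(1) by (intro countable_lists countable_SIGMA) auto
  ultimately show ?thesis using countable_image countable_subset by blast
qed

text \<open>The positions of \<open>AA\<close> start at 1 while basis vectors are numbered from 0;
  hence the shift.\<close>

definition unit_vec :: "nat \<Rightarrow> nat \<Rightarrow> int"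
  where "unit_vec i = (\<lambda>j\<in>{1..}. if j = Suc i then 1 else 0)"

lemma group_AA: "group AA" and carrier_AA: "carrier AA = {x \<in> {1..} \<rightarrow>\<^sub>E UNIV. finite {i \<in> {1..}. x i \<noteq> 0}}"
  and mult_AA: "x \<otimes>\<^bsub>AA\<^esub> y = (\<lambda>i\<in>{1..}. x i + y i)" and one_AA: "\<one>\<^bsub>AA\<^esub> = (\<lambda>i\<in>{1..}. 0)"
  by (auto simp: AA_def carrier_sum_group)

lemma comm_group_AA: "comm_group AA"
  by (rule group.group_comm_groupI[OF group_AA]) (auto simp: mult_AA add.commute)

lemma unit_vec_closed: "unit_vec i \<in> carrier AA"
proof -
  have "finite {j \<in> {1..}. unit_vec i j \<noteq> 0}"
    by (rule finite_subset[of _ "{Suc i}"]) (auto simp: unit_vec_def split: if_splits)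
  then show ?thesis by (auto simp: carrier_AA unit_vec_def)
qed

lemma int_pow_AA:
  assumes "x \<in> carrier AA"
  shows "x [^]\<^bsub>AA\<^esub> (k::int) = (\<lambda>i\<in>{1..}. k * x i)"
proof -
  interpret comm_group AA by (rule comm_group_AA)
  have nat: "x [^]\<^bsub>AA\<^esub> (k::nat) = (\<lambda>i\<in>{1..}. int k * x i)" for k
    by (induct k) (auto simp: one_AA mult_AA algebra_simps)
  have inv: "inv\<^bsub>AA\<^esub> y = (\<lambda>i\<in>{1..}. - y i)" if "y \<in> carrier AA" for y
    using that unfolding AA_def by (subst inv_sum_group) auto
  show ?thesis
  proof (cases k rule: int_cases2)
    case (nonneg j)
    show ?thesis unfolding nonneg int_pow_int by (rule nat)
  next
    case (nonpos j)
    have "x [^]\<^bsub>AA\<^esub> k = inv\<^bsub>AA\<^esub> (x [^]\<^bsub>AA\<^esub> j)"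
      unfolding nonpos by (rule int_pow_neg_int[OF assms])
    also have "\<dots> = (\<lambda>i\<in>{1..}. - (x [^]\<^bsub>AA\<^esub> j) i)" by (rule inv[OF nat_pow_closed[OF assms]])
    finally show ?thesis unfolding nonpos nat by (auto simp: restrict_def)
  qed
qed

lemma generate_unit_vec: "generate AA (range unit_vec) = carrier AA"
proof
  interpret comm_group AA by (rule comm_group_AA)
  have sub: "range unit_vec \<subseteq> carrier AA" using unit_vec_closed by auto
  show "generate AA (range unit_vec) \<subseteq> carrier AA" by (rule generate_incl[OF sub])
  have sg: "subgroup (generate AA (range unit_vec)) AA" by (rule generate_is_subgroup[OF sub])
  have "x \<in> generate AA (range unit_vec)" if "x \<in> carrier AA" "card {i \<in> {1..}. x i \<noteq> 0} = c" for c x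
    using that
  proof (induct c arbitrary: x)
    case 0
    then have "{i \<in> {1..}. x i \<noteq> 0} = {}" by (auto simp: carrier_AA)
    then have "x = \<one>\<^bsub>AA\<^esub>" using 0 by (auto simp: one_AA carrier_AA PiE_def extensional_def)
    then show ?case using subgroup.one_closed[OF sg] by simp
  next
    case (Suc c)
    then have ne: "{i \<in> {1..}. x i \<noteq> 0} \<noteq> {}" by (metis card.empty nat.distinct(1))
    then obtain i where i: "i \<ge> 1" "x i \<noteq> 0" by auto
    then obtain j where j: "i = Suc j" by (cases i) auto
    define y where "y = x(i := 0)"
    have fin: "finite {i \<in> {1..}. x i \<noteq> 0}" using Suc by (auto simp: carrier_AA)
    have ys: "{k \<in> {1..}. y k \<noteq> 0} = {k \<in> {1..}. x k \<noteq> 0} - {i}" by (auto simp: y_def)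
    have yc: "y \<in> carrier AA"
      using Suc(2) fin i unfolding carrier_AA ys mem_Collect_eq by (auto simp: y_def PiE_def extensional_def)
    moreover have "card {k \<in> {1..}. y k \<noteq> 0} = c" unfolding ys using Suc(3) fin i by auto
    ultimately have yg: "y \<in> generate AA (range unit_vec)" by (rule Suc(1))
    have "unit_vec j [^]\<^bsub>AA\<^esub> (x i) \<in> generate AA (range unit_vec)"
      by (intro subgroup_int_pow_closed[OF sg] generate.incl) auto
    with yg have "y \<otimes>\<^bsub>AA\<^esub> unit_vec j [^]\<^bsub>AA\<^esub> (x i) \<in> generate AA (range unit_vec)"
      by (rule subgroup.m_closed[OF sg])
    moreover have "y \<otimes>\<^bsub>AA\<^esub> unit_vec j [^]\<^bsub>AA\<^esub> (x i) = x"
      unfolding int_pow_AA[OF unit_vec_closed] using Suc(2) i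
      by (auto simp: mult_AA y_def unit_vec_def j carrier_AA PiE_def extensional_def fun_eq_iff)
    ultimately show ?case by simp
  qed
  then show "carrier AA \<subseteq> generate AA (range unit_vec)" by blast
qed

lemma exists_hom_AA:
  fixes F :: "('c, 'd) monoid_scheme" and f :: "nat \<Rightarrow> 'c"
  assumes "comm_group F" and f: "\<And>i. f i \<in> carrier F"
  shows "\<exists>h \<in> hom AA F. \<forall>i. h (unit_vec i) = f i"
proof -
  interpret F: comm_group F by fact
  \<comment> \<open>Only finitely many factors are nontrivial because \<open>x\<close> has finite
    support, so \<open>gfinprod\<close> is a genuine product; \<open>i - 1\<close> undoes the shift
    in \<open>unit_vec\<close>.\<close>
  define h where "h = (\<lambda>x :: nat \<Rightarrow> int. gfinprod F (\<lambda>i. f (i - 1) [^]\<^bsub>F\<^esub> (x i)) {1..})"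
  have "h \<in> hom AA F"
    unfolding h_def AA_def by (rule F.hom_group_sum) (auto simp: f F.hom_integer_group_pow)
  moreover have "h (unit_vec j) = f j" for j
  proof -
    have "h (unit_vec j) = gfinprod F (\<lambda>i. f (i - 1) [^]\<^bsub>F\<^esub> (unit_vec j i)) {Suc j}"
      unfolding h_def
      by (rule F.gfinprod_mono_neutral_cong_right) (auto simp: unit_vec_def f split: if_splits)
    also have "\<dots> = f j" using f by (subst F.gfinprod_eq_finprod) (auto simp: unit_vec_def)
    finally show ?thesis .
  qed
  ultimately show ?thesis by blast
qed

definition basis :: "nat \<Rightarrow> nat \<Rightarrow> (nat \<Rightarrow> int) set"
  where "basis n i = multiples AA n (carrier AA) #>\<^bsub>AA\<^esub> unit_vec i"

locale AAn_group = comm_group A for A :: "(nat \<Rightarrow> int) set monoid" (structure) +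
  fixes n :: nat
  assumes A_def: "A = AAn n"

lemma AAn_group: "AAn_group (AAn n) n"
proof -
  interpret AA: comm_group AA by (rule comm_group_AA)
  have "comm_group (AAn n)" unfolding AAn_def
    by (rule AA.abelian_FactGroup[OF AA.subgroup_multiples[OF AA.subgroup_self]])
  then show ?thesis by (simp add: AAn_group_def AAn_group_axioms_def)
qed

context AAn_group
begin

abbreviation e :: "nat \<Rightarrow> (nat \<Rightarrow> int) set" where "e \<equiv> basis n"

abbreviation span :: "nat set \<Rightarrow> (nat \<Rightarrow> int) set set" where "span J \<equiv> generate A (e ` J)"

lemma normal_multiples_AA: "multiples AA n (carrier AA) \<lhd> AA"
proof -
  interpret AA: comm_group AA by (rule comm_group_AA)
  show ?thesis by (rule AA.subgroup_imp_normal[OF AA.subgroup_multiples[OF AA.subgroup_self]])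
qed

lemma e_closed [simp]: "e i \<in> carrier A"
  using unit_vec_closed by (auto simp: A_def AAn_def basis_def carrier_FactGroup)

lemma span_closed: "x \<in> span J \<Longrightarrow> x \<in> carrier A"
  by (rule subsetD[OF generate_incl, of "e ` J"]) auto

lemma subgroup_span: "subgroup (span J) A"
  by (rule generate_is_subgroup) auto

lemma e_in_span: "i \<in> J \<Longrightarrow> e i \<in> span J"
  by (auto intro: generate.incl)

lemma span_mono: "I \<subseteq> J \<Longrightarrow> span I \<subseteq> span J"
  by (rule mono_generate) auto

lemma span_UNIV: "span UNIV = carrier A"
proof -
  have h: "(\<lambda>x. multiples AA n (carrier AA) #>\<^bsub>AA\<^esub> x) \<in> hom AA A"
    unfolding A_def AAn_def by (rule normal.r_coset_hom_Mod[OF normal_multiples_AA])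
  then have gh: "group_hom AA A (\<lambda>x. multiples AA n (carrier AA) #>\<^bsub>AA\<^esub> x)"
    using group_AA is_group by (simp add: group_hom_def group_hom_axioms_def)
  have sub: "range unit_vec \<subseteq> carrier AA" using unit_vec_closed by auto
  have "e ` UNIV = (\<lambda>x. multiples AA n (carrier AA) #>\<^bsub>AA\<^esub> x) ` range unit_vec"
    by (auto simp: basis_def)
  then have "span UNIV = (\<lambda>x. multiples AA n (carrier AA) #>\<^bsub>AA\<^esub> x) ` carrier AA"
    using group_hom.generate_img[OF gh sub] unfolding generate_unit_vec by simp
  then show ?thesis by (simp add: A_def AAn_def carrier_FactGroup)
qed

lemma countable_carrier: "countable (carrier A)"
  unfolding span_UNIV[symmetric] by (rule countable_generate) auto

lemma pow_n [simp]: "x \<in> carrier A \<Longrightarrow> x [^] n = \<one>"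
proof -
  assume "x \<in> carrier A"
  then obtain a where a: "a \<in> carrier AA" "x = multiples AA n (carrier AA) #>\<^bsub>AA\<^esub> a"
    by (auto simp: A_def AAn_def carrier_FactGroup)
  interpret AA: comm_group AA by (rule comm_group_AA)
  have "x [^] n = multiples AA n (carrier AA) #>\<^bsub>AA\<^esub> (a [^]\<^bsub>AA\<^esub> n)"
    unfolding A_def AAn_def a(2) by (rule normal.FactGroup_pow[OF normal_multiples_AA a(1)])
  also have "\<dots> = multiples AA n (carrier AA)"
    using a by (intro AA.coset_join2 AA.subgroup_multiples AA.subgroup_self multiplesI) auto
  finally show "x [^] n = \<one>" by (simp add: A_def AAn_def)
qed

text \<open>Universal property of \<open>A\<close>, free on the \<open>e i\<close> among abelian
  groups of exponent dividing \<open>n\<close>: a homomorphism from \<open>AA\<close> to such a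
  group is trivial on \<open>n\<close>-multiples and factors through the quotient. Extensionality
  makes the result an element of \<open>Hom_group\<close>.\<close>

lemma exists_lift:
  fixes F :: "('c, 'd) monoid_scheme" and f :: "nat \<Rightarrow> 'c"
  assumes F: "comm_group F" and exp: "\<And>y. y \<in> carrier F \<Longrightarrow> y [^]\<^bsub>F\<^esub> n = \<one>\<^bsub>F\<^esub>"
    and f: "\<And>i. f i \<in> carrier F"
  shows "\<exists>h. h \<in> hom A F \<and> h \<in> extensional (carrier A) \<and> (\<forall>i. h (e i) = f i)"
proof -
  interpret F: comm_group F by fact
  interpret AA: comm_group AA by (rule comm_group_AA)
  obtain h where h: "h \<in> hom AA F" and hf: "\<forall>i. h (unit_vec i) = f i"
    using exists_hom_AA[OF F, of f] f by blast
  interpret h: group_hom AA F h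
    using h by (simp add: group_hom_def group_hom_axioms_def AA.is_group F.is_group)
  let ?N = "multiples AA n (carrier AA)"
  have sN: "subgroup ?N AA" by (rule AA.subgroup_multiples[OF AA.subgroup_self])
  have "h x = h y" if x: "x \<in> carrier AA" and y: "y \<in> carrier AA" and eq: "?N #>\<^bsub>AA\<^esub> x = ?N #>\<^bsub>AA\<^esub> y" for x y
  proof -
    have "x \<in> ?N #>\<^bsub>AA\<^esub> y" using AA.rcos_self[OF x sN] eq by simp
    then obtain z where z: "z \<in> carrier AA" "x = z [^]\<^bsub>AA\<^esub> n \<otimes>\<^bsub>AA\<^esub> y"
      by (auto simp: r_coset_def multiples_def)
    then show ?thesis using y exp by (simp add: h.hom_nat_pow)
  qed
  then obtain g where g: "g \<in> hom (AA Mod ?N) F" and gh: "\<And>x. x \<in> carrier AA \<Longrightarrow> g (?N #>\<^bsub>AA\<^esub> x) = h x"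
    using FactGroup_universal[OF h normal_multiples_AA] by blast
  have ge: "g (e i) = f i" for i using gh[OF unit_vec_closed] hf by (simp add: basis_def)
  have gA: "g \<in> hom A F" using g by (simp add: A_def AAn_def)
  have "restrict g (carrier A) \<in> hom A F"
    using gA by (auto simp: hom_def Pi_iff)
  then show ?thesis using ge by (intro exI[of _ "restrict g (carrier A)"]) auto
qed

definition lift :: "('c, 'd) monoid_scheme \<Rightarrow> (nat \<Rightarrow> 'c) \<Rightarrow> (nat \<Rightarrow> int) set \<Rightarrow> 'c"
  where "lift F f = (SOME h. h \<in> hom A F \<and> h \<in> extensional (carrier A) \<and> (\<forall>i. h (e i) = f i))"

lemma lift:
  fixes F :: "('c, 'd) monoid_scheme" and f :: "nat \<Rightarrow> 'c"
  assumes "comm_group F" "\<And>y. y \<in> carrier F \<Longrightarrow> y [^]\<^bsub>F\<^esub> n = \<one>\<^bsub>F\<^esub>" "\<And>i. f i \<in> carrier F"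
  shows "lift F f \<in> hom A F" "lift F f \<in> extensional (carrier A)" "lift F f (e i) = f i"
  using someI_ex[OF exists_lift[OF assms], folded lift_def] by auto

lemma hom_eq_on_span:
  assumes "group F" "g \<in> hom A F" "h \<in> hom A F" "\<And>i. i \<in> J \<Longrightarrow> g (e i) = h (e i)" "x \<in> span J"
  shows "g x = h x"
  by (rule hom_eq_on_generate[OF is_group assms(1-3) _ _ assms(5)]) (use assms(4) in auto)

lemma hom_eqI:
  assumes "group F" "g \<in> hom A F" "h \<in> hom A F" "\<And>i. g (e i) = h (e i)" "x \<in> carrier A"
  shows "g x = h x"
  using hom_eq_on_span[OF assms(1-3), of UNIV] assms span_UNIV by auto

abbreviation endo :: "(nat \<Rightarrow> (nat \<Rightarrow> int) set) \<Rightarrow> (nat \<Rightarrow> int) set \<Rightarrow> (nat \<Rightarrow> int) set"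
  where "endo \<equiv> lift A"

lemma endo:
  assumes "\<And>i. f i \<in> carrier A"
  shows "endo f \<in> hom A A" "endo f \<in> extensional (carrier A)" "endo f (e i) = f i"
  using lift[OF comm_group_axioms pow_n assms] by auto

lemma endo_closed: "(\<And>i. f i \<in> carrier A) \<Longrightarrow> x \<in> carrier A \<Longrightarrow> endo f x \<in> carrier A"
  using endo(1)[of f] by (auto simp: hom_def)

lemma finite_subset_span_Int:
  assumes "finite T" "T \<subseteq> span J"
  shows "\<exists>K. T \<subseteq> span (J \<inter> {..<K})"
  using assms
proof (induct T)
  case (insert x T)
  then obtain K where K: "T \<subseteq> span (J \<inter> {..<K})" by auto
  have mono: "span (J \<inter> {..<K}) \<subseteq> span (J \<inter> {..<K'})" if "K \<le> K'" for K K'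
    by (rule span_mono) (use that in auto)
  have "\<exists>L. x \<in> span (J \<inter> {..<L})" if "x \<in> span J"
    using that
  proof (induct rule: generate.induct)
    case one
    then show ?case using generate.one by blast
  next
    case (incl x)
    then obtain i where "i \<in> J" "x = e i" by blast
    then show ?case using e_in_span[of i "J \<inter> {..<Suc i}"] by auto
  next
    case (inv x)
    then obtain i where "i \<in> J" "x = e i" by blast
    then show ?case
      using subgroup.m_inv_closed[OF subgroup_span e_in_span[of i "J \<inter> {..<Suc i}"]] by auto
  next
    case (eng x y)
    then obtain L L' where "x \<in> span (J \<inter> {..<L})" "y \<in> span (J \<inter> {..<L'})" by blast
    then have "x \<in> span (J \<inter> {..<max L L'})" "y \<in> span (J \<inter> {..<max L L'})"
      using mono[OF max.cobounded1[of L L']] mono[OF max.cobounded2[of L' L]] by auto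
    then show ?case using subgroup.m_closed[OF subgroup_span] by blast
  qed
  then obtain L where L: "x \<in> span (J \<inter> {..<L})" using insert by auto
  have "insert x T \<subseteq> span (J \<inter> {..<max K L})" using L K mono[OF max.cobounded1[of K L]] mono[OF max.cobounded2[of L K]] by auto
  then show ?case by blast
qed auto

lemma finite_subset_span:
  assumes "finite T" "T \<subseteq> carrier A"
  shows "\<exists>K. T \<subseteq> span {..<K}"
  using finite_subset_span_Int[of T UNIV] assms span_UNIV by auto

text \<open>Divisibility is detected by the homomorphism to the integers modulo \<open>m\<close>
  that sends every basis vector to 1. It exists because \<open>m\<close> divides \<open>n\<close>;
  for \<open>m = 0\<close> its target is the group of integers.\<close>

lemma e_pow_mem_multiples:
  assumes "m dvd n" "e i [^] d \<in> multiples A m (carrier A)"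
  shows "m dvd d"
proof -
  let ?Z = "integer_mod_group m"
  have Z: "comm_group ?Z" by simp
  have exp: "y [^]\<^bsub>?Z\<^esub> n = \<one>\<^bsub>?Z\<^esub>" for y
    using assms(1) by (cases "m = 0") auto
  define f where "f = (\<lambda>i::nat. 1 mod int m)"
  have fc: "f i \<in> carrier ?Z" for i by (auto simp: f_def carrier_integer_mod_group)
  have h: "lift ?Z f \<in> hom A ?Z" and he: "lift ?Z f (e i) = f i"
    using lift[OF Z exp fc] by auto
  have gh: "group_hom A ?Z (lift ?Z f)" using h is_group by (simp add: group_hom_def group_hom_axioms_def)
  obtain y where y: "y \<in> carrier A" "e i [^] d = y [^] m" using assms(2) by (auto simp: mem_multiples)
  have "lift ?Z f (e i [^] d) = f i [^]\<^bsub>?Z\<^esub> d"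
    using group_hom.hom_nat_pow[OF gh e_closed, of i d] he by simp
  also have "\<dots> = int d mod int m" by (simp add: f_def mod_mult_right_eq)
  finally have "lift ?Z f (e i [^] d) = int d mod int m" .
  moreover have "lift ?Z f (y [^] m) = 0"
    using y by (simp add: group_hom.hom_nat_pow[OF gh])
  ultimately have "int d mod int m = 0" using y by simp
  then show ?thesis by (metis mod_0_imp_dvd of_nat_dvd_iff)
qed

section \<open>Automorphisms from permutations and shears of the basis\<close>

lemma auto_compose:
  assumes "\<phi> \<in> auto A" "\<psi> \<in> auto A"
  shows "compose (carrier A) \<phi> \<psi> \<in> auto A"
  using assms by (auto simp: auto_def intro: hom_compose compose_Bij)

lemma autoI:
  assumes f: "\<And>i. f i \<in> carrier A" and g: "\<And>i. g i \<in> carrier A"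
    and fg: "\<And>i. endo f (g i) = e i" and gf: "\<And>i. endo g (f i) = e i"
  shows "endo f \<in> auto A"
proof -
  have inv: "endo p (endo q x) = x"
    if p: "\<And>i. p i \<in> carrier A" and q: "\<And>i. q i \<in> carrier A"
      and pq: "\<And>i. endo p (q i) = e i" and x: "x \<in> carrier A" for p q x
  proof -
    have c: "compose (carrier A) (endo p) (endo q) \<in> hom A A"
      by (rule hom_compose[OF endo(1)[OF q] endo(1)[OF p]])
    have i: "(\<lambda>x\<in>carrier A. x) \<in> hom A A" using id_in_auto by (simp add: auto_def)
    have "compose (carrier A) (endo p) (endo q) x = (\<lambda>x\<in>carrier A. x) x"
      by (rule hom_eqI[OF is_group c i _ x]) (simp add: compose_eq endo(3)[OF q] pq)
    then show ?thesis using x by (simp add: compose_eq)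
  qed
  have "bij_betw (endo f) (carrier A) (carrier A)"
    by (rule bij_betw_byWitness[where f' = "endo g"])
       (auto simp: inv[OF g f gf] inv[OF f g fg] endo_closed[OF f] endo_closed[OF g])
  then show ?thesis using endo(1,2)[OF f] by (simp add: auto_def Bij_def)
qed

lemma auto_perm:
  assumes p: "bij p"
  shows "endo (\<lambda>i. e (p i)) \<in> auto A"
  by (rule autoI[where g = "\<lambda>i. e (inv_into UNIV p i)"])
     (use p in \<open>auto simp: endo(3) bij_is_inj bij_is_surj surj_f_inv_f\<close>)

lemma endo_shear:
  assumes t: "\<And>i. t i \<in> carrier A" and x: "x \<in> carrier A"
  shows "endo (\<lambda>i. e i \<otimes> t i) x = x \<otimes> endo t x"
proof -
  have lam: "(\<lambda>x\<in>carrier A. x \<otimes> endo t x) \<in> hom A A"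
  proof (rule homI)
    fix x y assume "x \<in> carrier A" "y \<in> carrier A"
    moreover then have "endo t (x \<otimes> y) = endo t x \<otimes> endo t y"
      using endo(1)[OF t] by (auto simp: hom_def)
    ultimately show "(\<lambda>x\<in>carrier A. x \<otimes> endo t x) (x \<otimes> y) =
      (\<lambda>x\<in>carrier A. x \<otimes> endo t x) x \<otimes> (\<lambda>x\<in>carrier A. x \<otimes> endo t x) y"
      by (simp add: endo_closed[OF t] m_ac)
  qed (simp add: endo_closed[OF t])
  have et: "e i \<otimes> t i \<in> carrier A" for i using t by simp
  have "endo (\<lambda>i. e i \<otimes> t i) x = (\<lambda>x\<in>carrier A. x \<otimes> endo t x) x"
    by (rule hom_eqI[OF is_group endo(1)[OF et] lam _ x]) (simp add: endo(3)[OF et] endo(3)[OF t])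
  then show ?thesis using x by simp
qed

text \<open>Additively the map is \<open>1 + N\<close> with \<open>N = endo t\<close>. The
  hypothesis \<open>tt\<close> says \<open>N^2 = 0\<close>, so \<open>1 - N\<close> is the
  inverse.\<close>

lemma auto_shear:
  assumes t: "\<And>i. t i \<in> carrier A" and tt: "\<And>i. endo t (t i) = \<one>"
  shows "endo (\<lambda>i. e i \<otimes> t i) \<in> auto A"
proof (rule autoI[where g = "\<lambda>i. e i \<otimes> inv (t i)"])
  have it: "inv (t i) \<in> carrier A" for i using t by simp
  have gh: "group_hom A A (endo t)"
    using endo(1)[OF t] is_group by (simp add: group_hom_def group_hom_axioms_def)
  have "endo t (e i \<otimes> inv (t i)) = t i" for i
    by (simp add: t group_hom.hom_mult[OF gh] group_hom.hom_inv[OF gh] tt endo(3))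
  then show "endo (\<lambda>i. e i \<otimes> t i) (e i \<otimes> inv (t i)) = e i" for i
    by (simp add: endo_shear t m_assoc)
  have inv: "endo (\<lambda>i. inv (t i)) x = inv (endo t x)" if x: "x \<in> carrier A" for x
  proof -
    have "(\<lambda>x\<in>carrier A. inv (endo t x)) \<in> hom A A"
      by (rule homI) (simp_all add: endo_closed[OF t] group_hom.hom_mult[OF gh] inv_mult)
    from hom_eqI[OF is_group endo(1)[OF it] this _ x]
    have "endo (\<lambda>i. inv (t i)) x = (\<lambda>x\<in>carrier A. inv (endo t x)) x"
      by (simp add: endo(3)[OF it] endo(3)[OF t])
    then show ?thesis using x by simp
  qed
  have "endo t (e i \<otimes> t i) = t i" for i
    by (simp add: t group_hom.hom_mult[OF gh] tt endo(3))
  then show "endo (\<lambda>i. e i \<otimes> inv (t i)) (e i \<otimes> t i) = e i" for i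
    using t by (simp add: endo_shear[OF it] inv m_assoc)
qed (use t in simp_all)

lemma auto_fixes_span:
  assumes "\<phi> \<in> auto A" "\<And>i. i \<in> J \<Longrightarrow> \<phi> (e i) = e i" "x \<in> span J"
  shows "\<phi> x = x"
proof -
  have i: "(\<lambda>x\<in>carrier A. x) \<in> hom A A" using id_in_auto by (simp add: auto_def)
  have "\<phi> x = (\<lambda>x\<in>carrier A. x) x"
    by (rule hom_eq_on_span[OF is_group autoD(1)[OF assms(1)] i _ assms(3)]) (simp add: assms(2))
  then show ?thesis using span_closed[OF assms(3)] by simp
qed

lemma hom_one_on_span:
  assumes "h \<in> hom A A" "\<And>i. i \<in> J \<Longrightarrow> h (e i) = \<one>" "x \<in> span J"
  shows "h x = \<one>"
proof -
  have i: "(\<lambda>x\<in>carrier A. \<one>) \<in> hom A A" by (rule homI) auto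
  have "h x = (\<lambda>x\<in>carrier A. \<one>) x"
    by (rule hom_eq_on_span[OF is_group assms(1) i _ assms(3)]) (simp add: assms(2))
  then show ?thesis using span_closed[OF assms(3)] by simp
qed

lemma hom_image_span:
  assumes "\<phi> \<in> hom A A" "\<And>i. i \<in> I \<Longrightarrow> \<phi> (e i) \<in> span J" "x \<in> span I"
  shows "\<phi> x \<in> span J"
proof -
  have gh: "group_hom A A \<phi>" using assms is_group by (simp add: group_hom_def group_hom_axioms_def)
  have "\<phi> ` span I = generate A (\<phi> ` e ` I)"
    by (rule group_hom.generate_img[OF gh, symmetric]) auto
  also have "\<dots> \<subseteq> span J"
    by (rule generate_subgroup_incl[OF _ subgroup_span]) (use assms(2) in auto)
  finally show ?thesis using assms(3) by blast
qed

text \<open>Euclid's algorithm: the shear of \<open>e j\<close> by \<open>- q\<close> times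
  \<open>e i\<close> replaces \<open>c\<close> by \<open>c mod d\<close>, and the swap of
  \<open>i\<close> and \<open>j\<close> exchanges the two coefficients. The other basis vectors stay
  fixed so that \<open>auto_monomial\<close> can treat one coordinate after another.\<close>

lemma auto_gcd:
  assumes "i \<noteq> j"
  shows "\<exists>\<phi>\<in>auto A. (\<forall>k. k \<noteq> i \<longrightarrow> k \<noteq> j \<longrightarrow> \<phi> (e k) = e k) \<and>
    (\<exists>g::int. \<phi> (e i [^] c \<otimes> e j [^] d) = e i [^] g \<and> g dvd c \<and> g dvd d)"
proof (induct "nat \<bar>d\<bar>" arbitrary: c d rule: less_induct)
  case less
  show ?case
  proof (cases "d = 0")
    case True
    then show ?thesis by (intro bexI[of _ "\<lambda>x\<in>carrier A. x"] conjI exI[of _ c]) (auto simp: id_in_auto)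
  next
    case False
    define q r where "q = c div d" and "r = c mod d"
    have qr: "c = d * q + r" by (simp add: q_def r_def)
    define t where "t = (\<lambda>k. if k = j then e i [^] (- q) else \<one>)"
    have t: "t k \<in> carrier A" for k by (auto simp: t_def)
    have gt: "group_hom A A (endo t)"
      using endo(1)[OF t] is_group by (simp add: group_hom_def group_hom_axioms_def)
    have ti: "endo t (e i) = \<one>" using assms by (simp add: endo(3)[OF t]) (simp add: t_def)
    have "endo t (t k) = \<one>" for k
    proof (cases "k = j")
      case True
      then have "t k = e i [^] (- q)" by (simp add: t_def)
      then show ?thesis using group_hom.hom_int_pow[OF gt e_closed, of i "- q"] ti by simp
    next
      case False
      then have "t k = \<one>" by (simp add: t_def)
      then show ?thesis using group_hom.hom_one[OF gt] by simp
    qed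
    then have \<phi>1: "endo (\<lambda>k. e k \<otimes> t k) \<in> auto A" (is "?\<phi>1 \<in> _") by (rule auto_shear[OF t])
    define p where "p = (\<lambda>k. if k = i then j else if k = j then i else k)"
    have "p (p k) = k" for k by (auto simp: p_def)
    then have "bij p" by (metis involuntory_imp_bij)
    then have \<phi>2: "endo (\<lambda>k. e (p k)) \<in> auto A" (is "?\<phi>2 \<in> _") by (rule auto_perm)
    have "nat \<bar>r\<bar> < nat \<bar>d\<bar>" using False abs_mod_less by (simp add: r_def)
    from less(1)[OF this, of d] obtain \<phi>3 g where \<phi>3: "\<phi>3 \<in> auto A"
      and f3: "\<forall>k. k \<noteq> i \<longrightarrow> k \<noteq> j \<longrightarrow> \<phi>3 (e k) = e k"
      and g: "\<phi>3 (e i [^] d \<otimes> e j [^] r) = e i [^] g" "g dvd d" "g dvd r" by blast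
    let ?\<phi> = "compose (carrier A) \<phi>3 (compose (carrier A) ?\<phi>2 ?\<phi>1)"
    have et: "e k \<otimes> t k \<in> carrier A" for k using t by simp
    have "?\<phi>1 (e i [^] c \<otimes> e j [^] d) = e i [^] r \<otimes> e j [^] d"
    proof -
      note gh = autoD(3)[OF \<phi>1]
      have 1: "?\<phi>1 (e i) = e i" and 2: "?\<phi>1 (e j) = e j \<otimes> e i [^] (- q)"
        using assms by (auto simp: endo(3)[OF et]) (auto simp: t_def)
      have "c = r + q * d" using qr by simp
      then have c: "e i [^] c = e i [^] r \<otimes> e i [^] (q * d)" by (simp add: int_pow_mult)
      have "?\<phi>1 (e i [^] c \<otimes> e j [^] d) = e i [^] c \<otimes> (e j \<otimes> e i [^] (- q)) [^] d"
        by (simp add: group_hom.hom_mult[OF gh] group_hom.hom_int_pow[OF gh] 1 2)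
      also have "\<dots> = e i [^] c \<otimes> (e j [^] d \<otimes> e i [^] (- (q * d)))"
        by (simp add: int_pow_distrib int_pow_pow)
      also have "\<dots> = e i [^] r \<otimes> e j [^] d"
        unfolding c by (simp add: int_pow_neg m_ac r_inv)
      finally show ?thesis .
    qed
    moreover have "?\<phi>2 (e i [^] r \<otimes> e j [^] d) = e i [^] d \<otimes> e j [^] r"
    proof -
      note gh = autoD(3)[OF \<phi>2]
      have "?\<phi>2 (e i) = e j" "?\<phi>2 (e j) = e i" by (auto simp: endo(3) p_def)
      then show ?thesis by (simp add: group_hom.hom_mult[OF gh] group_hom.hom_int_pow[OF gh] m_comm)
    qed
    ultimately have "?\<phi> (e i [^] c \<otimes> e j [^] d) = e i [^] g" using g by (simp add: compose_eq)
    moreover have "\<forall>k. k \<noteq> i \<longrightarrow> k \<noteq> j \<longrightarrow> ?\<phi> (e k) = e k"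
    proof (intro allI impI)
      fix k assume k: "k \<noteq> i" "k \<noteq> j"
      have "?\<phi>1 (e k) = e k" using k by (simp add: endo(3)[OF et]) (simp add: t_def)
      moreover have "?\<phi>2 (e k) = e k" using k by (simp add: endo(3) p_def)
      ultimately show "?\<phi> (e k) = e k" using f3 k by (simp add: compose_eq)
    qed
    moreover have "?\<phi> \<in> auto A" by (intro auto_compose \<phi>1 \<phi>2 \<phi>3)
    moreover have "g dvd c" using g qr by simp
    ultimately show ?thesis using g(2) by blast
  qed
qed

lemma span_insert:
  assumes "x \<in> span (insert j J)"
  shows "\<exists>y\<in>span J. \<exists>d::int. x = y \<otimes> e j [^] d"
  using assms
proof (induct rule: generate.induct)
  case one
  have "\<one> = \<one> \<otimes> e j [^] (0::int)" by simp
  then show ?case using generate.one by blast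
next
  case (incl x)
  then consider "x = e j" | i where "i \<in> J" "x = e i" by auto
  then show ?case
  proof cases
    case 1
    then have "x = \<one> \<otimes> e j [^] (1::int)" by simp
    then show ?thesis using generate.one by blast
  next
    case 2
    then have "x = x \<otimes> e j [^] (0::int)" "x \<in> span J" using e_in_span by auto
    then show ?thesis by blast
  qed
next
  case (inv x)
  then consider "x = e j" | i where "i \<in> J" "x = e i" by auto
  then show ?case
  proof cases
    case 1
    then have "inv x = \<one> \<otimes> e j [^] (- 1::int)" by (simp add: int_pow_neg)
    then show ?thesis using generate.one by blast
  next
    case 2
    then have "inv x = inv x \<otimes> e j [^] (0::int)" "inv x \<in> span J"
      using e_in_span subgroup.m_inv_closed[OF subgroup_span] by auto
    then show ?thesis by blast
  qed
next
  case (eng x y)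
  then obtain a b and c d :: int where *: "a \<in> span J" "b \<in> span J"
    "x = a \<otimes> e j [^] c" "y = b \<otimes> e j [^] d" by blast
  have "x \<otimes> y = (a \<otimes> b) \<otimes> e j [^] (c + d)"
    using * span_closed[OF *(1)] span_closed[OF *(2)] by (simp add: int_pow_mult m_ac)
  then show ?case using * subgroup.m_closed[OF subgroup_span *(1,2)] by blast
qed

text \<open>By induction on the support: the lower part of \<open>x\<close> is first moved to a
  multiple of \<open>e 0\<close>, then \<open>auto_gcd\<close> absorbs the top coordinate.\<close>

lemma auto_monomial:
  assumes "x \<in> carrier A"
  shows "\<exists>\<phi>\<in>auto A. \<exists>d::int. \<phi> x = e 0 [^] d"
proof -
  \<comment> \<open>The induction also records that the basis vectors from \<open>Suc K\<close> on
    are fixed; otherwise the top coordinate would be disturbed while the lower ones are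
    treated.\<close>
  have "\<exists>\<phi>\<in>auto A. (\<forall>k\<ge>Suc K. \<phi> (e k) = e k) \<and> (\<exists>d::int. \<phi> x = e 0 [^] d)" if "x \<in> span {..<Suc K}" for K x
    using that
  proof (induct K arbitrary: x)
    case 0
    then have "x \<in> span (insert 0 {})" by (simp add: lessThan_Suc)
    then obtain y and d :: int where "y \<in> span {}" "x = y \<otimes> e 0 [^] d" using span_insert by blast
    then have "x = e 0 [^] d" by (simp add: generate_empty)
    then show ?case by (intro bexI[of _ "\<lambda>x\<in>carrier A. x"]) (auto simp: id_in_auto)
  next
    case (Suc K)
    then have "x \<in> span (insert (Suc K) {..<Suc K})" by (simp add: lessThan_Suc)
    then obtain y and d :: int where y: "y \<in> span {..<Suc K}" "x = y \<otimes> e (Suc K) [^] d"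
      using span_insert by blast
    obtain \<phi> c where \<phi>: "\<phi> \<in> auto A" "\<forall>k\<ge>Suc K. \<phi> (e k) = e k" "\<phi> y = e 0 [^] (c::int)"
      using Suc(1)[OF y(1)] by blast
    obtain \<psi> g where \<psi>: "\<psi> \<in> auto A" "\<forall>k. k \<noteq> 0 \<longrightarrow> k \<noteq> Suc K \<longrightarrow> \<psi> (e k) = e k"
      "\<psi> (e 0 [^] c \<otimes> e (Suc K) [^] d) = e 0 [^] (g::int)"
      using auto_gcd[of 0 "Suc K" c d] by auto
    note gh = autoD(3)[OF \<phi>(1)]
    have "\<phi> x = e 0 [^] c \<otimes> e (Suc K) [^] d"
      using y(2) span_closed[OF y(1)] \<phi>
      by (simp add: group_hom.hom_mult[OF gh] group_hom.hom_int_pow[OF gh])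
    moreover have "x \<in> carrier A" using y span_closed[OF y(1)] by simp
    ultimately have "compose (carrier A) \<psi> \<phi> x = e 0 [^] g" using \<psi> by (simp add: compose_eq)
    moreover have "\<forall>k\<ge>Suc (Suc K). compose (carrier A) \<psi> \<phi> (e k) = e k"
      using \<phi>(2) \<psi>(2) by (simp add: compose_eq)
    ultimately show ?case using auto_compose[OF \<psi>(1) \<phi>(1)] by blast
  qed
  moreover obtain K where "x \<in> span {..<K}" using finite_subset_span[of "{x}"] assms by auto
  then have "x \<in> span {..<Suc K}" using span_mono[of "{..<K}" "{..<Suc K}"] by auto
  ultimately show ?thesis by blast
qed

text \<open>Let \<open>e\<^sub>j\<^sub>*\<close> be basis vectors outside all supports in sight. The automorphism is the composition of
  \<open>e\<^sub>j \<leftrightarrow> e\<^sub>j\<^sub>*\<close>, of \<open>e\<^sub>j\<^sub>* \<mapsto> e\<^sub>j\<^sub>* \<phi>(e\<^sub>j)\<close>, and of a shear that cancels \<open>e\<^sub>j\<^sub>*\<close> by reading off the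
  coordinates of \<open>\<phi>\<^sup>-\<^sup>1\<close>.\<close>

lemma auto_finitary:
  assumes \<phi>: "\<phi> \<in> auto A"
  shows "\<exists>\<psi>\<in>auto A. \<exists>L. (\<forall>x\<in>span {..<K}. \<psi> x = \<phi> x) \<and> (\<forall>i\<ge>L. \<psi> (e i) = e i)"
proof -
  have phc: "\<phi> x \<in> carrier A" if "x \<in> carrier A" for x using autoD(2)[OF \<phi>] that by (auto simp: bij_betw_def)
  have "\<phi> ` e ` {..<K} \<subseteq> carrier A" using phc by auto
  then obtain K0 where K0: "\<phi> ` e ` {..<K} \<subseteq> span {..<K0}"
    using finite_subset_span[of "\<phi> ` e ` {..<K}"] by auto
  \<comment> \<open>The vectors \<open>e (j + L)\<close>, \<open>j < K\<close>, play the role of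
    \<open>e\<^sub>j\<^sub>*\<close>. Their indices exceed both the moved indices \<open>j\<close>
    and the supports of all \<open>\<phi> (e j)\<close>.\<close>
  define L where "L = max K0 K"
  have LK: "L \<ge> K" by (simp add: L_def)
  have KL: "\<phi> (e i) \<in> span {..<L}" if "i < K" for i
    using that K0 span_mono[of "{..<K0}" "{..<L}"] by (auto simp: L_def)
  define \<phi>' where "\<phi>' = inv_into (carrier A) \<phi>"
  have \<phi>': "\<phi>' x \<in> carrier A" "\<phi> (\<phi>' x) = x" if "x \<in> carrier A" for x
    using autoD(2)[OF \<phi>] that inv_into_into[of x \<phi> "carrier A"] f_inv_into_f[of x \<phi> "carrier A"]
    unfolding \<phi>'_def bij_betw_def by simp_all
  have \<phi>'\<phi>: "\<phi>' (\<phi> x) = x" if "x \<in> carrier A" for x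
    using autoD(2)[OF \<phi>] that unfolding \<phi>'_def bij_betw_def by auto
  define p where "p = (\<lambda>i. if i < K then i + L else if L \<le> i \<and> i < L + K then i - L else i)"
  have pp: "p (p i) = i" for i using LK by (auto simp: p_def)
  then have "bij p" by (metis involuntory_imp_bij)
  then have \<psi>1: "endo (\<lambda>i. e (p i)) \<in> auto A" (is "?\<psi>1 \<in> _") by (rule auto_perm)
  define t where "t = (\<lambda>i. if L \<le> i \<and> i < L + K then \<phi> (e (i - L)) else \<one>)"
  have t: "t i \<in> carrier A" for i by (auto simp: t_def phc)
  have t0: "endo t x = \<one>" if "x \<in> span {..<L}" for x
    by (rule hom_one_on_span[OF endo(1)[OF t] _ that]) (simp add: endo(3)[OF t], simp add: t_def)
  have tL: "t i \<in> span {..<L}" for i by (auto simp: t_def intro: KL generate.one)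
  have \<psi>2: "endo (\<lambda>i. e i \<otimes> t i) \<in> auto A" (is "?\<psi>2 \<in> _") by (rule auto_shear[OF t t0[OF tL]])
  define j where "j = (\<lambda>i. if i < K then e (i + L) else \<one>)"
  have j: "j i \<in> carrier A" for i by (auto simp: j_def)
  have jL: "j i \<in> span {L..}" for i by (auto simp: j_def intro: generate.one e_in_span)
  have jspan: "endo j x \<in> span {L..}" if "x \<in> carrier A" for x
    by (rule hom_image_span[OF endo(1)[OF j], of UNIV])
       (use that span_UNIV jL in \<open>simp_all add: endo(3)[OF j]\<close>)
  \<comment> \<open>\<open>endo j\<close> copies the first \<open>K\<close> coordinates to the
    starred block. Hence \<open>endo u\<close> sends \<open>\<phi> (e i)\<close>,
    \<open>i < K\<close>, to the inverse of \<open>e (i + L)\<close>, which is the cancellation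
    needed. As \<open>u\<close> is trivial from \<open>L\<close> on, the shear is invertible and
    moves finitely many basis vectors.\<close>
  define u where "u = (\<lambda>i. if i < L then inv (endo j (\<phi>' (e i))) else \<one>)"
  have u: "u i \<in> carrier A" for i by (auto simp: u_def intro!: endo_closed[OF j] \<phi>')
  have uL: "u i \<in> span {L..}" for i
    by (auto simp: u_def intro!: subgroup.m_inv_closed[OF subgroup_span] jspan \<phi>' generate.one)
  have u0: "endo u x = \<one>" if "x \<in> span {L..}" for x
    by (rule hom_one_on_span[OF endo(1)[OF u] _ that]) (simp add: endo(3)[OF u], simp add: u_def)
  have \<psi>3: "endo (\<lambda>i. e i \<otimes> u i) \<in> auto A" (is "?\<psi>3 \<in> _") by (rule auto_shear[OF u u0[OF uL]])
  have ueq: "endo u x = inv (endo j (\<phi>' x))" if x: "x \<in> span {..<L}" for x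
  proof -
    have gj: "group_hom A A (endo j)"
      using endo(1)[OF j] is_group by (simp add: group_hom_def group_hom_axioms_def)
    have h: "(\<lambda>x\<in>carrier A. inv (endo j (\<phi>' x))) \<in> hom A A"
    proof (rule homI)
      fix x y assume xy: "x \<in> carrier A" "y \<in> carrier A"
      have "\<phi> (\<phi>' x \<otimes> \<phi>' y) = x \<otimes> y"
        using xy \<phi>' by (simp add: group_hom.hom_mult[OF autoD(3)[OF \<phi>]])
      then have "\<phi>' (x \<otimes> y) = \<phi>' x \<otimes> \<phi>' y" using \<phi>'\<phi>[of "\<phi>' x \<otimes> \<phi>' y"] xy \<phi>' by simp
      then show "(\<lambda>x\<in>carrier A. inv (endo j (\<phi>' x))) (x \<otimes> y) =
        (\<lambda>x\<in>carrier A. inv (endo j (\<phi>' x))) x \<otimes> (\<lambda>x\<in>carrier A. inv (endo j (\<phi>' x))) y"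
        using xy \<phi>' by (simp add: group_hom.hom_mult[OF gj] inv_mult endo_closed[OF j])
    qed (simp add: endo_closed[OF j] \<phi>')
    have "endo u x = (\<lambda>x\<in>carrier A. inv (endo j (\<phi>' x))) x"
      by (rule hom_eq_on_span[OF is_group endo(1)[OF u] h _ x]) (simp add: endo(3)[OF u], simp add: u_def)
    then show ?thesis using span_closed[OF x] by simp
  qed
  let ?\<psi> = "compose (carrier A) ?\<psi>3 (compose (carrier A) ?\<psi>2 ?\<psi>1)"
  have \<psi>: "?\<psi> \<in> auto A" by (intro auto_compose \<psi>1 \<psi>2 \<psi>3)
  have et: "e k \<otimes> t k \<in> carrier A" and eu: "e k \<otimes> u k \<in> carrier A" for k using t u by auto
  have "?\<psi> (e i) = \<phi> (e i)" if i: "i < K" for i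
  proof -
    have "?\<psi>1 (e i) = e (i + L)" using i by (simp add: endo(3) p_def)
    moreover have "?\<psi>2 (e (i + L)) = e (i + L) \<otimes> \<phi> (e i)"
      using i by (simp add: endo(3)[OF et]) (simp add: t_def)
    moreover have "?\<psi>3 (e (i + L) \<otimes> \<phi> (e i)) = \<phi> (e i)"
    proof -
      have 1: "?\<psi>3 (e (i + L)) = e (i + L)" by (simp add: endo(3)[OF eu]) (simp add: u_def)
      have "?\<psi>3 (\<phi> (e i)) = \<phi> (e i) \<otimes> endo u (\<phi> (e i))" by (rule endo_shear[OF u phc]) simp
      also have "endo u (\<phi> (e i)) = inv (e (i + L))"
        using i by (simp add: ueq[OF KL[OF i]] \<phi>'\<phi> endo(3)[OF j]) (simp add: j_def)
      finally show ?thesis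
        using phc[of "e i"] by (simp add: group_hom.hom_mult[OF autoD(3)[OF \<psi>3]] 1 m_lcomm)
    qed
    ultimately show ?thesis by (simp add: compose_eq phc)
  qed
  then have "\<forall>x\<in>span {..<K}. ?\<psi> x = \<phi> x"
    using hom_eq_on_span[OF is_group autoD(1)[OF \<psi>] autoD(1)[OF \<phi>], of "{..<K}"] by auto
  moreover have "\<forall>i\<ge>L + K. ?\<psi> (e i) = e i"
  proof (intro allI impI)
    fix i assume i: "L + K \<le> i"
    have "?\<psi>1 (e i) = e i" using i by (simp add: endo(3) p_def)
    moreover have "?\<psi>2 (e i) = e i" using i by (simp add: endo(3)[OF et]) (simp add: t_def)
    moreover have "?\<psi>3 (e i) = e i" using i by (simp add: endo(3)[OF eu]) (simp add: u_def)
    ultimately show "?\<psi> (e i) = e i" by (simp add: compose_eq)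
  qed
  ultimately show ?thesis using \<psi> by blast
qed

end

section \<open>Borel sets of spaces of functions and subgroups\<close>

lemma space_borel_of [simp]: "space (borel_of T) = topspace T"
  by (simp add: borel_of_def space_measure_of_conv)

lemma sets_borel_of: "sets (borel_of T) = sigma_sets (topspace T) {U. openin T U}"
  unfolding borel_of_def by (rule sets_measure_of) (auto dest: openin_subset)

text \<open>With countably many coordinates and values there are only countably many boxes, so each
  open set is a countable union of finite intersections of the generators. Covers both
  \<open>Sub\<close>, with truth values, and \<open>Hom_topology\<close>, with values in
  \<open>F\<close>.\<close>

lemma sets_borel_of_pullback_product:
  assumes I: "countable I" and D: "countable D" and f: "\<And>a. a \<in> A \<Longrightarrow> f a \<in> I \<rightarrow>\<^sub>E D"
  defines "T \<equiv> pullback_topology A f (product_topology (\<lambda>_. discrete_topology D) I)"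
  shows "topspace T = A" and "sets (borel_of T) = sigma_sets A {{a \<in> A. f a i = d} |i d. i \<in> I \<and> d \<in> D}"
proof -
  let ?P = "product_topology (\<lambda>_. discrete_topology D) I"
  let ?G = "{{a \<in> A. f a i = d} |i d. i \<in> I \<and> d \<in> D}"
  show T: "topspace T = A" using f by (auto simp: T_def topspace_pullback_topology)
  have "?G \<subseteq> {U. openin T U}"
  proof
    fix U assume "U \<in> ?G"
    then obtain i d where U: "U = {a \<in> A. f a i = d}" and i: "i \<in> I" "d \<in> D" by blast
    define B where "B = (\<Pi>\<^sub>E j\<in>I. if j = i then {d} else D)"
    have "openin ?P B"
      unfolding B_def openin_PiE_gen
    proof (intro disjI2 conjI ballI)
      show "finite {j \<in> I. (if j = i then {d} else D) \<noteq> topspace (discrete_topology D)}"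
        by (rule finite_subset[of _ "{i}"]) auto
    qed (use i in auto)
    moreover have "U = f -` B \<inter> A"
    proof -
      have "f a \<in> B \<longleftrightarrow> f a i = d" if "a \<in> A" for a
        using f[OF that] i by (auto simp: B_def PiE_iff split: if_splits)
      then show ?thesis unfolding U by blast
    qed
    ultimately show "U \<in> {U. openin T U}" unfolding T_def by (auto simp: openin_pullback_topology)
  qed
  then have 1: "sigma_sets A ?G \<subseteq> sets (borel_of T)"
    unfolding sets_borel_of T by (rule sigma_sets_mono')
  define M where "M = sigma A ?G"
  have setsM: "sets M = sigma_sets A ?G" and spaceM: "space M = A"
    unfolding M_def by (rule sets_measure_of space_measure_of; auto)+
  have gen: "{a \<in> space M. f a i = d} \<in> sets M" if "i \<in> I" "d \<in> D" for i d
    unfolding setsM spaceM using that by (intro sigma_sets.Basic) blast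
  have "openin T U \<Longrightarrow> U \<in> sets M" for U
  proof -
    assume "openin T U"
    then obtain V where V: "openin ?P V" "U = f -` V \<inter> A"
      unfolding T_def openin_pullback_topology by blast
    define S where "S = (SIGMA J:{J. finite J \<and> J \<subseteq> I}. J \<rightarrow>\<^sub>E D)"
    define box where "box = (\<lambda>(J, c). {a \<in> space M. \<forall>j\<in>J. f a j = c j})"
    have S: "countable S" unfolding S_def
      by (intro countable_SIGMA countable_Collect_finite_subset I) (auto intro!: countable_PiE D)
    have box: "box s \<in> sets M" if "s \<in> S" for s
    proof -
      obtain J c where s: "s = (J, c)" by force
      have J: "finite J" "J \<subseteq> I" "c \<in> J \<rightarrow>\<^sub>E D" using that by (auto simp: S_def s)
      have "{a \<in> space M. \<forall>j\<in>J. f a j = c j} \<in> sets M"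
        by (rule sets.sets_Collect_finite_All[OF _ J(1)], rule gen) (use J in auto)
      then show ?thesis by (simp add: box_def s)
    qed
    have "U = \<Union> (box ` {s \<in> S. box s \<subseteq> U})"
    proof
      show "U \<subseteq> \<Union> (box ` {s \<in> S. box s \<subseteq> U})"
      proof
        fix a assume a: "a \<in> U"
        then have aA: "a \<in> A" "f a \<in> V" using V by auto
        obtain W where W: "finite {i \<in> I. W i \<noteq> D}" "f a \<in> Pi\<^sub>E I W" "Pi\<^sub>E I W \<subseteq> V"
          using V(1)[unfolded openin_product_topology_alt, rule_format, OF aA(2)] by auto
        define J where "J = {i \<in> I. W i \<noteq> D}"
        define s where "s = (J, restrict (f a) J)"
        have s: "s \<in> S" using W(1) f[OF aA(1)] by (auto simp: S_def s_def J_def)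
        have "b \<in> U" if b: "b \<in> box s" for b
        proof -
          have bA: "b \<in> A" and bj: "\<And>j. j \<in> J \<Longrightarrow> f b j = f a j"
            using b by (auto simp: box_def s_def spaceM)
          have "f b i \<in> W i" if "i \<in> I" for i
          proof (cases "i \<in> J")
            case True
            then show ?thesis using bj W(2) that by auto
          next
            case False
            then have "W i = D" using that by (auto simp: J_def)
            then show ?thesis using f[OF bA] that by auto
          qed
          then have "f b \<in> Pi\<^sub>E I W" using f[OF bA] by (auto simp: PiE_def)
          then show ?thesis using V W bA by auto
        qed
        moreover have "a \<in> box s" using aA by (auto simp: box_def s_def spaceM)
        ultimately show "a \<in> \<Union> (box ` {s \<in> S. box s \<subseteq> U})" using s by blast
      qed
    qed blast
    also have "\<dots> \<in> sets M"
      by (intro sets.countable_UN' countable_subset[OF _ S]) (use box in auto)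
    finally show "U \<in> sets M" .
  qed
  then have "sets (borel_of T) \<subseteq> sets M"
    unfolding sets_borel_of T using spaceM by (intro sets.sigma_sets_subset') auto
  with 1 setsM show "sets (borel_of T) = sigma_sets A ?G" by auto
qed

section \<open>Events in the space of subgroups\<close>

definition subgroups :: "('a, 'b) monoid_scheme \<Rightarrow> 'a set set"
  where "subgroups G = {H. subgroup H G}"

text \<open>For finite \<open>S\<close> these events are closed under intersection and generate the
  Borel sets, so laws of random subgroups are compared on them alone.\<close>

definition containing :: "('a, 'b) monoid_scheme \<Rightarrow> 'a set \<Rightarrow> 'a set set"
  where "containing G S = {H \<in> subgroups G. S \<subseteq> H}"

text \<open>For finite \<open>T\<close> inside the carrier these are the cylinder events: finite
  unions of atoms fixing \<open>H \<inter> T\<close>.\<close>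

definition depends_on :: "('a, 'b) monoid_scheme \<Rightarrow> 'a set \<Rightarrow> 'a set set \<Rightarrow> bool"
  where "depends_on G T E \<longleftrightarrow> E \<subseteq> subgroups G \<and>
    (\<forall>H\<in>subgroups G. \<forall>H'\<in>subgroups G. H \<inter> T = H' \<inter> T \<longrightarrow> H \<in> E \<longrightarrow> H' \<in> E)"

lemma
  fixes G :: "('a, 'b) monoid_scheme"
  assumes G: "countable (carrier G)"
  shows topspace_Sub: "topspace (Sub G) = subgroups G"
    and sets_borel_Sub: "sets (borel_of (Sub G)) =
      sigma_sets (subgroups G) {containing G S |S. finite S \<and> S \<subseteq> carrier G}"
proof -
  let ?f = "\<lambda>H. \<lambda>x\<in>carrier G. x \<in> H"
  let ?Gen = "{{H \<in> subgroups G. ?f H x = d} |x d. x \<in> carrier G \<and> d \<in> (UNIV :: bool set)}"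
  let ?Pi = "{containing G S |S. finite S \<and> S \<subseteq> carrier G}"
  have f: "?f H \<in> carrier G \<rightarrow>\<^sub>E (UNIV :: bool set)" if "H \<in> subgroups G" for H by auto
  note * = sets_borel_of_pullback_product[where A = "subgroups G" and f = ?f and D = "UNIV :: bool set",
      OF G countableI_type f]
  show "topspace (Sub G) = subgroups G"
    using *(1) by (simp add: Sub_def subgroups_def)
  have "sets (borel_of (Sub G)) = sigma_sets (subgroups G) ?Gen"
    using *(2) by (simp add: Sub_def subgroups_def)
  also have "\<dots> = sigma_sets (subgroups G) ?Pi"
  proof (rule sigma_sets_eqI)
    define M where "M = sigma (subgroups G) ?Pi"
    have sub: "?Pi \<subseteq> Pow (subgroups G)" unfolding containing_def by blast
    have M: "sets M = sigma_sets (subgroups G) ?Pi" "space M = subgroups G"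
      unfolding M_def by (rule sets_measure_of[OF sub], rule space_measure_of[OF sub])
    fix U assume "U \<in> ?Gen"
    then obtain x d where U: "x \<in> carrier G" "U = {H \<in> subgroups G. (x \<in> H) = d}" by auto
    have "containing G {x} \<in> sets M" unfolding M using U(1) by (intro sigma_sets.Basic) blast
    moreover have "U = (if d then containing G {x} else space M - containing G {x})"
      using U(2) by (auto simp: containing_def M)
    ultimately have "U \<in> sets M" by auto
    then show "U \<in> sigma_sets (subgroups G) ?Pi" unfolding M .
  next
    define M where "M = sigma (subgroups G) ?Gen"
    have M: "sets M = sigma_sets (subgroups G) ?Gen" "space M = subgroups G"
      unfolding M_def by (rule sets_measure_of space_measure_of; auto)+
    fix U assume "U \<in> ?Pi"
    then obtain S where S: "finite S" "S \<subseteq> carrier G" "U = containing G S" by blast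
    have "{H \<in> space M. x \<in> H} \<in> sets M" if "x \<in> S" for x
    proof -
      have "{H \<in> space M. x \<in> H} = {H \<in> subgroups G. ?f H x = True}" using S that by (auto simp: M)
      also have "\<dots> \<in> sets M" unfolding M using S that by (intro sigma_sets.Basic) blast
      finally show ?thesis .
    qed
    then have "{H \<in> space M. \<forall>x\<in>S. x \<in> H} \<in> sets M" using S(1) by (intro sets.sets_Collect_finite_All)
    moreover have "{H \<in> space M. \<forall>x\<in>S. x \<in> H} = U" by (auto simp: S M containing_def)
    ultimately show "U \<in> sigma_sets (subgroups G) ?Gen" using M by simp
  qed
  finally show "sets (borel_of (Sub G)) = sigma_sets (subgroups G) ?Pi" .
qed

locale countable_group = group G for G :: "('a, 'b) monoid_scheme" (structure) +
  assumes countable_carrier: "countable (carrier G)"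
begin

lemma topspace_Sub_eq [simp]: "topspace (Sub G) = subgroups G"
  by (rule topspace_Sub[OF countable_carrier])

lemma sets_containing:
  assumes "finite S" "S \<subseteq> carrier G"
  shows "containing G S \<in> sets (borel_of (Sub G))"
  unfolding sets_borel_Sub[OF countable_carrier] using assms by (intro sigma_sets.Basic) blast

lemma sets_mem: "x \<in> carrier G \<Longrightarrow> {H \<in> subgroups G. x \<in> H} \<in> sets (borel_of (Sub G))"
  using sets_containing[of "{x}"] by (simp add: containing_def)

lemma measure_eq_on_containing:
  assumes "prob_space \<mu>" "sets \<mu> = sets (borel_of (Sub G))"
    and "prob_space \<nu>" "sets \<nu> = sets (borel_of (Sub G))"
    and eq: "\<And>S. finite S \<Longrightarrow> S \<subseteq> carrier G \<Longrightarrow> measure \<mu> (containing G S) = measure \<nu> (containing G S)"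
  shows "\<mu> = \<nu>"
proof (rule measure_eqI_generator_eq)
  interpret \<mu>: prob_space \<mu> by fact
  interpret \<nu>: prob_space \<nu> by fact
  let ?Pi = "{containing G S |S. finite S \<and> S \<subseteq> carrier G}"
  show "Int_stable ?Pi"
  proof (rule Int_stableI)
    fix a b assume "a \<in> ?Pi" "b \<in> ?Pi"
    then obtain S T where "a = containing G S" "finite S" "S \<subseteq> carrier G"
      "b = containing G T" "finite T" "T \<subseteq> carrier G" by blast
    moreover then have "a \<inter> b = containing G (S \<union> T)" by (auto simp: containing_def)
    ultimately show "a \<inter> b \<in> ?Pi" by blast
  qed
  show "?Pi \<subseteq> Pow (subgroups G)" by (auto simp: containing_def)
  show "sets \<mu> = sigma_sets (subgroups G) ?Pi" "sets \<nu> = sigma_sets (subgroups G) ?Pi"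
    using assms sets_borel_Sub[OF countable_carrier] by auto
  show "emeasure \<mu> U = emeasure \<nu> U" if "U \<in> ?Pi" for U
    using that eq by (auto simp: \<mu>.emeasure_eq_measure \<nu>.emeasure_eq_measure)
  show "range (\<lambda>_::nat. containing G {}) \<subseteq> ?Pi" by blast
  show "(\<Union>i::nat. containing G {}) = subgroups G" by (auto simp: containing_def)
  show "emeasure \<mu> (containing G {}) \<noteq> \<infinity>" for i :: nat by (simp add: \<mu>.emeasure_eq_measure)
qed

lemma measurable_to_Sub:
  assumes "f \<in> space M \<rightarrow> subgroups G" "\<And>x. x \<in> carrier G \<Longrightarrow> {\<omega> \<in> space M. x \<in> f \<omega>} \<in> sets M"
  shows "f \<in> measurable M (borel_of (Sub G))"
proof (rule measurable_sigma_sets)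
  show "sets (borel_of (Sub G)) = sigma_sets (subgroups G) {containing G S |S. finite S \<and> S \<subseteq> carrier G}"
    by (rule sets_borel_Sub[OF countable_carrier])
  show "{containing G S |S. finite S \<and> S \<subseteq> carrier G} \<subseteq> Pow (subgroups G)" by (auto simp: containing_def)
  show "f \<in> space M \<rightarrow> subgroups G" by fact
  fix U assume "U \<in> {containing G S |S. finite S \<and> S \<subseteq> carrier G}"
  then obtain S where S: "finite S" "S \<subseteq> carrier G" "U = containing G S" by blast
  have "{\<omega> \<in> space M. \<forall>x\<in>S. x \<in> f \<omega>} \<in> sets M"
    using S assms(2) by (intro sets.sets_Collect_finite_All) auto
  moreover have "{\<omega> \<in> space M. \<forall>x\<in>S. x \<in> f \<omega>} = f -` U \<inter> space M"
    using assms(1) by (auto simp: S containing_def)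
  ultimately show "f -` U \<inter> space M \<in> sets M" by simp
qed

lemma sets_depends_on:
  assumes T: "finite T" "T \<subseteq> carrier G" and E: "depends_on G T E"
  shows "E \<in> sets (borel_of (Sub G))"
proof -
  let ?M = "borel_of (Sub G)"
  define B where "B = (\<lambda>C. {H \<in> space ?M. \<forall>x\<in>T. (x \<in> H) = (x \<in> C)})"
  have B: "B C \<in> sets ?M" for C
    unfolding B_def
  proof (rule sets.sets_Collect_finite_All[OF _ T(1)])
    fix x assume "x \<in> T"
    then have "{H \<in> space ?M. x \<in> H} \<in> sets ?M" using sets_mem T by auto
    moreover then have "{H \<in> space ?M. x \<notin> H} \<in> sets ?M" by (rule sets.sets_Collect_neg)
    ultimately show "{H \<in> space ?M. (x \<in> H) = (x \<in> C)} \<in> sets ?M" by (cases "x \<in> C") auto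
  qed
  have "E = (\<Union>C\<in>(\<lambda>H. H \<inter> T) ` E. B C)"
  proof
    show "E \<subseteq> (\<Union>C\<in>(\<lambda>H. H \<inter> T) ` E. B C)"
      using E by (auto simp: B_def depends_on_def)
    show "(\<Union>C\<in>(\<lambda>H. H \<inter> T) ` E. B C) \<subseteq> E"
    proof
      fix H assume "H \<in> (\<Union>C\<in>(\<lambda>H. H \<inter> T) ` E. B C)"
      then obtain H' where "H' \<in> E" "H \<in> subgroups G" "\<forall>x\<in>T. (x \<in> H) = (x \<in> H')"
        by (auto simp: B_def)
      moreover then have "H' \<inter> T = H \<inter> T" "H' \<in> subgroups G" using E by (auto simp: depends_on_def)
      ultimately show "H \<in> E" using E unfolding depends_on_def by blast
    qed
  qed
  moreover have "finite ((\<lambda>H. H \<inter> T) ` E)"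
    by (rule finite_subset[of _ "Pow T"]) (use T in auto)
  ultimately show ?thesis using B by (metis (no_types, lifting) sets.finite_UN)
qed

lemma depends_on_containing: "depends_on G S (containing G S)"
  by (auto simp: depends_on_def containing_def)

lemma depends_on_mono: "depends_on G S E \<Longrightarrow> S \<subseteq> T \<Longrightarrow> depends_on G T E"
proof -
  assume E: "depends_on G S E" and "S \<subseteq> T"
  then have "H \<inter> S = H' \<inter> S" if "H \<inter> T = H' \<inter> T" for H H' using that by blast
  then show "depends_on G T E" using E unfolding depends_on_def by (metis (no_types))
qed

lemma auto_image_mem:
  assumes "\<phi> \<in> auto G" "x \<in> carrier G" "H \<in> subgroups G"
  shows "\<phi> x \<in> \<phi> ` H \<longleftrightarrow> x \<in> H"
  using autoD(2)[OF assms(1)] assms(2,3) subgroup.subset[of H G]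
  by (auto simp: subgroups_def bij_betw_def inj_on_def)

lemma auto_image_subgroup:
  assumes "\<phi> \<in> auto G" "H \<in> subgroups G"
  shows "\<phi> ` H \<in> subgroups G"
  using group_hom.subgroup_img_is_subgroup[OF autoD(3)[OF assms(1)]] assms(2)
  by (simp add: subgroups_def)

lemma auto_image_measurable:
  assumes "\<phi> \<in> auto G"
  shows "(\<lambda>H. \<phi> ` H) \<in> measurable (borel_of (Sub G)) (borel_of (Sub G))"
proof (rule measurable_to_Sub)
  fix x assume "x \<in> carrier G"
  then obtain y where y: "y \<in> carrier G" "x = \<phi> y"
    using autoD(2)[OF assms] by (auto simp: bij_betw_def)
  have "x \<in> \<phi> ` H \<longleftrightarrow> y \<in> H" if "H \<in> subgroups G" for H
    using auto_image_mem[OF assms y(1) that] y(2) by simp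
  then have "{H \<in> subgroups G. x \<in> \<phi> ` H} = {H \<in> subgroups G. y \<in> H}" by auto
  then show "{H \<in> space (borel_of (Sub G)). x \<in> \<phi> ` H} \<in> sets (borel_of (Sub G))"
    using sets_mem[OF y(1)] by simp
qed (use auto_image_subgroup[OF assms] in auto)

lemma CRS_I:
  assumes P: "prob_space \<mu>" and s: "sets \<mu> = sets (borel_of (Sub G))"
    and eq: "\<And>\<phi> S. \<phi> \<in> auto G \<Longrightarrow> finite S \<Longrightarrow> S \<subseteq> carrier G \<Longrightarrow>
      measure \<mu> (containing G (\<phi> ` S)) = measure \<mu> (containing G S)"
  shows "\<mu> \<in> CRS G"
proof -
  have "distr \<mu> (borel_of (Sub G)) (\<lambda>H. \<phi> ` H) = \<mu>" if \<phi>: "\<phi> \<in> auto G" for \<phi>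
  proof -
    have m: "(\<lambda>H. \<phi> ` H) \<in> measurable \<mu> (borel_of (Sub G))"
      using auto_image_measurable[OF \<phi>] measurable_cong_sets[OF s refl] by blast
    have sp: "space \<mu> = subgroups G" using sets_eq_imp_space_eq[OF s] by simp
    show ?thesis
    proof (rule measure_eq_on_containing[OF prob_space.prob_space_distr[OF P m] _ P s])
      fix S assume S: "finite S" "S \<subseteq> carrier G"
      define S' where "S' = inv_into (carrier G) \<phi> ` S"
      have SS: "\<phi> ` S' = S" "S' \<subseteq> carrier G"
        using S(2) autoD(2)[OF \<phi>] inv_into_into[of _ \<phi> "carrier G"]
        by (auto simp: S'_def bij_betw_def image_image f_inv_into_f subset_iff)
      have "S \<subseteq> \<phi> ` H \<longleftrightarrow> S' \<subseteq> H" if H: "H \<in> subgroups G" for H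
      proof -
        have "S \<subseteq> \<phi> ` H \<longleftrightarrow> (\<forall>x\<in>S'. \<phi> x \<in> \<phi> ` H)" unfolding SS(1)[symmetric] by (rule image_subset_iff)
        also have "\<dots> \<longleftrightarrow> (\<forall>x\<in>S'. x \<in> H)"
          by (intro ball_cong refl auto_image_mem[OF \<phi> _ H]) (use SS(2) in blast)
        finally show ?thesis by blast
      qed
      then have "(\<lambda>H. \<phi> ` H) -` containing G S \<inter> space \<mu> = containing G S'"
        using auto_image_subgroup[OF \<phi>] unfolding sp containing_def by auto
      then have "measure (distr \<mu> (borel_of (Sub G)) (\<lambda>H. \<phi> ` H)) (containing G S) = measure \<mu> (containing G S')"
        using measure_distr[OF m sets_containing[OF S]] by simp
      also have "\<dots> = measure \<mu> (containing G S)"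
        using eq[OF \<phi> _ SS(2)] SS(1) S(1) by (simp add: S'_def)
      finally show "measure (distr \<mu> (borel_of (Sub G)) (\<lambda>H. \<phi> ` H)) (containing G S) = measure \<mu> (containing G S)" .
    qed simp
  qed
  then show ?thesis using P s by (simp add: CRS_def)
qed

lemma CRS_invariant:
  assumes "\<mu> \<in> CRS G" and \<phi>: "\<phi> \<in> auto G"
    and E: "E \<subseteq> subgroups G" "E' \<in> sets (borel_of (Sub G))"
    and iff: "\<And>H. H \<in> subgroups G \<Longrightarrow> H \<in> E \<longleftrightarrow> \<phi> ` H \<in> E'"
  shows "measure \<mu> E = measure \<mu> E'"
proof -
  have s: "sets \<mu> = sets (borel_of (Sub G))" and d: "distr \<mu> (borel_of (Sub G)) (\<lambda>H. \<phi> ` H) = \<mu>"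
    using assms by (auto simp: CRS_def)
  have m: "(\<lambda>H. \<phi> ` H) \<in> measurable \<mu> (borel_of (Sub G))"
    using auto_image_measurable[OF \<phi>] measurable_cong_sets[OF s refl] by blast
  have "(\<lambda>H. \<phi> ` H) -` E' \<inter> space \<mu> = E"
    using sets_eq_imp_space_eq[OF s] E iff by auto
  then show ?thesis using measure_distr[OF m E(2)] d by simp
qed

end

text \<open>The limit of the conditional measures is a finitely additive function on the algebra \<open>\<C>\<close> that is dominated
  by a multiple of the given measure; hence it is continuous at the empty set.\<close>

lemma (in prob_space) limit_of_conditional_measures:
  assumes C: "algebra (space M) \<C>" "sets M = sigma_sets (space M) \<C>"
    and V: "\<And>k::nat. V k \<in> sets M" "\<And>k. measure M (V k) = p" "p > 0"
    and lim: "\<And>E. E \<in> \<C> \<Longrightarrow> \<exists>c. eventually (\<lambda>k. measure M (V k \<inter> E) = c) sequentially"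
  shows "\<exists>\<nu>. prob_space \<nu> \<and> sets \<nu> = sets M \<and>
    (\<forall>E\<in>\<C>. eventually (\<lambda>k. measure \<nu> E = measure M (V k \<inter> E) / p) sequentially)"
proof -
  interpret C: algebra "space M" \<C> by fact
  have CM: "\<C> \<subseteq> sets M" unfolding C(2) by (rule sigma_sets_superset_generator)
  define c where "c = (\<lambda>E. SOME c. eventually (\<lambda>k. measure M (V k \<inter> E) = c) sequentially)"
  have c: "eventually (\<lambda>k. measure M (V k \<inter> E) = c E) sequentially" if "E \<in> \<C>" for E
    unfolding c_def by (rule someI_ex[OF lim[OF that]])
  have ev: "\<exists>k. P k" if "eventually P sequentially" for P :: "nat \<Rightarrow> bool"
    using that eventually_happens[of P sequentially] by auto
  have cb: "0 \<le> c E \<and> c E \<le> measure M E" if E: "E \<in> \<C>" for E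
  proof -
    obtain k where "measure M (V k \<inter> E) = c E" using ev[OF c[OF E]] by blast
    moreover have "measure M (V k \<inter> E) \<le> measure M E"
      using E CM by (intro finite_measure_mono) auto
    ultimately show ?thesis using measure_nonneg[of M "V k \<inter> E"] by simp
  qed
  define f where "f = (\<lambda>E. ennreal (c E / p))"
  have "\<exists>\<mu> :: 'a set \<Rightarrow> ennreal. (\<forall>s \<in> \<C>. \<mu> s = f s) \<and> measure_space (space M) (sigma_sets (space M) \<C>) \<mu>"
  proof (rule C.caratheodory_empty_continuous)
    have "c {} = 0" using cb[of "{}"] by auto
    then show "positive \<C> f" by (simp add: positive_def f_def)
    show "additive \<C> f"
      unfolding additive_def
    proof (intro ballI impI)
      fix x y assume xy: "x \<in> \<C>" "y \<in> \<C>" "x \<inter> y = {}"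
      \<comment> \<open>The limits are attained, so finitely many of them can be read off at one
        common \<open>k\<close>, where additivity is that of a measure.\<close>
      have "eventually (\<lambda>k. measure M (V k \<inter> x) = c x \<and> measure M (V k \<inter> y) = c y \<and>
        measure M (V k \<inter> (x \<union> y)) = c (x \<union> y)) sequentially"
        by (intro eventually_conj c xy C.Un)
      then obtain k where k: "measure M (V k \<inter> x) = c x" "measure M (V k \<inter> y) = c y"
        "measure M (V k \<inter> (x \<union> y)) = c (x \<union> y)" using ev by blast
      have "measure M ((V k \<inter> x) \<union> (V k \<inter> y)) = measure M (V k \<inter> x) + measure M (V k \<inter> y)"
        using xy CM V(1) by (intro finite_measure_Union) auto
      then have "c (x \<union> y) = c x + c y" using k by (simp add: Int_Un_distrib)
      then show "f (x \<union> y) = f x + f y"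
        using cb[OF xy(1)] cb[OF xy(2)] V(3) by (simp add: f_def add_divide_distrib ennreal_plus)
    qed
    show "f A \<noteq> \<infinity>" for A by (simp add: f_def)
    fix A :: "nat \<Rightarrow> 'a set" assume A: "range A \<subseteq> \<C>" "decseq A" "(\<Inter>i. A i) = {}"
    have "(\<lambda>i. measure M (A i)) \<longlonglongrightarrow> measure M (\<Inter>i. A i)"
      using A CM by (intro finite_Lim_measure_decseq) auto
    then have lim0: "(\<lambda>i. measure M (A i)) \<longlonglongrightarrow> 0" using A(3) by simp
    have lo: "\<forall>i. 0 \<le> c (A i)" and up: "\<forall>i. c (A i) \<le> measure M (A i)"
      using cb[OF subsetD[OF A(1) rangeI]] by auto
    have "(\<lambda>i. c (A i)) \<longlonglongrightarrow> 0"
      by (rule tendsto_sandwich[OF always_eventually[OF lo] always_eventually[OF up] tendsto_const lim0])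
    then have "(\<lambda>i. c (A i) / p) \<longlonglongrightarrow> 0 / p" using V(3) by (intro tendsto_divide tendsto_const) auto
    then have "(\<lambda>i. ennreal (c (A i) / p)) \<longlonglongrightarrow> ennreal (0 / p)" by (rule tendsto_ennrealI)
    then show "(\<lambda>i. f (A i)) \<longlonglongrightarrow> 0" by (simp add: f_def)
  qed
  then obtain \<mu> where \<mu>: "\<forall>s\<in>\<C>. \<mu> s = f s" "measure_space (space M) (sigma_sets (space M) \<C>) \<mu>" by blast
  define \<nu> where "\<nu> = measure_of (space M) \<C> \<mu>"
  have sets: "sets \<nu> = sets M" unfolding \<nu>_def C(2) using C.space_closed by (rule sets_measure_of)
  have space: "space \<nu> = space M" using sets by (rule sets_eq_imp_space_eq)
  have em: "emeasure \<nu> E = f E" if "E \<in> \<C>" for E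
  proof -
    have "emeasure \<nu> E = \<mu> E"
      unfolding \<nu>_def
      by (rule emeasure_measure_of[OF refl C.space_closed])
         (use \<mu>(2) that sets[unfolded \<nu>_def C(2)] in \<open>auto simp: measure_space_def\<close>)
    then show ?thesis using \<mu>(1) that by simp
  qed
  obtain k where "measure M (V k \<inter> space M) = c (space M)" using ev[OF c[OF C.top]] by blast
  then have "c (space M) = p" using V(1,2) by (simp add: Int_absorb2 sets.sets_into_space)
  then have "emeasure \<nu> (space \<nu>) = 1" using em[OF C.top] V(3) by (simp add: space f_def)
  then have prob: "prob_space \<nu>" by (rule prob_spaceI)
  have mE: "measure \<nu> E = c E / p" if "E \<in> \<C>" for E
    using em[OF that] cb[OF that] V(3) by (simp add: measure_def f_def)
  have "eventually (\<lambda>k. measure \<nu> E = measure M (V k \<inter> E) / p) sequentially" if "E \<in> \<C>" for E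
    using c[OF that] by (rule eventually_mono) (simp add: mE[OF that])
  then show ?thesis using prob sets by blast
qed

section \<open>Mixing\<close>

sublocale AAn_group \<subseteq> countable_group A
  by unfold_locales (rule countable_carrier)

locale ergodic_CRS = AAn_group A n for A (structure) and n +
  fixes lam :: "(nat \<Rightarrow> int) set set measure"
  assumes extreme: "lam \<in> CRSe A"

sublocale ergodic_CRS \<subseteq> lam: prob_space lam
  using extreme by (simp add: CRSe_def CRS_def)

context ergodic_CRS
begin

abbreviation contain :: "(nat \<Rightarrow> int) set set \<Rightarrow> (nat \<Rightarrow> int) set set set" where
  "contain \<equiv> containing A"

lemma lam_CRS: "lam \<in> CRS A"
  using extreme by (simp add: CRSe_def)

lemma sets_lam: "sets lam = sets (borel_of (Sub A))"
  using lam_CRS by (simp add: CRS_def)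

lemma space_lam [simp]: "space lam = subgroups A"
  using sets_eq_imp_space_eq[OF sets_lam] by simp

lemma sets_lam_containing [simp]: "finite S \<Longrightarrow> S \<subseteq> carrier A \<Longrightarrow> contain S \<in> sets lam"
  using sets_containing by (simp add: sets_lam)

lemma sets_lam_depends_on: "finite T \<Longrightarrow> T \<subseteq> carrier A \<Longrightarrow> depends_on A T E \<Longrightarrow> E \<in> sets lam"
  using sets_depends_on by (simp add: sets_lam)

text \<open>An automorphism that fixes \<open>T\<close> pointwise preserves every event depending on
  \<open>T\<close>, so only \<open>S\<close> is moved.\<close>

lemma measure_containing_auto_Int:
  assumes \<phi>: "\<phi> \<in> auto A" and S: "finite S" "S \<subseteq> carrier A" and T: "finite T" "T \<subseteq> carrier A"
    and E: "depends_on A T E" and fixed: "\<And>x. x \<in> T \<Longrightarrow> \<phi> x = x"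
  shows "measure lam (contain (\<phi> ` S) \<inter> E) = measure lam (contain S \<inter> E)"
proof (rule CRS_invariant[OF lam_CRS \<phi>, symmetric])
  have phS: "\<phi> ` S \<subseteq> carrier A" using autoD(2)[OF \<phi>] S(2) by (auto simp: bij_betw_def)
  show "contain S \<inter> E \<subseteq> subgroups A" by (auto simp: containing_def)
  show "contain (\<phi> ` S) \<inter> E \<in> sets (borel_of (Sub A))"
    by (intro sets.Int sets_containing sets_depends_on[OF T E] phS finite_imageI S)
  fix H assume H: "H \<in> subgroups A"
  have im: "\<phi> ` H \<in> subgroups A" by (rule auto_image_subgroup[OF \<phi> H])
  have "(\<phi> ` H) \<inter> T = H \<inter> T"
    using auto_image_mem[OF \<phi> _ H] fixed T(2) by (auto, metis subsetD)+
  then have "H \<in> E \<longleftrightarrow> \<phi> ` H \<in> E" using E H im unfolding depends_on_def by metis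
  moreover have "S \<subseteq> H \<longleftrightarrow> \<phi> ` S \<subseteq> \<phi> ` H"
  proof -
    have "\<phi> ` S \<subseteq> \<phi> ` H \<longleftrightarrow> (\<forall>x\<in>S. \<phi> x \<in> \<phi> ` H)" by (rule image_subset_iff)
    also have "\<dots> \<longleftrightarrow> (\<forall>x\<in>S. x \<in> H)"
      by (intro ball_cong refl auto_image_mem[OF \<phi> _ H]) (use S(2) in blast)
    finally show ?thesis by blast
  qed
  ultimately show "H \<in> contain S \<inter> E \<longleftrightarrow> \<phi> ` H \<in> contain (\<phi> ` S) \<inter> E"
    using H im by (simp add: containing_def)
qed

lemma depends_on_subgroups: "depends_on A {} (subgroups A)"
  by (auto simp: depends_on_def)

lemma measure_containing_auto:
  assumes \<phi>: "\<phi> \<in> auto A" and S: "finite S" "S \<subseteq> carrier A"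
  shows "measure lam (contain (\<phi> ` S)) = measure lam (contain S)"
proof -
  have "contain S \<inter> subgroups A = contain S" for S by (auto simp: containing_def)
  then show ?thesis
    using measure_containing_auto_Int[OF \<phi> S _ _ depends_on_subgroups] by simp
qed

section \<open>Cylinder events, conditional limits and extremality\<close>

definition cylinders :: "(nat \<Rightarrow> int) set set set set"
  where "cylinders = {E. \<exists>T. finite T \<and> T \<subseteq> carrier A \<and> depends_on A T E}"

lemma algebra_cylinders: "algebra (subgroups A) cylinders"
  unfolding algebra_iff_Un
proof (intro conjI ballI)
  show "cylinders \<subseteq> Pow (subgroups A)" by (auto simp: cylinders_def depends_on_def)
  have "depends_on A {} {}" by (simp add: depends_on_def)
  then show "{} \<in> cylinders" unfolding cylinders_def by blast
  fix E assume "E \<in> cylinders"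
  then obtain T where T: "finite T" "T \<subseteq> carrier A" "depends_on A T E" unfolding cylinders_def by blast
  have "depends_on A T (subgroups A - E)"
    using T(3) unfolding depends_on_def by (metis DiffD2 DiffI Diff_subset)
  then show "subgroups A - E \<in> cylinders" using T unfolding cylinders_def by blast
  fix E' assume "E' \<in> cylinders"
  then obtain T' where T': "finite T'" "T' \<subseteq> carrier A" "depends_on A T' E'" unfolding cylinders_def by blast
  have "depends_on A (T \<union> T') E" "depends_on A (T \<union> T') E'"
    using T T' depends_on_mono by blast+
  then have "depends_on A (T \<union> T') (E \<union> E')" unfolding depends_on_def by (metis Un_iff Un_least)
  then show "E \<union> E' \<in> cylinders" using T T' unfolding cylinders_def by (auto intro!: exI[of _ "T \<union> T'"])
qed

lemma containing_in_cylinders: "finite S \<Longrightarrow> S \<subseteq> carrier A \<Longrightarrow> contain S \<in> cylinders"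
  unfolding cylinders_def using depends_on_containing by blast

lemma cylinders_sets: "E \<in> cylinders \<Longrightarrow> E \<in> sets lam"
  unfolding cylinders_def using sets_lam_depends_on by blast

lemma sets_lam_cylinders: "sets lam = sigma_sets (subgroups A) cylinders"
proof
  have "sets lam = sigma_sets (subgroups A) {contain S |S. finite S \<and> S \<subseteq> carrier A}"
    unfolding sets_lam by (rule sets_borel_Sub[OF countable_carrier])
  also have "\<dots> \<subseteq> sigma_sets (subgroups A) cylinders"
    by (rule sigma_sets_mono') (use containing_in_cylinders in blast)
  finally show "sets lam \<subseteq> sigma_sets (subgroups A) cylinders" .
  show "sigma_sets (subgroups A) cylinders \<subseteq> sets lam"
    using sets.sigma_sets_subset[of cylinders lam] cylinders_sets by auto
qed

text \<open>Invariance of the limit is tested on the events \<open>contain S\<close> only, and there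
  it is an identity that need hold just for large \<open>k\<close>. The events \<open>W k\<close>
  themselves are not invariant.\<close>

lemma conditional_limit_CRS:
  assumes W: "\<And>k::nat. W k \<in> sets lam" "\<And>k. measure lam (W k) = q" "q > 0"
    and lim: "\<And>E. E \<in> cylinders \<Longrightarrow> \<exists>c. eventually (\<lambda>k. measure lam (W k \<inter> E) = c) sequentially"
    and inv: "\<And>\<phi> S. \<phi> \<in> auto A \<Longrightarrow> finite S \<Longrightarrow> S \<subseteq> carrier A \<Longrightarrow>
      eventually (\<lambda>k. measure lam (W k \<inter> contain (\<phi> ` S)) = measure lam (W k \<inter> contain S)) sequentially"
  shows "\<exists>\<nu>\<in>CRS A. \<forall>E\<in>cylinders. eventually (\<lambda>k. measure \<nu> E = measure lam (W k \<inter> E) / q) sequentially"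
proof -
  have "\<exists>\<nu>. prob_space \<nu> \<and> sets \<nu> = sets lam \<and>
    (\<forall>E\<in>cylinders. eventually (\<lambda>k. measure \<nu> E = measure lam (W k \<inter> E) / q) sequentially)"
    by (rule lam.limit_of_conditional_measures[OF _ _ W lim])
       (simp_all add: algebra_cylinders sets_lam_cylinders)
  then obtain \<nu> where \<nu>: "prob_space \<nu>" "sets \<nu> = sets lam"
    "\<forall>E\<in>cylinders. eventually (\<lambda>k. measure \<nu> E = measure lam (W k \<inter> E) / q) sequentially" by blast
  have "\<nu> \<in> CRS A"
  proof (rule CRS_I[OF \<nu>(1)])
    show "sets \<nu> = sets (borel_of (Sub A))" using \<nu>(2) sets_lam by simp
    fix \<phi> S assume \<phi>: "\<phi> \<in> auto A" and S: "finite S" "S \<subseteq> carrier A"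
    have R: "\<phi> ` S \<subseteq> carrier A" using autoD(2)[OF \<phi>] S(2) by (auto simp: bij_betw_def)
    have 1: "eventually (\<lambda>k. measure \<nu> (contain (\<phi> ` S)) = measure lam (W k \<inter> contain (\<phi> ` S)) / q) sequentially"
      by (rule bspec[OF \<nu>(3) containing_in_cylinders[OF finite_imageI[OF S(1)] R]])
    have 2: "eventually (\<lambda>k. measure \<nu> (contain S) = measure lam (W k \<inter> contain S) / q) sequentially"
      by (rule bspec[OF \<nu>(3) containing_in_cylinders[OF S]])
    have "eventually (\<lambda>k. measure \<nu> (contain (\<phi> ` S)) = measure \<nu> (contain S)) sequentially"
      using 1 2 inv[OF \<phi> S] by eventually_elim simp
    then show "measure \<nu> (contain (\<phi> ` S)) = measure \<nu> (contain S)" by simp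
  qed
  then show ?thesis using \<nu>(3) by blast
qed

text \<open>Extremality in \<open>CRSe\<close> is phrased with all Borel sets, whereas the
  conditional limits are known on cylinders; Dynkin's lemma bridges the gap.\<close>

lemma extreme_mixture:
  assumes \<mu>: "\<mu> \<in> CRS A" and \<nu>: "\<nu> \<in> CRS A" and t: "0 < t" "t < 1"
    and eq: "\<And>E. E \<in> cylinders \<Longrightarrow> measure lam E = (1 - t) * measure \<mu> E + t * measure \<nu> E"
  shows "\<mu> = \<nu>"
proof -
  interpret \<mu>: prob_space \<mu> using \<mu> by (simp add: CRS_def)
  interpret \<nu>: prob_space \<nu> using \<nu> by (simp add: CRS_def)
  have s: "sets \<mu> = sets lam" "sets \<nu> = sets lam" using \<mu> \<nu> sets_lam by (auto simp: CRS_def)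
  note sp = sets_eq_imp_space_eq[OF s(1)] sets_eq_imp_space_eq[OF s(2)]
  interpret C: algebra "subgroups A" cylinders by (rule algebra_cylinders)
  have "measure lam E = (1 - t) * measure \<mu> E + t * measure \<nu> E" if "E \<in> sigma_sets (subgroups A) cylinders" for E
    using _ _ that
  proof (induct rule: sigma_sets_induct_disjoint)
    show "Int_stable cylinders" by (rule Int_stableI) (rule C.Int)
    show "cylinders \<subseteq> Pow (subgroups A)" by (rule C.space_closed)
    show "measure lam E = (1 - t) * measure \<mu> E + t * measure \<nu> E" if "E \<in> cylinders" for E
      by (rule eq[OF that])
    show "measure lam {} = (1 - t) * measure \<mu> {} + t * measure \<nu> {}" by simp
    fix E assume E: "E \<in> sigma_sets (subgroups A) cylinders"
      and IH: "measure lam E = (1 - t) * measure \<mu> E + t * measure \<nu> E"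
    then have "E \<in> sets lam" by (simp add: sets_lam_cylinders)
    then have c: "measure lam (subgroups A - E) = 1 - measure lam E"
      "measure \<mu> (subgroups A - E) = 1 - measure \<mu> E" "measure \<nu> (subgroups A - E) = 1 - measure \<nu> E"
      using lam.prob_compl[of E] \<mu>.prob_compl[of E] \<nu>.prob_compl[of E] s sp by simp_all
    show "measure lam (subgroups A - E) = (1 - t) * measure \<mu> (subgroups A - E) + t * measure \<nu> (subgroups A - E)"
      unfolding c IH by (simp add: algebra_simps)
  next
    fix F :: "nat \<Rightarrow> (nat \<Rightarrow> int) set set set"
    assume F: "disjoint_family F" "range F \<subseteq> sigma_sets (subgroups A) cylinders"
      and IH: "\<And>i. measure lam (F i) = (1 - t) * measure \<mu> (F i) + t * measure \<nu> (F i)"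
    have "(\<lambda>i. (1 - t) * measure \<mu> (F i) + t * measure \<nu> (F i)) sums
        ((1 - t) * measure \<mu> (\<Union>i. F i) + t * measure \<nu> (\<Union>i. F i))"
      using F s sets_lam_cylinders
      by (intro sums_add sums_mult \<mu>.finite_measure_UNION \<nu>.finite_measure_UNION) auto
    moreover have "(\<lambda>i. measure lam (F i)) sums measure lam (\<Union>i. F i)"
      using F sets_lam_cylinders by (intro lam.finite_measure_UNION) auto
    ultimately show "measure lam (\<Union>i. F i) = (1 - t) * measure \<mu> (\<Union>i. F i) + t * measure \<nu> (\<Union>i. F i)"
      using IH sums_unique2 by simp
  qed
  then have all: "\<forall>E\<in>sets (borel_of (Sub A)). measure lam E = (1 - t) * measure \<mu> E + t * measure \<nu> E"
    unfolding sets_lam[symmetric] sets_lam_cylinders by blast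
  have ext: "\<forall>\<mu>\<in>CRS A. \<forall>\<nu>\<in>CRS A. \<forall>t\<in>{0<..<1}. (\<forall>E\<in>sets (borel_of (Sub A)).
      measure lam E = (1 - t) * measure \<mu> E + t * measure \<nu> E) \<longrightarrow> \<mu> = \<nu>"
    using extreme unfolding CRSe_def by blast
  have "t \<in> {0<..<1}" using t by simp
  from mp[OF bspec[OF bspec[OF bspec[OF ext \<mu>] \<nu>] this] all] show ?thesis .
qed

text \<open>The events that translates of \<open>S\<close> to far away blocks lie in the random subgroup have an invariant
  limiting conditional distribution, which by extremality is \<open>lam\<close> itself.\<close>

theorem mixing:
  assumes S: "finite S" "S \<subseteq> span {K..}" and T: "finite T" "T \<subseteq> span {..<K}" and E: "depends_on A T E"
  shows "measure lam (contain S \<inter> E) = measure lam (contain S) * measure lam E"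
proof -
  obtain L0 where L0: "S \<subseteq> span ({K..} \<inter> {..<L0})" using finite_subset_span_Int[OF S] by blast
  \<comment> \<open>The block length is positive, so the blocks starting at \<open>K + k * L\<close>
    tend to infinity.\<close>
  define L where "L = Suc L0"
  have SL: "S \<subseteq> span {K..<K+L}"
    using L0 span_mono[of "{K..} \<inter> {..<L0}" "{K..<K+L}"] by (force simp: L_def)
  have L: "L \<ge> 1" by (simp add: L_def)
  \<comment> \<open>The involution exchanging the blocks of length \<open>L\<close> at
    \<open>K + a\<close> and \<open>K + b\<close>; for this the blocks must be equal or disjoint,
    which \<open>sep\<close> guarantees for multiples of \<open>L\<close>.\<close>
  define sw where "sw = (\<lambda>a b i. if K + a \<le> i \<and> i < K + a + L then i - a + b
    else if K + b \<le> i \<and> i < K + b + L then i - b + a else i)"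
  define \<phi> where "\<phi> = (\<lambda>a b. endo (\<lambda>i. e (sw a b i)))"
  have \<phi>e: "\<phi> a b (e i) = e (sw a b i)" for a b i unfolding \<phi>_def by (rule endo(3)) simp
  have \<phi>: "\<phi> a b \<in> auto A" if "a = b \<or> a + L \<le> b \<or> b + L \<le> a" for a b
  proof -
    have "sw a b (sw a b i) = i" for i using that by (auto simp: sw_def)
    then have "bij (sw a b)" by (metis involuntory_imp_bij)
    then show ?thesis unfolding \<phi>_def by (rule auto_perm)
  qed
  have sep: "k * L = l * L \<or> k * L + L \<le> l * L \<or> l * L + L \<le> k * L" for k l :: nat
  proof (cases k l rule: linorder_cases)
    case less
    then have "Suc k * L \<le> l * L" by (intro mult_le_mono1) simp
    then show ?thesis by simp
  next
    case greater
    then have "Suc l * L \<le> k * L" by (intro mult_le_mono1) simp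
    then show ?thesis by simp
  qed simp
  define S' where "S' = (\<lambda>k::nat. \<phi> 0 (k * L) ` S)"
  have Sc: "S \<subseteq> carrier A" using S(2) span_closed by blast
  have Tc: "T \<subseteq> carrier A" using T(2) span_closed by blast
  have fS': "finite (S' k)" for k using S(1) by (simp add: S'_def)
  have \<phi>0: "\<phi> 0 (k * L) \<in> auto A" for k using \<phi> sep[of 0 k] by simp
  have S'span: "S' k \<subseteq> span {K + k * L..}" for k
  proof
    fix x assume "x \<in> S' k"
    then obtain y where y: "y \<in> S" "x = \<phi> 0 (k * L) y" by (auto simp: S'_def)
    have "\<phi> 0 (k * L) y \<in> span {K + k * L..}"
      by (rule hom_image_span[OF autoD(1)[OF \<phi>0], of "{K..<K+L}"])
         (use y SL in \<open>auto simp: \<phi>e sw_def intro!: e_in_span\<close>)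
    then show "x \<in> span {K + k * L..}" using y by simp
  qed
  have S'c: "S' k \<subseteq> carrier A" for k using S'span span_closed by blast
  have S'kl: "\<phi> (k * L) (l * L) ` S' k = S' l" for k l
  proof -
    have "\<phi> (k * L) (l * L) (\<phi> 0 (k * L) x) = \<phi> 0 (l * L) x" if "x \<in> S" for x
    proof -
      have c: "compose (carrier A) (\<phi> (k * L) (l * L)) (\<phi> 0 (k * L)) \<in> hom A A"
        by (rule autoD(1)[OF auto_compose[OF \<phi>[OF sep] \<phi>0]])
      have "compose (carrier A) (\<phi> (k * L) (l * L)) (\<phi> 0 (k * L)) x = \<phi> 0 (l * L) x"
        by (rule hom_eq_on_span[OF is_group c autoD(1)[OF \<phi>0], of "{K..<K+L}"])
           (use that SL in \<open>auto simp: compose_eq \<phi>e sw_def\<close>)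
      then show ?thesis using that Sc by (simp add: compose_eq subset_iff)
    qed
    then show ?thesis unfolding S'_def image_image by (auto intro!: image_cong)
  qed
  have S'0: "S' 0 = S"
  proof -
    have "\<phi> 0 0 x = x" if "x \<in> S" for x
      by (rule auto_fixes_span[OF _ _ subsetD[OF SL that]]) (use \<phi>0[of 0] in \<open>auto simp: \<phi>e sw_def\<close>)
    then show ?thesis unfolding S'_def by (auto intro!: image_eqI)
  qed
  define V where "V = (\<lambda>k. contain (S' k))"
  have V: "V k \<in> sets lam" for k unfolding V_def using fS' S'c by simp
  \<comment> \<open>Once both blocks lie beyond the support of the event, exchanging them fixes the
    event, so the sequence is eventually constant and not merely convergent.\<close>
  have Vconst: "measure lam (V k \<inter> E) = measure lam (V l \<inter> E)"
    if "finite T" "T \<subseteq> span {..<K'}" "depends_on A T E" "K' \<le> K + k * L" "K' \<le> K + l * L" for T K' E k l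
  proof -
    have "\<phi> (k * L) (l * L) x = x" if "x \<in> T" for x
      by (rule auto_fixes_span[OF \<phi>[OF sep], of "{..<K'}"])
         (use that \<open>T \<subseteq> span {..<K'}\<close> \<open>K' \<le> K + k * L\<close> \<open>K' \<le> K + l * L\<close> in \<open>auto simp: \<phi>e sw_def\<close>)
    moreover have "T \<subseteq> carrier A" using that(2) span_closed by blast
    ultimately show ?thesis
      using measure_containing_auto_Int[OF \<phi>[OF sep[of k l]] fS'[of k] S'c[of k] that(1) _ that(3)] S'kl[of k l]
      by (simp add: V_def)
  qed
  have Vlim: "\<exists>c. eventually (\<lambda>k. measure lam (V k \<inter> E) = c) sequentially" if Ec: "E \<in> cylinders" for E
  proof -
    obtain T where T: "finite T" "T \<subseteq> carrier A" "depends_on A T E" using Ec by (auto simp: cylinders_def)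
    obtain K' where K': "T \<subseteq> span {..<K'}" using finite_subset_span[OF T(1,2)] by blast
    have far: "K' \<le> K + k * L" if "k \<ge> K'" for k
    proof -
      have "k * 1 \<le> k * L" using L by (intro mult_le_mono2)
      then show ?thesis using that by linarith
    qed
    have "measure lam (V k \<inter> E) = measure lam (V K' \<inter> E)" if "k \<ge> K'" for k
      by (rule Vconst[OF T(1) K' T(3) far[OF that] far]) simp
    then show ?thesis unfolding eventually_sequentially by blast
  qed
  \<comment> \<open>By \<open>auto_finitary\<close>, \<open>\<phi>'\<close> is replaced by an
    automorphism that agrees with it on \<open>R\<close> and fixes all late blocks, hence
    \<open>V k\<close> is not affected.\<close>
  have Vinv: "eventually (\<lambda>k. measure lam (V k \<inter> contain (\<phi>' ` R)) = measure lam (V k \<inter> contain R)) sequentially"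
    if \<phi>': "\<phi>' \<in> auto A" and R: "finite R" "R \<subseteq> carrier A" for \<phi>' R
  proof -
    obtain K' where K': "R \<subseteq> span {..<K'}" using finite_subset_span[OF R] by blast
    obtain \<psi> M where \<psi>: "\<psi> \<in> auto A" "\<forall>x\<in>span {..<K'}. \<psi> x = \<phi>' x" "\<forall>i\<ge>M. \<psi> (e i) = e i"
      using auto_finitary[OF \<phi>', of K'] by blast
    have "measure lam (V k \<inter> contain (\<phi>' ` R)) = measure lam (V k \<inter> contain R)" if "k \<ge> M" for k
    proof -
      have "k * 1 \<le> k * L" using L by (intro mult_le_mono2)
      then have kM: "M \<le> K + k * L" using \<open>k \<ge> M\<close> by linarith
      have "\<psi> x = x" if x: "x \<in> S' k" for x
        by (rule auto_fixes_span[OF \<psi>(1) _ subsetD[OF S'span x]]) (use \<psi>(3) kM in auto)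
      then have "\<psi> ` S' k = S' k" by auto
      moreover have "\<psi> ` R = \<phi>' ` R" using \<psi>(2) K' by (auto intro!: image_cong)
      ultimately have "\<psi> ` (S' k \<union> R) = S' k \<union> \<phi>' ` R" by (simp add: image_Un)
      moreover have "measure lam (contain (\<psi> ` (S' k \<union> R))) = measure lam (contain (S' k \<union> R))"
        by (rule measure_containing_auto[OF \<psi>(1)]) (use fS' S'c R in auto)
      moreover have "contain (S' k \<union> Q) = V k \<inter> contain Q" for Q by (auto simp: V_def containing_def)
      ultimately show ?thesis by simp
    qed
    then show ?thesis unfolding eventually_sequentially by blast
  qed
  define p where "p = measure lam (contain S)"
  have Vp: "measure lam (V k) = p" for k
    using measure_containing_auto[OF \<phi>0 S(1) Sc] by (simp add: V_def S'_def p_def)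
  have Elam: "E \<in> sets lam" by (rule sets_lam_depends_on[OF T(1) Tc E])
  have SS: "contain S \<in> sets lam" using S(1) Sc by simp
  have "0 \<le> p" "p \<le> 1" by (simp_all add: p_def)
  \<comment> \<open>Conditioning on \<open>V k\<close> and on its complement requires both to have
    positive probability.\<close>
  then consider "p = 0" | "p = 1" | "0 < p" "p < 1" by linarith
  then show ?thesis
  proof cases
    case 1
    have "measure lam (contain S \<inter> E) \<le> p" unfolding p_def using SS by (intro lam.finite_measure_mono) auto
    then have "measure lam (contain S \<inter> E) = 0" using 1 measure_nonneg[of lam "contain S \<inter> E"] by simp
    then show ?thesis using 1 by (simp add: p_def)
  next
    case 2
    have "measure lam (E - contain S) \<le> measure lam (space lam - contain S)"
      using sets.sets_into_space[OF Elam] by (intro lam.finite_measure_mono sets.compl_sets SS) auto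
    then have "measure lam (E - contain S) = 0"
      using 2 lam.prob_compl[OF SS] by (simp add: p_def measure_le_0_iff)
    then have "measure lam E = measure lam (E \<inter> contain S)"
      using lam.finite_measure_Diff'[OF Elam SS] by simp
    then show ?thesis using 2 by (simp add: p_def Int_commute)
  next
    case 3
    have cI: "measure lam ((subgroups A - V k) \<inter> F) = measure lam F - measure lam (V k \<inter> F)"
      if "F \<in> sets lam" for F k
    proof -
      have "(subgroups A - V k) \<inter> F = F - V k" using sets.sets_into_space[OF that] by auto
      then show ?thesis using lam.finite_measure_Diff'[OF that V] by (simp add: Int_commute)
    qed
    obtain \<nu>1 where \<nu>1: "\<nu>1 \<in> CRS A"
      "\<forall>E\<in>cylinders. eventually (\<lambda>k. measure \<nu>1 E = measure lam (V k \<inter> E) / p) sequentially"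
      using conditional_limit_CRS[OF V Vp 3(1) Vlim Vinv] by blast
    have "\<exists>\<nu>\<in>CRS A. \<forall>E\<in>cylinders. eventually
        (\<lambda>k. measure \<nu> E = measure lam ((subgroups A - V k) \<inter> E) / (1 - p)) sequentially"
    proof (rule conditional_limit_CRS)
      show "subgroups A - V k \<in> sets lam" for k using sets.compl_sets[OF V, of k] by simp
      show "measure lam (subgroups A - V k) = 1 - p" for k using lam.prob_compl[OF V, of k] Vp by simp
      show "0 < 1 - p" using 3 by simp
      show "\<exists>c. eventually (\<lambda>k. measure lam ((subgroups A - V k) \<inter> E) = c) sequentially" if "E \<in> cylinders" for E
      proof -
        obtain c where "eventually (\<lambda>k. measure lam (V k \<inter> E) = c) sequentially" using Vlim[OF \<open>E \<in> cylinders\<close>] by blast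
        then have "eventually (\<lambda>k. measure lam ((subgroups A - V k) \<inter> E) = measure lam E - c) sequentially"
          by (rule eventually_mono) (simp add: cI[OF cylinders_sets[OF \<open>E \<in> cylinders\<close>]])
        then show ?thesis by blast
      qed
      fix \<phi>' R assume R: "\<phi>' \<in> auto A" "finite R" "R \<subseteq> carrier A"
      have R': "\<phi>' ` R \<subseteq> carrier A" using autoD(2)[OF R(1)] R(3) by (auto simp: bij_betw_def)
      show "eventually (\<lambda>k. measure lam ((subgroups A - V k) \<inter> contain (\<phi>' ` R)) =
          measure lam ((subgroups A - V k) \<inter> contain R)) sequentially"
        using Vinv[OF R] by (rule eventually_mono) (simp add: cI R R' measure_containing_auto)
    qed
    then obtain \<nu>2 where \<nu>2: "\<nu>2 \<in> CRS A" "\<forall>E\<in>cylinders. eventually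
        (\<lambda>k. measure \<nu>2 E = measure lam ((subgroups A - V k) \<inter> E) / (1 - p)) sequentially" by blast
    have ex: "\<exists>k. measure \<nu>1 F = measure lam (V k \<inter> F) / p \<and>
        measure \<nu>2 F = (measure lam F - measure lam (V k \<inter> F)) / (1 - p)" if F: "F \<in> cylinders" for F
    proof -
      have "eventually (\<lambda>k. measure \<nu>1 F = measure lam (V k \<inter> F) / p \<and>
        measure \<nu>2 F = measure lam ((subgroups A - V k) \<inter> F) / (1 - p)) sequentially"
        using \<nu>1(2) \<nu>2(2) F by (intro eventually_conj) auto
      then show ?thesis unfolding cI[OF cylinders_sets[OF F]]
        using eventually_happens[of _ sequentially] by simp
    qed
    \<comment> \<open>The two conditional limits have \<open>lam\<close> as a mixture with weights
      \<open>1 - p\<close> and \<open>p\<close>. Their equality at \<open>E\<close> says that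
      \<open>E\<close> is equally likely given \<open>V k\<close> and given its complement, which is
      independence.\<close>
    have "\<nu>2 = \<nu>1"
    proof (rule extreme_mixture[OF \<nu>2(1) \<nu>1(1) 3])
      fix F assume "F \<in> cylinders"
      then obtain k where "measure \<nu>1 F = measure lam (V k \<inter> F) / p"
        "measure \<nu>2 F = (measure lam F - measure lam (V k \<inter> F)) / (1 - p)" using ex by blast
      then show "measure lam F = (1 - p) * measure \<nu>2 F + p * measure \<nu>1 F" using 3 by simp
    qed
    moreover have "E \<in> cylinders" unfolding cylinders_def using T(1) Tc E by blast
    ultimately obtain k where k: "measure lam (V k \<inter> E) / p = (measure lam E - measure lam (V k \<inter> E)) / (1 - p)"
      using ex by metis
    \<comment> \<open>\<open>E\<close> is supported below \<open>K\<close>, where no block reaches,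
      so \<open>k\<close> may be replaced by 0, and the block at 0 carries \<open>S\<close>
      itself.\<close>
    have "measure lam (V k \<inter> E) = measure lam (V 0 \<inter> E)" by (rule Vconst[OF T E]) simp_all
    then have "measure lam (V k \<inter> E) = measure lam (contain S \<inter> E)" by (simp add: V_def S'0)
    then show ?thesis using k 3 by (simp add: p_def[symmetric] field_simps)
  qed
qed

end

section \<open>The index of an ergodic random subgroup\<close>

context ergodic_CRS
begin

abbreviation P :: "(nat \<Rightarrow> int) set set set \<Rightarrow> real" where "P \<equiv> measure lam"

definition freq :: "nat \<Rightarrow> real" where "freq d = P (contain {e 0 [^] d})"

lemma containing_mono:
  assumes "\<And>H. H \<in> subgroups A \<Longrightarrow> S \<subseteq> H \<Longrightarrow> S' \<subseteq> H" "finite S'" "S' \<subseteq> carrier A"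
  shows "P (contain S) \<le> P (contain S')"
  by (rule lam.finite_measure_mono) (use assms in \<open>auto simp: containing_def intro!: sets_lam_containing[unfolded containing_def]\<close>)

lemma P_basis_pow: "P (contain {e i [^] (d::nat)}) = freq d"
proof -
  define p where "p = (\<lambda>k. if k = 0 then i else if k = i then 0 else k)"
  have "p (p k) = k" for k by (auto simp: p_def)
  then have "bij p" by (metis involuntory_imp_bij)
  then have \<phi>: "endo (\<lambda>k. e (p k)) \<in> auto A" (is "?\<phi> \<in> _") by (rule auto_perm)
  have "?\<phi> (e 0 [^] d) = e i [^] d"
    using group_hom.hom_nat_pow[OF autoD(3)[OF \<phi>] e_closed] by (simp add: endo(3) p_def)
  then have "?\<phi> ` {e 0 [^] d} = {e i [^] d}" by simp
  then show ?thesis using measure_containing_auto[OF \<phi>, of "{e 0 [^] d}"] by (simp add: freq_def)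
qed

lemma P_containing_int_pow:
  assumes "x \<in> carrier A"
  shows "P (contain {x [^] (g::int)}) = P (contain {x [^] (nat \<bar>g\<bar>)})"
proof -
  have "x [^] g \<in> H \<longleftrightarrow> x [^] (nat \<bar>g\<bar>) \<in> H" if H: "subgroup H A" for H
  proof (cases g rule: int_cases2)
    case (nonneg k)
    then show ?thesis by (simp add: int_pow_int)
  next
    case (nonpos k)
    have "inv (x [^] k) \<in> H \<longleftrightarrow> x [^] k \<in> H"
      using subgroup.m_inv_closed[OF H] assms by (metis inv_inv nat_pow_closed)
    then show ?thesis using nonpos assms by (simp add: int_pow_neg_int)
  qed
  then have "contain {x [^] g} = contain {x [^] (nat \<bar>g\<bar>)}" by (auto simp: containing_def subgroups_def)
  then show ?thesis by simp
qed

lemma freq_dvd: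
  assumes "c dvd d"
  shows "freq c \<le> freq d"
  unfolding freq_def
proof (rule containing_mono)
  fix H assume H: "H \<in> subgroups A" "{e 0 [^] c} \<subseteq> H"
  obtain k where k: "d = c * k" using assms by blast
  have "(e 0 [^] c) [^] k \<in> H" by (rule subgroup_pow_closed) (use H in \<open>auto simp: subgroups_def\<close>)
  then show "{e 0 [^] d} \<subseteq> H" by (simp add: k nat_pow_pow)
qed auto

text \<open>By mixing, \<open>e 0 [^] c\<close> and \<open>e 1 [^] d\<close> lie in the subgroup
  together with positive probability. Then so does their product, which \<open>auto_gcd\<close>
  carries to a power of \<open>e 0\<close> whose exponent divides both.\<close>

lemma freq_common_divisor:
  assumes "freq c > 0" "freq d > 0"
  shows "\<exists>g. g dvd c \<and> g dvd d \<and> freq g > 0"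
proof -
  have sub: "{e 1 [^] d} \<subseteq> span {1..}" "{e 0 [^] c} \<subseteq> span {..<1}"
    using subgroup_pow_closed[OF subgroup_span e_in_span] by auto
  have "P (contain {e 1 [^] d} \<inter> contain {e 0 [^] c}) = freq d * freq c"
    using mixing[OF _ sub(1) _ sub(2) depends_on_containing] by (simp add: P_basis_pow)
  moreover have "contain {e 1 [^] d} \<inter> contain {e 0 [^] c} = contain {e 1 [^] d, e 0 [^] c}"
    by (auto simp: containing_def)
  ultimately have "P (contain {e 1 [^] d, e 0 [^] c}) = freq d * freq c" by simp
  moreover have "P (contain {e 1 [^] d, e 0 [^] c}) \<le> P (contain {e 0 [^] c \<otimes> e 1 [^] d})"
  proof (rule containing_mono)
    fix H assume "H \<in> subgroups A" "{e 1 [^] d, e 0 [^] c} \<subseteq> H"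
    then show "{e 0 [^] c \<otimes> e 1 [^] d} \<subseteq> H"
      using subgroup.m_closed[of H A "e 0 [^] c" "e 1 [^] d"] by (simp add: subgroups_def)
  qed auto
  moreover have "freq d * freq c > 0" using assms by simp
  ultimately have pos: "P (contain {e 0 [^] c \<otimes> e 1 [^] d}) > 0" by linarith
  obtain \<phi> g where \<phi>: "\<phi> \<in> auto A" and g: "\<phi> (e 0 [^] int c \<otimes> e 1 [^] int d) = e 0 [^] (g::int)" "g dvd int c" "g dvd int d"
    using auto_gcd[of 0 1 "int c" "int d"] by auto
  have "\<phi> ` {e 0 [^] c \<otimes> e 1 [^] d} = {e 0 [^] g}" using g(1) by (simp add: int_pow_int)
  then have "P (contain {e 0 [^] g}) > 0"
    using measure_containing_auto[OF \<phi>, of "{e 0 [^] c \<otimes> e 1 [^] d}"] pos by simp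
  then have "freq (nat \<bar>g\<bar>) > 0" unfolding P_containing_int_pow[OF e_closed] freq_def .
  moreover have "nat \<bar>g\<bar> dvd c" "nat \<bar>g\<bar> dvd d" using g(2,3) int_dvd_int_iff[of "nat \<bar>g\<bar>" c] int_dvd_int_iff[of "nat \<bar>g\<bar>" d] by simp_all
  ultimately show ?thesis by blast
qed

lemma freq_one: "e 0 [^] d = \<one> \<Longrightarrow> freq d = 1"
proof -
  assume "e 0 [^] d = \<one>"
  then have "contain {e 0 [^] d} = space lam" by (auto simp: containing_def subgroups_def subgroup.one_closed)
  then show ?thesis by (simp add: freq_def lam.prob_space del: space_lam)
qed

lemma exists_index: "\<exists>m. \<forall>d. freq d > 0 \<longleftrightarrow> m dvd d"
proof (cases "\<exists>d>0. freq d > 0")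
  case True
  define m where "m = (LEAST d. d > 0 \<and> freq d > 0)"
  have m: "m > 0" "freq m > 0" using LeastI_ex[OF True] by (auto simp: m_def)
  have least: "m \<le> d" if "d > 0" "freq d > 0" for d unfolding m_def by (rule Least_le) (use that in simp)
  have "m dvd d" if d: "freq d > 0" for d
  proof -
    obtain g where g: "g dvd m" "g dvd d" "freq g > 0" using freq_common_divisor[OF m(2) d] by blast
    have "g > 0" using g(1) m(1) by (rule dvd_pos_nat[rotated])
    then have "m \<le> g" using least g by blast
    moreover have "g \<le> m" using g(1) m(1) by (rule dvd_imp_le)
    ultimately show ?thesis using g by simp
  qed
  moreover have "freq d > 0" if "m dvd d" for d using freq_dvd[OF that] m by linarith
  ultimately show ?thesis by blast
next
  case False
  \<comment> \<open>The identity lies in every subgroup. Since 0 divides only 0, the value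
    \<open>m = 0\<close> describes exactly this case.\<close>
  have "freq 0 = 1" by (rule freq_one) simp
  then have "freq d > 0 \<longleftrightarrow> d = 0" for d using False by (metis gr0I zero_less_one)
  then show ?thesis by (intro exI[of _ 0]) simp
qed

definition index :: nat where "index = (SOME m. \<forall>d. freq d > 0 \<longleftrightarrow> m dvd d)"

lemma freq_pos_iff: "freq d > 0 \<longleftrightarrow> index dvd d"
  using someI_ex[OF exists_index, folded index_def] by blast

lemma index_dvd: "index dvd n"
  using freq_one[of n] by (simp flip: freq_pos_iff)

abbreviation mA :: "(nat \<Rightarrow> int) set set" where "mA \<equiv> multiples A index (carrier A)"

text \<open>By \<open>auto_monomial\<close> an automorphism takes \<open>x\<close> to a multiple of
  \<open>e 0\<close>, where \<open>index\<close> decides; pulling a root back along the automorphism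
  shows that \<open>x\<close> is an \<open>index\<close>-multiple.\<close>

lemma mem_mA:
  assumes x: "x \<in> carrier A" and pos: "P (contain {x}) > 0"
  shows "x \<in> mA"
proof -
  obtain \<phi> d where \<phi>: "\<phi> \<in> auto A" and d: "\<phi> x = e 0 [^] (d::int)" using auto_monomial[OF x] by blast
  have "P (contain {e 0 [^] d}) > 0" using measure_containing_auto[OF \<phi>, of "{x}"] x pos d by simp
  then have "index dvd nat \<bar>d\<bar>"
    unfolding P_containing_int_pow[OF e_closed] freq_def[symmetric] freq_pos_iff .
  then have "int index dvd d" using int_dvd_int_iff[of index "nat \<bar>d\<bar>"] by simp
  then obtain c where c: "d = int index * c" by blast
  have "e 0 [^] c \<in> \<phi> ` carrier A" using autoD(2)[OF \<phi>] by (simp add: bij_betw_def)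
  then obtain y where y: "y \<in> carrier A" "\<phi> y = e 0 [^] c" by auto
  have "\<phi> (y [^] index) = \<phi> x"
    using group_hom.hom_nat_pow[OF autoD(3)[OF \<phi>] y(1)] y(2) d c
    by (simp add: int_pow_pow mult.commute flip: int_pow_int)
  then have "y [^] index = x"
    using autoD(2)[OF \<phi>] x y(1) by (auto simp: bij_betw_def inj_on_def)
  then show ?thesis using y by (auto simp: mem_multiples)
qed

lemma AE_subset_mA: "AE H in lam. H \<subseteq> mA"
proof -
  have "AE H in lam. \<forall>x\<in>carrier A - mA. x \<notin> H"
  proof (subst AE_ball_countable, rule countable_Diff[OF countable_carrier], rule ballI)
    fix x assume x: "x \<in> carrier A - mA"
    then have "P (contain {x}) = 0" using mem_mA[of x] by (auto simp: zero_less_measure_iff)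
    moreover have "contain {x} \<in> sets lam" using x by simp
    ultimately have "AE H in lam. H \<notin> contain {x}"
      by (intro AE_not_in) (simp add: null_sets_def lam.emeasure_eq_measure)
    moreover have "AE H in lam. H \<in> space lam" by (rule AE_space)
    ultimately show "AE H in lam. x \<notin> H" by eventually_elim (simp add: containing_def)
  qed
  moreover have "AE H in lam. H \<in> space lam" by (rule AE_space)
  ultimately show ?thesis
    by eventually_elim (auto simp: subgroups_def dest: subgroup.mem_carrier)
qed

text \<open>Mixing wants one event below a bound and the other beyond it, so the indices are added
  in increasing order.\<close>

lemma P_basis_pows:
  assumes "finite I"
  shows "P (contain ((\<lambda>i. e i [^] index) ` I)) = freq index ^ card I"
  using assms
proof (induct I rule: finite_linorder_max_induct)
  case empty
  have "contain {} = space lam" by (auto simp: containing_def)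
  then show ?case using lam.prob_space by simp
next
  case (insert b I)
  have "P (contain {e b [^] index} \<inter> contain ((\<lambda>i. e i [^] index) ` I)) =
    P (contain {e b [^] index}) * P (contain ((\<lambda>i. e i [^] index) ` I))"
  proof (rule mixing)
    show "{e b [^] index} \<subseteq> span {b..}"
      using subgroup_pow_closed[OF subgroup_span e_in_span] by auto
    show "(\<lambda>i. e i [^] index) ` I \<subseteq> span {..<b}"
      using insert(2) subgroup_pow_closed[OF subgroup_span e_in_span] by auto
  qed (use insert depends_on_containing in auto)
  moreover have "contain {e b [^] index} \<inter> contain ((\<lambda>i. e i [^] index) ` I) =
    contain ((\<lambda>i. e i [^] index) ` insert b I)" by (auto simp: containing_def)
  moreover have "b \<notin> I" using insert(2) by auto
  ultimately show ?case using insert by (simp add: P_basis_pow)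
qed

text \<open>The shear of the \<open>e k\<close>, \<open>k \<in> J\<close>, by the inverses of
  \<open>j k\<close> fixes the span of the first \<open>K\<close> basis vectors, hence
  \<open>E\<close>, and carries the unshifted event to the shifted one. So every value of the shift
  is equally likely, independently of \<open>E\<close>.\<close>

lemma P_shifted_basis:
  assumes J: "finite J" "J \<subseteq> {K..}" and j: "\<And>k. k \<in> J \<Longrightarrow> j k \<in> span {..<K}"
    and T: "finite T" "T \<subseteq> span {..<K}" and E: "depends_on A T E"
  shows "P (contain ((\<lambda>k. (e k \<otimes> inv (j k)) [^] index) ` J) \<inter> E) = freq index ^ card J * P E"
proof -
  define t where "t = (\<lambda>k. if k \<in> J then inv (j k) else \<one>)"
  have tK: "t k \<in> span {..<K}" for k
    using j subgroup.m_inv_closed[OF subgroup_span] generate.one by (auto simp: t_def)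
  have t: "t k \<in> carrier A" for k using tK span_closed by blast
  have t1: "t k = \<one>" if "k < K" for k using that J(2) by (auto simp: t_def)
  have et1: "endo t x = \<one>" if x: "x \<in> span {..<K}" for x
    by (rule hom_one_on_span[OF endo(1)[OF t] _ x]) (simp add: endo(3)[OF t] t1)
  have \<phi>: "endo (\<lambda>k. e k \<otimes> t k) \<in> auto A" (is "?\<phi> \<in> _") by (rule auto_shear[OF t et1[OF tK]])
  have et: "e k \<otimes> t k \<in> carrier A" for k using t by simp
  have im: "?\<phi> ` ((\<lambda>k. e k [^] index) ` J) = (\<lambda>k. (e k \<otimes> inv (j k)) [^] index) ` J"
    unfolding image_image
  proof (rule image_cong[OF refl])
    fix k assume "k \<in> J"
    then have "?\<phi> (e k) = e k \<otimes> inv (j k)" by (simp add: endo(3)[OF et]) (simp add: t_def)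
    then show "?\<phi> (e k [^] index) = (e k \<otimes> inv (j k)) [^] index"
      using group_hom.hom_nat_pow[OF autoD(3)[OF \<phi>] e_closed, of k index] by simp
  qed
  have fix_T: "?\<phi> x = x" if x: "x \<in> T" for x
    by (rule auto_fixes_span[OF \<phi> _ subsetD[OF T(2) x]]) (simp add: endo(3)[OF et] t1)
  have Tc: "T \<subseteq> carrier A" using T(2) span_closed by blast
  have Jc: "(\<lambda>k. e k [^] index) ` J \<subseteq> carrier A" by (rule image_subsetI) simp
  have "P (contain ((\<lambda>k. (e k \<otimes> inv (j k)) [^] index) ` J) \<inter> E) = P (contain ((\<lambda>k. e k [^] index) ` J) \<inter> E)"
    using measure_containing_auto_Int[OF \<phi> finite_imageI[OF J(1)] Jc T(1) Tc E fix_T] unfolding im by simp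
  also have "\<dots> = P (contain ((\<lambda>k. e k [^] index) ` J)) * P E"
  proof (rule mixing[OF _ _ T E])
    show "(\<lambda>k. e k [^] index) ` J \<subseteq> span {K..}"
      using J(2) subgroup_pow_closed[OF subgroup_span e_in_span] by auto
  qed (use J in simp)
  finally show ?thesis using P_basis_pows[OF J(1)] by simp
qed

section \<open>Representatives of \<open>mA\<close> modulo the random subgroup\<close>

definition separated :: "(nat \<Rightarrow> int) set set \<Rightarrow> (nat \<Rightarrow> int) set set set"
  where "separated W = {H \<in> subgroups A. \<forall>w\<in>W. \<forall>w'\<in>W. w \<noteq> w' \<longrightarrow> (w \<otimes> inv w') [^] index \<notin> H}"

text \<open>The elements whose membership in \<open>H\<close> decides whether \<open>H\<close> is in
  \<open>separated W\<close>.\<close>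

definition differences :: "(nat \<Rightarrow> int) set set \<Rightarrow> (nat \<Rightarrow> int) set set"
  where "differences W = (\<lambda>(w, w'). (w \<otimes> inv w') [^] index) ` (W \<times> W)"

lemma finite_differences: "finite W \<Longrightarrow> finite (differences W)"
  by (simp add: differences_def)

lemma differences_subset:
  assumes "subgroup K A" "W \<subseteq> K"
  shows "differences W \<subseteq> K"
proof
  fix x assume "x \<in> differences W"
  then obtain a b where ab: "a \<in> K" "b \<in> K" "x = (a \<otimes> inv b) [^] index"
    using assms(2) by (auto simp: differences_def)
  show "x \<in> K"
    unfolding ab(3)
    by (rule subgroup_pow_closed[OF assms(1) subgroup.m_closed[OF assms(1) ab(1) subgroup.m_inv_closed[OF assms(1) ab(2)]]])
qed

lemma depends_on_separated: "depends_on A (differences W) (separated W)"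
  unfolding depends_on_def
proof (intro conjI ballI impI)
  fix H H' assume *: "H' \<in> subgroups A" "H \<inter> differences W = H' \<inter> differences W" "H \<in> separated W"
  have "(w \<otimes> inv w') [^] index \<in> differences W" if "w \<in> W" "w' \<in> W" for w w'
    using that by (auto simp: differences_def)
  then show "H' \<in> separated W" using * unfolding separated_def by blast
qed (auto simp: separated_def)

lemma sets_separated: "finite W \<Longrightarrow> W \<subseteq> carrier A \<Longrightarrow> separated W \<in> sets lam"
  by (rule sets_lam_depends_on[OF finite_differences differences_subset[OF subgroup_self] depends_on_separated])

lemma separated_unique:
  assumes "H \<in> separated W" "W \<subseteq> carrier A" "w \<in> W" "w' \<in> W" "x \<in> carrier A"
    and "(x \<otimes> inv w) [^] index \<in> H" "(x \<otimes> inv w') [^] index \<in> H"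
  shows "w = w'"
proof (rule ccontr)
  assume ne: "w \<noteq> w'"
  have H: "subgroup H A" using assms(1) by (simp add: separated_def subgroups_def)
  have c: "w \<in> carrier A" "w' \<in> carrier A" using assms by auto
  have "inv (x \<otimes> inv w) \<otimes> (x \<otimes> inv w') = w \<otimes> ((inv x \<otimes> x) \<otimes> inv w')"
    using c assms(5) by (simp only: inv_mult_group inv_inv inv_closed m_assoc m_closed)
  then have "w \<otimes> inv w' = inv (x \<otimes> inv w) \<otimes> (x \<otimes> inv w')"
    using c assms(5) by simp
  then have "(w \<otimes> inv w') [^] index = inv ((x \<otimes> inv w) [^] index) \<otimes> (x \<otimes> inv w') [^] index"
    using c assms(5) by (simp add: nat_pow_distrib nat_pow_inv)
  then have "(w \<otimes> inv w') [^] index \<in> H"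
    using subgroup.m_closed[OF H subgroup.m_inv_closed[OF H assms(6)] assms(7)] by simp
  then show False using assms(1,3,4) ne by (simp add: separated_def)
qed

lemma card_separated:
  assumes W: "finite W" "W \<subseteq> carrier A" and pos: "P (separated W) > 0"
  shows "real (card W) * freq index \<le> 1"
proof -
  \<comment> \<open>\<open>e K\<close> is a fresh basis vector beyond the support of
    \<open>W\<close>, so each event shifted by some \<open>w\<close> is independent of
    \<open>separated W\<close>.\<close>
  obtain K where K: "W \<subseteq> span {..<K}" using finite_subset_span[OF W] by blast
  define Q where "Q = (\<lambda>w. contain {(e K \<otimes> inv w) [^] index} \<inter> separated W)"
  have Q: "P (Q w) = freq index * P (separated W)" if "w \<in> W" for w
    using P_shifted_basis[of "{K}" K "\<lambda>_. w" "differences W" "separated W"] that K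
      finite_differences[OF W(1)] differences_subset[OF subgroup_span K] depends_on_separated
    by (auto simp: Q_def)
  have Qs: "Q w \<in> sets lam" if "w \<in> W" for w
    unfolding Q_def using that W by (intro sets.Int sets_lam_containing sets_separated) auto
  have "disjoint_family_on Q W"
    unfolding disjoint_family_on_def
  proof (intro ballI impI)
    fix w w' assume w: "w \<in> W" "w' \<in> W" "w \<noteq> w'"
    have False if H: "H \<in> Q w" "H \<in> Q w'" for H
    proof -
      have "w = w'"
        by (rule separated_unique[OF _ W(2) w(1,2) e_closed[of K]]) (use H in \<open>auto simp: Q_def containing_def\<close>)
      then show False using w(3) by simp
    qed
    then show "Q w \<inter> Q w' = {}" by blast
  qed
  then have "P (\<Union>w\<in>W. Q w) = (\<Sum>w\<in>W. P (Q w))"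
    using Qs W by (intro lam.finite_measure_finite_Union) auto
  moreover have "P (\<Union>w\<in>W. Q w) \<le> P (separated W)"
    by (rule lam.finite_measure_mono) (use sets_separated[OF W] in \<open>auto simp: Q_def\<close>)
  ultimately have "real (card W) * freq index * P (separated W) \<le> 1 * P (separated W)" using Q by simp
  then show ?thesis using pos by (simp only: mult_le_cancel_right)
qed

text \<open>For \<open>H \<subseteq> mA\<close> and \<open>W\<close> in the carrier, the
  \<open>index\<close>-th powers of the elements of \<open>W\<close> represent each coset of
  \<open>H\<close> in \<open>mA\<close> exactly once.\<close>

definition transversal :: "(nat \<Rightarrow> int) set set \<Rightarrow> (nat \<Rightarrow> int) set set \<Rightarrow> bool"
  where "transversal W H \<longleftrightarrow> H \<in> separated W \<and> (\<forall>x\<in>carrier A. \<exists>w\<in>W. (x \<otimes> inv w) [^] index \<in> H)"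

text \<open>The bound of \<open>card_separated\<close> gives a \<open>W\<close> of maximal size with
  \<open>separated W\<close> of positive probability. By maximality and countability, almost surely
  on \<open>separated W\<close> no element can be added, so \<open>W\<close> represents all of
  \<open>mA\<close>. A fresh \<open>e K\<close> is then represented by some \<open>w\<close>, and
  the disjoint events that gave the bound fill \<open>separated W\<close>.\<close>

lemma exists_transversal:
  "\<exists>W. finite W \<and> W \<subseteq> carrier A \<and> P (separated W) > 0 \<and>
    (AE H in lam. H \<in> separated W \<longrightarrow> transversal W H) \<and> real (card W) * freq index = 1"
proof -
  let ?Q = "\<lambda>W. finite W \<and> W \<subseteq> carrier A \<and> P (separated W) > 0"
  have fpos: "freq index > 0" by (simp add: freq_pos_iff)
  have bound: "card W \<le> nat \<lfloor>1 / freq index\<rfloor>" if "?Q W" for W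
  proof -
    have "real (card W) \<le> 1 / freq index"
      using card_separated[of W] that fpos by (simp add: pos_le_divide_eq)
    then show ?thesis by (simp add: le_nat_floor)
  qed
  have "separated {} = space lam" by (auto simp: separated_def)
  then have "?Q {}" using lam.prob_space by simp
  then obtain W where W: "?Q W" and max: "\<forall>W'. ?Q W' \<longrightarrow> card W' \<le> card W"
    using ex_has_greatest_nat[of ?Q "{}" card "Suc (nat \<lfloor>1 / freq index\<rfloor>)"] bound
    by (metis (no_types, lifting) le_imp_less_Suc)
  \<comment> \<open>The subgroups that keep \<open>W\<close> separated and would still allow
    \<open>x\<close> to be added.\<close>
  define R where "R = (\<lambda>x. {H \<in> separated W. \<forall>w\<in>W. (x \<otimes> inv w) [^] index \<notin> H})"
  have fW: "finite W" and Wc: "W \<subseteq> carrier A" using W by auto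
  have R: "R x \<in> sets lam \<and> P (R x) = 0" if x: "x \<in> carrier A" for x
  proof (cases "R x = {}")
    case False
    then have xW: "x \<notin> W"
      using x by (auto simp: R_def separated_def subgroups_def r_inv subgroup.one_closed)
    have eq: "R x = separated (insert x W)"
    proof (rule Set.set_eqI, rule iffI)
      fix H assume H: "H \<in> R x"
      then have sH: "subgroup H A" by (simp add: R_def separated_def subgroups_def)
      have "(w \<otimes> inv x) [^] index \<notin> H" if w: "w \<in> W" for w
      proof
        have wc: "w \<in> carrier A" using w Wc by blast
        assume "(w \<otimes> inv x) [^] index \<in> H"
        then have "inv ((w \<otimes> inv x) [^] index) \<in> H" by (rule subgroup.m_inv_closed[OF sH])
        moreover have "inv ((w \<otimes> inv x) [^] index) = (x \<otimes> inv w) [^] index"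
          using wc x by (simp add: nat_pow_inv[symmetric] inv_mult_group m_comm)
        ultimately show False using H w by (simp add: R_def)
      qed
      then show "H \<in> separated (insert x W)" using H unfolding R_def separated_def by auto
    next
      fix H assume "H \<in> separated (insert x W)"
      then show "H \<in> R x" using xW unfolding R_def separated_def by auto
    qed
    have "P (R x) = 0"
    proof (rule ccontr)
      assume "P (R x) \<noteq> 0"
      then have "P (separated (insert x W)) > 0" unfolding eq by (simp add: zero_less_measure_iff)
      then have "card (insert x W) \<le> card W" using max fW Wc x by blast
      then show False using xW fW by simp
    qed
    then show ?thesis using eq sets_separated[of "insert x W"] fW Wc x by simp
  qed auto
  have "AE H in lam. \<forall>x\<in>carrier A. H \<notin> R x"
  proof (subst AE_ball_countable, rule countable_carrier, rule ballI)
    fix x assume "x \<in> carrier A"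
    then show "AE H in lam. H \<notin> R x"
      using R by (intro AE_not_in) (simp add: null_sets_def lam.emeasure_eq_measure)
  qed
  then have ae: "AE H in lam. H \<in> separated W \<longrightarrow> transversal W H"
    by eventually_elim (auto simp: R_def transversal_def)
  obtain K where K: "W \<subseteq> span {..<K}" using finite_subset_span[OF fW Wc] by blast
  define Q where "Q = (\<lambda>w. contain {(e K \<otimes> inv w) [^] index} \<inter> separated W)"
  have Q: "P (Q w) = freq index * P (separated W)" if "w \<in> W" for w
    using P_shifted_basis[of "{K}" K "\<lambda>_. w" "differences W" "separated W"] that K
      finite_differences[OF fW] differences_subset[OF subgroup_span K] depends_on_separated
    by (auto simp: Q_def)
  have Qs: "Q w \<in> sets lam" if "w \<in> W" for w
    unfolding Q_def using that fW Wc by (intro sets.Int sets_lam_containing sets_separated) auto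
  have "P (separated W) \<le> P (\<Union>w\<in>W. Q w)"
  proof (rule lam.finite_measure_mono_AE)
    show "AE H in lam. H \<in> separated W \<longrightarrow> H \<in> (\<Union>w\<in>W. Q w)"
      using ae by eventually_elim (force simp: transversal_def Q_def containing_def separated_def)
    show "(\<Union>w\<in>W. Q w) \<in> sets lam" using Qs fW by (intro sets.finite_UN) auto
  qed
  also have "\<dots> \<le> (\<Sum>w\<in>W. P (Q w))"
    by (rule lam.finite_measure_subadditive_finite) (use Qs fW in auto)
  also have "\<dots> = (real (card W) * freq index) * P (separated W)" using Q by simp
  finally have "1 \<le> real (card W) * freq index" using W by simp
  then have "real (card W) * freq index = 1" using card_separated[of W] W by simp
  then show ?thesis using W ae by blast
qed

text \<open>Moving \<open>S\<close> to the fresh coordinates from \<open>M\<close> on keeps its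
  probability and makes it independent of the atom \<open>E\<close>. Given \<open>E\<close>, the
  \<open>index\<close>-th power of each \<open>e (i + M)\<close> is congruent modulo
  \<open>H\<close> to that of exactly one \<open>j i\<close> in \<open>W\<close>, and all functions
  \<open>j\<close> are equally likely. By linearity the moved \<open>S\<close> lies in
  \<open>H\<close> iff its image under the endomorphism given by \<open>j\<close> does. These images
  belong to \<open>T\<close>, so \<open>C\<close> decides, and the probability becomes a
  count.\<close>

lemma P_containing_atom:
  assumes W: "finite W" "W \<subseteq> span {..<K}" and KM: "K \<le> M" "N \<le> M"
    and S: "finite S" "S \<subseteq> multiples A index (span {..<N})"
    and card_W: "real (card W) * freq index = 1"
    and T: "T = differences W \<union> (\<Union>j\<in>{..<N} \<rightarrow>\<^sub>E W. endo (\<lambda>i. if i < N then j i else \<one>) ` S)"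
    and E: "E = {H \<in> subgroups A. H \<inter> T = C}" "E \<subseteq> separated W" "P E > 0"
  shows "P (contain S) = card {j \<in> {..<N} \<rightarrow>\<^sub>E W. endo (\<lambda>i. if i < N then j i else \<one>) ` S \<subseteq> C} * freq index ^ N"
proof -
  let ?J = "{..<N} \<rightarrow>\<^sub>E W"
  define \<theta> where "\<theta> = (\<lambda>j. endo (\<lambda>i. if i < N then j i else \<one>))"
  have Wc: "W \<subseteq> carrier A" using W(2) span_closed by blast
  have finJ: "finite ?J" using W(1) by (intro finite_PiE) auto
  have jW: "j i \<in> W" if "j \<in> ?J" "i < N" for j i using that by auto
  have jc: "(if i < N then j i else \<one>) \<in> carrier A" if "j \<in> ?J" for i j
    using jW[OF that] Wc by auto
  have \<theta>hom: "\<theta> j \<in> hom A A" and \<theta>e: "\<theta> j (e i) = (if i < N then j i else \<one>)" if "j \<in> ?J" for i j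
    unfolding \<theta>_def by (rule endo(1)[OF jc[OF that]], rule endo(3)[OF jc[OF that]])
  have \<theta>K: "\<theta> j x \<in> span {..<K}" if j: "j \<in> ?J" and x: "x \<in> carrier A" for j x
    by (rule hom_image_span[OF \<theta>hom[OF j], of UNIV])
       (use x span_UNIV jW[OF j] W(2) generate.one in \<open>auto simp: \<theta>e[OF j] simp del: in_mono\<close>)
  have mc: "multiples A index (span {..<N}) \<subseteq> carrier A"
    by (rule multiples_subset) (use span_closed in blast)
  then have Sc: "S \<subseteq> carrier A" using S(2) by blast
  have Tfin: "finite T" unfolding T using finite_differences[OF W(1)] finJ S(1) by blast
  have TK: "T \<subseteq> span {..<K}"
    unfolding T \<theta>_def[symmetric]
    using differences_subset[OF subgroup_span W(2)] \<theta>K Sc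
    by (auto simp: \<theta>_def)
  have depE: "depends_on A T E" by (auto simp: E(1) depends_on_def)
  have Esets: "E \<in> sets lam"
    by (rule sets_lam_depends_on[OF Tfin _ depE]) (use TK span_closed in blast)
  \<comment> \<open>Exchanges the first \<open>N\<close> basis vectors with the block at
    \<open>M\<close>; the two blocks are disjoint because \<open>N \<le> M\<close>.\<close>
  define p where "p = (\<lambda>i. if i < N then i + M else if M \<le> i \<and> i < M + N then i - M else i)"
  have "p (p i) = i" for i using KM by (auto simp: p_def)
  then have "bij p" by (metis involuntory_imp_bij)
  then have \<phi>auto: "endo (\<lambda>i. e (p i)) \<in> auto A" by (rule auto_perm)
  define \<phi> where "\<phi> = endo (\<lambda>i. e (p i))"
  have \<phi>: "\<phi> \<in> auto A" and \<phi>e: "\<phi> (e i) = e (p i)" for i using \<phi>auto by (simp_all add: \<phi>_def endo(3))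
  note \<phi>hom = autoD(3)[OF \<phi>]
  have S_pow: "\<exists>u\<in>span {..<N}. s = u [^] index" if "s \<in> S" for s
    using S(2) that by (auto simp: mem_multiples)
  have \<phi>S: "\<phi> ` S \<subseteq> span {M..}"
  proof
    fix y assume "y \<in> \<phi> ` S"
    then obtain u where u: "u \<in> span {..<N}" "y = \<phi> (u [^] index)" using S_pow by blast
    have "\<phi> u \<in> span {M..}"
      by (rule hom_image_span[OF autoD(1)[OF \<phi>] _ u(1)]) (auto simp: \<phi>e p_def intro!: e_in_span)
    then have "(\<phi> u) [^] index \<in> span {M..}" by (rule subgroup_pow_closed[OF subgroup_span])
    then show "y \<in> span {M..}" using u(2) group_hom.hom_nat_pow[OF \<phi>hom span_closed[OF u(1)]] by simp
  qed
  then have \<phi>SK: "\<phi> ` S \<subseteq> span {K..}" using span_mono[of "{M..}" "{K..}"] KM by auto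
  then have \<phi>Sc: "\<phi> ` S \<subseteq> carrier A" using span_closed by blast
  have PS: "P (contain (\<phi> ` S)) = P (contain S)" by (rule measure_containing_auto[OF \<phi> S(1) Sc])
  have mix: "P (contain (\<phi> ` S) \<inter> E) = P (contain S) * P E"
    using mixing[OF finite_imageI[OF S(1)] \<phi>SK Tfin TK depE] PS by simp
  define B where "B = (\<lambda>j. (\<lambda>k. (e k \<otimes> inv (j (k - M))) [^] index) ` {M..<M + N})"
  define Q where "Q = (\<lambda>j. contain (B j) \<inter> E)"
  have jM: "j (k - M) \<in> span {..<K}" if "j \<in> ?J" "k \<in> {M..<M + N}" for j k
    using jW[OF that(1), of "k - M"] that(2) W(2) by auto
  have Bc: "B j \<subseteq> carrier A" if "j \<in> ?J" for j
    unfolding B_def by (rule image_subsetI) (simp add: span_closed[OF jM[OF that]])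
  have MK: "{M..<M + N} \<subseteq> {K..}" using KM(1) by auto
  have PQ: "P (Q j) = freq index ^ N * P E" if j: "j \<in> ?J" for j
    unfolding Q_def B_def
    using P_shifted_basis[of "{M..<M + N}" K "\<lambda>k. j (k - M)", OF _ MK jM[OF j] Tfin TK depE] by simp
  have Qs: "Q j \<in> sets lam" if "j \<in> ?J" for j
    unfolding Q_def by (intro sets.Int Esets sets_lam_containing Bc[OF that]) (simp add: B_def)
  have disj: "j = j'" if j: "j \<in> ?J" "j' \<in> ?J" and H: "H \<in> Q j" "H \<in> Q j'" for j j' H
  proof (rule PiE_ext[OF j])
    fix i assume i: "i \<in> {..<N}"
    have "(e (i + M) \<otimes> inv (j i)) [^] index \<in> B j" "(e (i + M) \<otimes> inv (j' i)) [^] index \<in> B j'"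
      unfolding B_def using i by (auto intro!: image_eqI[of _ _ "i + M"])
    then have "(e (i + M) \<otimes> inv (j i)) [^] index \<in> H" "(e (i + M) \<otimes> inv (j' i)) [^] index \<in> H"
      using H by (auto simp: Q_def containing_def)
    moreover have "H \<in> separated W" using H E(2) by (auto simp: Q_def)
    ultimately show "j i = j' i"
      using separated_unique[OF _ Wc jW[OF j(1)] jW[OF j(2)] e_closed[of "i + M"]] i by auto
  qed
  have key: "\<phi> ` S \<subseteq> H \<longleftrightarrow> \<theta> j ` S \<subseteq> H" if j: "j \<in> ?J" and H: "H \<in> Q j" for j H
  proof -
    have sH: "subgroup H A" using H by (simp add: Q_def containing_def subgroups_def)
    have gh\<theta>: "group_hom A A (\<theta> j)"
      using \<theta>hom[OF j] is_group by (simp add: group_hom_def group_hom_axioms_def)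
    \<comment> \<open>The discrepancy between \<open>\<phi>\<close> and \<open>\<theta> j\<close>,
      raised to the power \<open>index\<close>. It is a homomorphism, so it suffices that
      \<open>H\<close> contains its values at the first \<open>N\<close> basis vectors, which is the
      event \<open>Q j\<close>.\<close>
    define g where "g = (\<lambda>u. (\<phi> u \<otimes> inv (\<theta> j u)) [^] index)"
    have c: "\<phi> u \<in> carrier A" "\<theta> j u \<in> carrier A" if "u \<in> carrier A" for u
      using that group_hom.hom_closed[OF \<phi>hom] group_hom.hom_closed[OF gh\<theta>] by auto
    have "g \<in> hom A A"
    proof (rule homI)
      fix x y assume xy: "x \<in> carrier A" "y \<in> carrier A"
      have "\<phi> (x \<otimes> y) \<otimes> inv (\<theta> j (x \<otimes> y)) = (\<phi> x \<otimes> inv (\<theta> j x)) \<otimes> (\<phi> y \<otimes> inv (\<theta> j y))"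
        using xy c by (simp add: group_hom.hom_mult[OF \<phi>hom] group_hom.hom_mult[OF gh\<theta>] inv_mult m_ac)
      then show "g (x \<otimes> y) = g x \<otimes> g y" using xy c by (simp add: g_def nat_pow_distrib)
    qed (use c in \<open>simp add: g_def\<close>)
    then have "group_hom A A g" using is_group by (simp add: group_hom_def group_hom_axioms_def)
    then have "subgroup {u \<in> carrier A. g u \<in> H} A" by (rule group_hom.subgroup_vimage[OF _ sH])
    moreover have "e ` {..<N} \<subseteq> {u \<in> carrier A. g u \<in> H}"
    proof (intro image_subsetI CollectI conjI e_closed)
      fix i assume i: "i \<in> {..<N}"
      have "g (e i) = (e (i + M) \<otimes> inv (j i)) [^] index" using i by (simp add: g_def \<phi>e \<theta>e[OF j] p_def)
      also have "\<dots> \<in> B j" unfolding B_def using i by (auto intro!: image_eqI[of _ _ "i + M"])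
      finally show "g (e i) \<in> H" using H by (auto simp: Q_def containing_def)
    qed
    ultimately have gH: "span {..<N} \<subseteq> {u \<in> carrier A. g u \<in> H}" by (intro generate_subgroup_incl)
    have "\<phi> s \<in> H \<longleftrightarrow> \<theta> j s \<in> H" if s: "s \<in> S" for s
    proof -
      obtain u where u: "u \<in> span {..<N}" "s = u [^] index" using S_pow[OF s] by blast
      note uc = span_closed[OF u(1)]
      have sc: "s \<in> carrier A" using uc u(2) by simp
      have "g u = \<phi> s \<otimes> inv (\<theta> j s)"
        unfolding g_def u(2) using uc c[OF uc]
        by (simp add: group_hom.hom_nat_pow[OF \<phi>hom] group_hom.hom_nat_pow[OF gh\<theta>] nat_pow_distrib nat_pow_inv)
      then have gs: "\<phi> s \<otimes> inv (\<theta> j s) \<in> H" using gH u(1) by auto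
      have 1: "\<phi> s = (\<phi> s \<otimes> inv (\<theta> j s)) \<otimes> \<theta> j s" using c[OF sc] by (simp add: m_assoc)
      have 2: "\<theta> j s = inv (\<phi> s \<otimes> inv (\<theta> j s)) \<otimes> \<phi> s" using c[OF sc] by (simp add: inv_mult_group m_assoc)
      show ?thesis
        using subgroup.m_closed[OF sH gs, of "\<theta> j s"]
          subgroup.m_closed[OF sH subgroup.m_inv_closed[OF sH gs], of "\<phi> s"] 1 2 by metis
    qed
    then show ?thesis by (simp add: image_subset_iff)
  qed
  have PQS: "P (contain (\<phi> ` S) \<inter> Q j) = (if \<theta> j ` S \<subseteq> C then freq index ^ N * P E else 0)" if j: "j \<in> ?J" for j
  proof -
    have "\<theta> j ` S \<subseteq> T" using j unfolding T \<theta>_def by blast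
    then have "\<theta> j ` S \<subseteq> H \<longleftrightarrow> \<theta> j ` S \<subseteq> C" if "H \<in> Q j" for H using that unfolding Q_def E(1) by blast
    then have "H \<in> contain (\<phi> ` S) \<longleftrightarrow> \<theta> j ` S \<subseteq> C" if "H \<in> Q j" for H
      using key[OF j that] that by (simp add: containing_def Q_def)
    then have "contain (\<phi> ` S) \<inter> Q j = (if \<theta> j ` S \<subseteq> C then Q j else {})" by auto
    then show ?thesis using PQ[OF j] by simp
  qed
  have QU: "(\<Union>j\<in>?J. Q j) \<in> sets lam" using Qs finJ by blast
  \<comment> \<open>There are \<open>card W ^ N\<close> disjoint events \<open>Q j\<close>, each of
    probability \<open>freq index ^ N * P E\<close>. By \<open>card_W\<close> they exhaust
    \<open>E\<close> up to a null set.\<close>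
  have "P (\<Union>j\<in>?J. Q j) = (\<Sum>j\<in>?J. P (Q j))"
    by (rule lam.finite_measure_finite_Union[OF finJ])
       (use Qs disj in \<open>auto simp: disjoint_family_on_def\<close>)
  also have "\<dots> = real (card W) ^ N * (freq index ^ N * P E)"
    using PQ by (simp add: card_PiE)
  also have "\<dots> = P E" using card_W by (simp flip: power_mult_distrib mult.assoc)
  finally have "P (E - (\<Union>j\<in>?J. Q j)) = 0"
    using lam.finite_measure_Diff[OF Esets QU] by (auto simp: Q_def)
  then have "P (contain (\<phi> ` S) \<inter> E - (\<Union>j\<in>?J. Q j)) = 0"
    using lam.finite_measure_mono[of "contain (\<phi> ` S) \<inter> E - (\<Union>j\<in>?J. Q j)" "E - (\<Union>j\<in>?J. Q j)"] Esets QU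
    by (auto simp: measure_le_0_iff)
  moreover have cS: "contain (\<phi> ` S) \<in> sets lam" using S(1) \<phi>Sc by simp
  ultimately have "P (contain (\<phi> ` S) \<inter> E) = P ((contain (\<phi> ` S) \<inter> E) \<inter> (\<Union>j\<in>?J. Q j))"
    using lam.finite_measure_Diff'[of "contain (\<phi> ` S) \<inter> E" "\<Union>j\<in>?J. Q j"] Esets QU by simp
  also have "(contain (\<phi> ` S) \<inter> E) \<inter> (\<Union>j\<in>?J. Q j) = (\<Union>j\<in>?J. contain (\<phi> ` S) \<inter> Q j)" by (auto simp: Q_def)
  also have "P \<dots> = (\<Sum>j\<in>?J. P (contain (\<phi> ` S) \<inter> Q j))"
    by (rule lam.finite_measure_finite_Union[OF finJ])
       (use Qs cS disj in \<open>auto simp: disjoint_family_on_def\<close>)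
  also have "\<dots> = (\<Sum>j\<in>?J. if \<theta> j ` S \<subseteq> C then freq index ^ N * P E else 0)" using PQS by simp
  also have "\<dots> = card {j \<in> ?J. \<theta> j ` S \<subseteq> C} * freq index ^ N * P E"
    using finJ by (simp add: sum.If_cases Int_def)
  finally have "P (contain S) * P E = card {j \<in> ?J. \<theta> j ` S \<subseteq> C} * freq index ^ N * P E" using mix by simp
  then show ?thesis using E(3) by (simp add: \<theta>_def)
qed

text \<open>There are only countably many pairs \<open>(N, S)\<close>, and for each of them almost
  every \<open>H\<close> in \<open>separated W\<close> lies in an atom of positive probability. So
  one \<open>H\<close> satisfies the counting formula for all pairs at once, and the law is computed
  from this single subgroup.\<close>

theorem random_subgroup_formula:
  "\<exists>W H. finite W \<and> W \<subseteq> carrier A \<and> transversal W H \<and> H \<subseteq> mA \<and>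
    (\<forall>N S. finite S \<longrightarrow> S \<subseteq> multiples A index (span {..<N}) \<longrightarrow>
      P (contain S) = card {j \<in> {..<N} \<rightarrow>\<^sub>E W. endo (\<lambda>i. if i < N then j i else \<one>) ` S \<subseteq> H} / card W ^ N)"
proof -
  obtain W where fW: "finite W" and Wc: "W \<subseteq> carrier A" and pos: "P (separated W) > 0"
    and tr: "AE H in lam. H \<in> separated W \<longrightarrow> transversal W H" and card_W: "real (card W) * freq index = 1"
    using exists_transversal by blast
  obtain K where K: "W \<subseteq> span {..<K}" using finite_subset_span[OF fW Wc] by blast
  define \<theta> where "\<theta> = (\<lambda>N j. endo (\<lambda>i. if i < N then j i else \<one>))"
  define Idx where "Idx = (SIGMA N:(UNIV :: nat set). {S. finite S \<and> S \<subseteq> multiples A index (span {..<N})})"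
  have mc: "multiples A index (span {..<N}) \<subseteq> carrier A" for N
    by (rule multiples_subset) (use span_closed in blast)
  have "countable Idx"
    unfolding Idx_def
    by (intro countable_SIGMA countable_Collect_finite_subset countable_subset[OF mc countable_carrier]) simp
  define \<Phi> where "\<Phi> = (\<lambda>(N, S) H. P (contain S) = card {j \<in> {..<N} \<rightarrow>\<^sub>E W. \<theta> N j ` S \<subseteq> H} / card W ^ N)"
  have "AE H in lam. \<forall>x\<in>Idx. H \<in> separated W \<longrightarrow> \<Phi> x H"
  proof (subst AE_ball_countable, rule \<open>countable Idx\<close>, rule ballI)
    fix x assume "x \<in> Idx"
    then obtain N S where x: "x = (N, S)" and S: "finite S" "S \<subseteq> multiples A index (span {..<N})"
      by (auto simp: Idx_def)
    define T where "T = differences W \<union> (\<Union>j\<in>{..<N} \<rightarrow>\<^sub>E W. \<theta> N j ` S)"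
    have T: "T = differences W \<union> (\<Union>j\<in>{..<N} \<rightarrow>\<^sub>E W. endo (\<lambda>i. if i < N then j i else \<one>) ` S)"
      by (simp add: T_def \<theta>_def)
    have Sc: "S \<subseteq> carrier A" using S(2) mc by blast
    have Tfin: "finite T" unfolding T_def using fW S(1) finite_differences by (blast intro: finite_PiE)
    have Tc: "T \<subseteq> carrier A"
    proof -
      have "\<theta> N j s \<in> carrier A" if "j \<in> {..<N} \<rightarrow>\<^sub>E W" "s \<in> S" for j s
        unfolding \<theta>_def by (rule endo_closed) (use that Sc Wc in auto)
      then show ?thesis unfolding T_def using differences_subset[OF subgroup_self Wc] by blast
    qed
    define E where "E = (\<lambda>C. {H \<in> subgroups A. H \<inter> T = C})"
    have Es: "E C \<in> sets lam" for C
      by (rule sets_lam_depends_on[OF Tfin Tc]) (auto simp: E_def depends_on_def)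
    \<comment> \<open>\<open>T\<close> is finite, so the atoms of probability 0 together form a null
      set.\<close>
    have "AE H in lam. \<forall>C\<in>{C \<in> Pow T. P (E C) = 0}. H \<notin> E C"
    proof (rule AE_finite_allI)
      show "finite {C \<in> Pow T. P (E C) = 0}" using Tfin by simp
      show "AE H in lam. H \<notin> E C" if "C \<in> {C \<in> Pow T. P (E C) = 0}" for C
        using that Es by (intro AE_not_in) (simp add: null_sets_def lam.emeasure_eq_measure)
    qed
    then show "AE H in lam. H \<in> separated W \<longrightarrow> \<Phi> x H"
    proof (rule eventually_mono, intro impI)
      fix H assume *: "\<forall>C\<in>{C \<in> Pow T. P (E C) = 0}. H \<notin> E C" and H: "H \<in> separated W"
      define C where "C = H \<inter> T"
      have HE: "H \<in> E C" using H by (simp add: E_def C_def separated_def)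
      have "P (E C) > 0"
      proof (rule ccontr)
        assume "\<not> 0 < P (E C)"
        then have "P (E C) = 0" by (simp add: zero_less_measure_iff)
        then show False using * HE by (auto simp: C_def)
      qed
      moreover have "E C \<subseteq> separated W"
      proof
        fix H' assume H': "H' \<in> E C"
        have "differences W \<subseteq> T" by (auto simp: T_def)
        then have "H \<inter> differences W = H' \<inter> differences W" using H' unfolding E_def C_def by blast
        moreover have "H \<in> subgroups A" "H' \<in> subgroups A" using HE H' by (auto simp: E_def)
        ultimately show "H' \<in> separated W" using depends_on_separated[of W] H unfolding depends_on_def by blast
      qed
      ultimately have "P (contain S) = card {j \<in> {..<N} \<rightarrow>\<^sub>E W. \<theta> N j ` S \<subseteq> C} * freq index ^ N"
        using P_containing_atom[OF fW K max.cobounded1 max.cobounded2 S card_W T E_def[THEN fun_cong]]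
        by (simp add: \<theta>_def)
      moreover have "\<theta> N j ` S \<subseteq> C \<longleftrightarrow> \<theta> N j ` S \<subseteq> H" if "j \<in> {..<N} \<rightarrow>\<^sub>E W" for j
        using that unfolding C_def T_def by blast
      then have "{j \<in> {..<N} \<rightarrow>\<^sub>E W. \<theta> N j ` S \<subseteq> C} = {j \<in> {..<N} \<rightarrow>\<^sub>E W. \<theta> N j ` S \<subseteq> H}" by blast
      moreover have "freq index = 1 / card W" using card_W by (metis nonzero_eq_divide_eq mult.commute mult_zero_left zero_neq_one)
      ultimately show "\<Phi> x H" by (simp add: \<Phi>_def x power_one_over divide_simps)
    qed
  qed
  with tr AE_subset_mA
  have ae: "AE H in lam. H \<in> separated W \<longrightarrow> transversal W H \<and> H \<subseteq> mA \<and> (\<forall>x\<in>Idx. \<Phi> x H)"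
    by eventually_elim blast
  have "\<exists>H. transversal W H \<and> H \<subseteq> mA \<and> (\<forall>x\<in>Idx. \<Phi> x H)"
  proof (rule ccontr)
    assume no: "\<nexists>H. transversal W H \<and> H \<subseteq> mA \<and> (\<forall>x\<in>Idx. \<Phi> x H)"
    have "AE H in lam. H \<notin> separated W" using ae by (rule eventually_mono) (use no in blast)
    then have "P (separated W) = 0"
      using sets_separated[OF fW Wc] AE_iff_measurable[of "separated W" lam "\<lambda>H. H \<notin> separated W"]
        sets.sets_into_space[OF sets_separated[OF fW Wc]]
      by (auto simp: measure_def Collect_conj_eq Int_absorb1 subset_iff)
    then show False using pos by simp
  qed
  then obtain H where H: "transversal W H" "H \<subseteq> mA" "\<forall>x\<in>Idx. \<Phi> x H" by blast
  have "P (contain S) = card {j \<in> {..<N} \<rightarrow>\<^sub>E W. \<theta> N j ` S \<subseteq> H} / card W ^ N"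
    if "finite S" "S \<subseteq> multiples A index (span {..<N})" for N S
    using H(3) that by (auto simp: Idx_def \<Phi>_def)
  then show ?thesis using fW Wc H(1,2) unfolding \<theta>_def by blast
qed

end

section \<open>Haar measure on \<open>Hom(\<A>\<^sub>n, F)\<close>\<close>

lemma subtopology_eq_pullback: "subtopology T C = pullback_topology C (\<lambda>x. x) T"
  by (auto simp: topology_eq openin_subtopology openin_pullback_topology)

locale Hom_AAn = AAn_group A n + F: comm_group F
  for A (structure) and n and F :: "('c, 'd) monoid_scheme" +
  assumes finite_F: "finite (carrier F)"
    and exponent: "multiples F n (carrier F) = {\<one>\<^bsub>F\<^esub>}"
begin

abbreviation Homs :: "((nat \<Rightarrow> int) set \<Rightarrow> 'c) set" where "Homs \<equiv> carrier (Hom_group A F)"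

abbreviation Hom_borel :: "((nat \<Rightarrow> int) set \<Rightarrow> 'c) measure"
  where "Hom_borel \<equiv> borel_of (Hom_topology A F)"

abbreviation mF :: "nat \<Rightarrow> 'c set" where "mF m \<equiv> multiples F m (carrier F)"

lemma Homs_def: "Homs = hom A F \<inter> extensional (carrier A)"
  by (simp add: Hom_group_def)

lemma mult_Homs: "k \<otimes>\<^bsub>Hom_group A F\<^esub> h = (\<lambda>x\<in>carrier A. k x \<otimes>\<^bsub>F\<^esub> h x)"
  by (simp add: Hom_group_def)

lemma HomsD: "h \<in> Homs \<Longrightarrow> group_hom A F h"
  using is_group F.is_group by (simp add: Homs_def group_hom_def group_hom_axioms_def)

lemma Homs_closed: "h \<in> Homs \<Longrightarrow> x \<in> carrier A \<Longrightarrow> h x \<in> carrier F"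
  using HomsD by (rule group_hom.hom_closed)

lemma exp_F: "y \<in> carrier F \<Longrightarrow> y [^]\<^bsub>F\<^esub> n = \<one>\<^bsub>F\<^esub>"
  using exponent multiplesI[of y "carrier F" F n] by blast

lemma lift_Homs:
  assumes "\<And>i. f i \<in> carrier F"
  shows "lift F f \<in> Homs" "lift F f (e i) = f i"
  using lift[OF F.comm_group_axioms exp_F assms] by (auto simp: Homs_def)

lemma
  shows space_Hom [simp]: "topspace (Hom_topology A F) = Homs"
    and sets_Hom: "sets Hom_borel =
      sigma_sets Homs {{h \<in> Homs. h x = y} |x y. x \<in> carrier A \<and> y \<in> carrier F}"
proof -
  have T: "Hom_topology A F = pullback_topology Homs (\<lambda>h. h)
      (product_topology (\<lambda>_. discrete_topology (carrier F)) (carrier A))"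
    by (simp add: Hom_topology_def subtopology_eq_pullback)
  have f: "h \<in> carrier A \<rightarrow>\<^sub>E carrier F" if "h \<in> Homs" for h
    using that by (auto simp: Homs_def hom_def PiE_def)
  note * = sets_borel_of_pullback_product[where A = Homs and f = "\<lambda>h. h" and D = "carrier F",
      OF countable_carrier countable_finite[OF finite_F] f]
  show "topspace (Hom_topology A F) = Homs" unfolding T by (rule *(1))
  show "sets Hom_borel = sigma_sets Homs {{h \<in> Homs. h x = y} |x y. x \<in> carrier A \<and> y \<in> carrier F}"
    unfolding T by (rule *(2))
qed

lemma sets_Hom_value:
  assumes "x \<in> carrier A"
  shows "{h \<in> Homs. R (h x)} \<in> sets Hom_borel"
proof -
  have "{h \<in> Homs. R (h x)} = (\<Union>y\<in>{y \<in> carrier F. R y}. {h \<in> Homs. h x = y})"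
    using Homs_closed assms by auto
  also have "\<dots> \<in> sets Hom_borel"
  proof (rule sets.finite_UN)
    show "finite {y \<in> carrier F. R y}" using finite_F by simp
    show "{h \<in> Homs. h x = y} \<in> sets Hom_borel" if "y \<in> {y \<in> carrier F. R y}" for y
      unfolding sets_Hom using that assms by (intro sigma_sets.Basic) blast
  qed
  finally show ?thesis .
qed

lemma measurable_to_Hom:
  assumes "f \<in> space M \<rightarrow> Homs"
    and "\<And>x y. x \<in> carrier A \<Longrightarrow> y \<in> carrier F \<Longrightarrow> {\<omega> \<in> space M. f \<omega> x = y} \<in> sets M"
  shows "f \<in> measurable M Hom_borel"
proof (rule measurable_sigma_sets[OF sets_Hom _ assms(1)])
  show "{{h \<in> Homs. h x = y} |x y. x \<in> carrier A \<and> y \<in> carrier F} \<subseteq> Pow Homs" by auto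
  fix U assume "U \<in> {{h \<in> Homs. h x = y} |x y. x \<in> carrier A \<and> y \<in> carrier F}"
  then obtain x y where U: "x \<in> carrier A" "y \<in> carrier F" "U = {h \<in> Homs. h x = y}" by blast
  have "f -` U \<inter> space M = {\<omega> \<in> space M. f \<omega> x = y}" using assms(1) U(3) by auto
  then show "f -` U \<inter> space M \<in> sets M" using assms(2)[OF U(1,2)] by simp
qed

lemma mult_Homs_closed:
  assumes "k \<in> Homs" "h \<in> Homs"
  shows "k \<otimes>\<^bsub>Hom_group A F\<^esub> h \<in> Homs"
proof -
  have "(\<lambda>x\<in>carrier A. k x \<otimes>\<^bsub>F\<^esub> h x) \<in> hom A F"
  proof (rule homI)
    fix x y assume "x \<in> carrier A" "y \<in> carrier A"
    then show "(\<lambda>x\<in>carrier A. k x \<otimes>\<^bsub>F\<^esub> h x) (x \<otimes> y) =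
      (\<lambda>x\<in>carrier A. k x \<otimes>\<^bsub>F\<^esub> h x) x \<otimes>\<^bsub>F\<^esub> (\<lambda>x\<in>carrier A. k x \<otimes>\<^bsub>F\<^esub> h x) y"
      using Homs_closed[OF assms(1)] Homs_closed[OF assms(2)]
      by (simp add: group_hom.hom_mult[OF HomsD[OF assms(1)]] group_hom.hom_mult[OF HomsD[OF assms(2)]] F.m_ac)
  qed (simp add: Homs_closed assms)
  then show ?thesis by (simp add: mult_Homs Homs_def)
qed

lemma translation_measurable:
  assumes k: "k \<in> Homs"
  shows "(\<lambda>h. k \<otimes>\<^bsub>Hom_group A F\<^esub> h) \<in> measurable Hom_borel Hom_borel"
proof (rule measurable_to_Hom)
  fix x y assume x: "x \<in> carrier A"
  have "{h \<in> space Hom_borel. (k \<otimes>\<^bsub>Hom_group A F\<^esub> h) x = y} = {h \<in> Homs. k x \<otimes>\<^bsub>F\<^esub> h x = y}"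
    using x by (auto simp: mult_Homs)
  then show "{h \<in> space Hom_borel. (k \<otimes>\<^bsub>Hom_group A F\<^esub> h) x = y} \<in> sets Hom_borel"
    using sets_Hom_value[OF x] by simp
qed (use mult_Homs_closed[OF k] in auto)

text \<open>Choose the images of the basis vectors independently and uniformly in \<open>F\<close>,
  and lift. Translation by \<open>k\<close> multiplies the image of \<open>e i\<close> by
  \<open>k (e i)\<close>, which preserves the uniform measure in each coordinate.\<close>

lemma haar_exists: "\<exists>\<eta>. haar_prob (Hom_group A F) (Hom_topology A F) \<eta>"
proof -
  define U where "U = uniform_count_measure (carrier F)"
  have F_ne: "carrier F \<noteq> {}" using F.one_closed by blast
  have spU: "space U = carrier F" and sU: "sets U = Pow (carrier F)"
    by (simp_all add: U_def space_uniform_count_measure sets_uniform_count_measure)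
  interpret U: prob_space U unfolding U_def by (rule prob_space_uniform_count_measure[OF finite_F F_ne])
  interpret product_prob_space "\<lambda>_::nat. U" UNIV by unfold_locales
  define M where "M = PiM UNIV (\<lambda>_::nat. U)"
  interpret M: prob_space M unfolding M_def by (rule prob_space_PiM) (rule U.prob_space_axioms)
  have spM: "space M = {f. \<forall>i. f i \<in> carrier F}" by (auto simp: M_def space_PiM spU PiE_def)
  have comp: "{f \<in> space M. f i = y} \<in> sets M" for i y
  proof -
    have "(\<lambda>f. f i) \<in> measurable M U" unfolding M_def by simp
    then have "(\<lambda>f. f i) -` ({y} \<inter> carrier F) \<inter> space M \<in> sets M" by (rule measurable_sets) (simp add: sU)
    moreover have "(\<lambda>f. f i) -` ({y} \<inter> carrier F) \<inter> space M = {f \<in> space M. f i = y}" by (auto simp: spM)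
    ultimately show ?thesis by simp
  qed
  have lf: "lift F f \<in> Homs" "lift F f (e i) = f i" if "f \<in> space M" for f i
    using lift_Homs[of f] that by (auto simp: spM)
  \<comment> \<open>Quantifying over all predicates \<open>R\<close> makes the product case work:
    there the value at \<open>x\<close> is split into finitely many cases \<open>z\<close>, and the
    hypothesis for \<open>y\<close> is used with a predicate shifted by \<open>z\<close>.\<close>
  have val: "\<forall>R. {f \<in> space M. R (lift F f x)} \<in> sets M" if "x \<in> span UNIV" for x
    using that
  proof (induct rule: generate.induct)
    case one
    have "{f \<in> space M. R (lift F f \<one>)} = (if R \<one>\<^bsub>F\<^esub> then space M else {})" for R
      using group_hom.hom_one[OF HomsD[OF lf(1)]] by auto
    then show ?case by auto
  next
    case (incl x)
    then obtain i where x: "x = e i" by blast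
    have "{f \<in> space M. R (lift F f x)} = (\<Union>y\<in>{y \<in> carrier F. R y}. {f \<in> space M. f i = y})" for R
      using lf(2) by (auto simp: x spM)
    then show ?case using comp finite_F by auto
  next
    case (inv x)
    then obtain i where x: "x = e i" by blast
    have "lift F f (inv x) = inv\<^bsub>F\<^esub> f i" if "f \<in> space M" for f
      using group_hom.hom_inv[OF HomsD[OF lf(1)[OF that]] e_closed] lf(2)[OF that] x by simp
    then have "{f \<in> space M. R (lift F f (inv x))} = (\<Union>y\<in>{y \<in> carrier F. R (inv\<^bsub>F\<^esub> y)}. {f \<in> space M. f i = y})" for R
      by (auto simp: spM)
    then show ?case using comp finite_F by auto
  next
    case (eng x y)
    then have xy: "x \<in> carrier A" "y \<in> carrier A" using span_closed by auto
    have "{f \<in> space M. R (lift F f (x \<otimes> y))} =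
      (\<Union>z\<in>carrier F. {f \<in> space M. lift F f x = z} \<inter> {f \<in> space M. R (z \<otimes>\<^bsub>F\<^esub> lift F f y)})" for R
      using group_hom.hom_mult[OF HomsD[OF lf(1)] xy] Homs_closed[OF lf(1) xy(1)] by auto
    moreover have "{f \<in> space M. lift F f x = z} \<in> sets M" for z
      using spec[OF eng(2), of "\<lambda>y. y = z"] by simp
    moreover have "{f \<in> space M. R (z \<otimes>\<^bsub>F\<^esub> lift F f y)} \<in> sets M" for z R
      using spec[OF eng(4), of "\<lambda>y. R (z \<otimes>\<^bsub>F\<^esub> y)"] by simp
    ultimately show ?case using finite_F by auto
  qed
  have lm: "lift F \<in> measurable M Hom_borel"
    by (rule measurable_to_Hom) (use lf(1) val span_UNIV in auto)
  define \<eta> where "\<eta> = distr M Hom_borel (lift F)"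
  have inv: "distr \<eta> Hom_borel (\<lambda>h. k \<otimes>\<^bsub>Hom_group A F\<^esub> h) = \<eta>" if k: "k \<in> Homs" for k
  proof -
    define \<tau> where "\<tau> = (\<lambda>f i. k (e i) \<otimes>\<^bsub>F\<^esub> f i)"
    have ke: "k (e i) \<in> carrier F" for i using Homs_closed[OF k] by simp
    have \<tau>M: "\<tau> \<in> measurable M M"
      unfolding M_def
    proof (rule measurable_PiM_single')
      fix i :: nat
      have "(\<lambda>y. k (e i) \<otimes>\<^bsub>F\<^esub> y) \<in> measurable U U"
        by (rule measurableI) (auto simp: spU sU ke)
      then show "(\<lambda>f. \<tau> f i) \<in> measurable (PiM UNIV (\<lambda>_. U)) U"
        unfolding \<tau>_def by (rule measurable_compose[rotated]) simp
    qed (auto simp: spM[unfolded M_def] \<tau>_def spU ke PiE_def)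
    \<comment> \<open>A product measure is determined on boxes, and \<open>\<tau>\<close> pulls a
      box back to a box whose sides have the same cardinalities.\<close>
    have "PiM UNIV (\<lambda>_::nat. U) = distr M M \<tau>"
    proof (rule PiM_eq[symmetric])
      show "sets (distr M M \<tau>) = sets (PiM UNIV (\<lambda>_. U))" by (simp add: M_def)
      fix J :: "nat set" and Z assume J: "finite J" "\<And>j. j \<in> J \<Longrightarrow> Z j \<in> sets U"
      have em: "emeasure U Y = ennreal (card Y / card (carrier F))" if "Y \<subseteq> carrier F" for Y
        unfolding U_def by (rule emeasure_uniform_count_measure[OF finite_F that])
      define Y where "Y = (\<lambda>j. {y \<in> carrier F. k (e j) \<otimes>\<^bsub>F\<^esub> y \<in> Z j})"
      have card: "card (Y j) = card (Z j)" if j: "j \<in> J" for j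
      proof (rule bij_betw_same_card[of "\<lambda>y. k (e j) \<otimes>\<^bsub>F\<^esub> y"], rule bij_betw_imageI)
        have Zc: "Z j \<subseteq> carrier F" using J(2)[OF j] by (simp add: sU)
        show "inj_on (\<lambda>y. k (e j) \<otimes>\<^bsub>F\<^esub> y) (Y j)" using ke by (auto simp: Y_def inj_on_def)
        show "(\<lambda>y. k (e j) \<otimes>\<^bsub>F\<^esub> y) ` Y j = Z j"
        proof
          show "Z j \<subseteq> (\<lambda>y. k (e j) \<otimes>\<^bsub>F\<^esub> y) ` Y j"
          proof
            fix x assume x: "x \<in> Z j"
            have "k (e j) \<otimes>\<^bsub>F\<^esub> (inv\<^bsub>F\<^esub> k (e j) \<otimes>\<^bsub>F\<^esub> x) = x"
              using ke x Zc by (simp add: subset_iff flip: F.m_assoc)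
            then show "x \<in> (\<lambda>y. k (e j) \<otimes>\<^bsub>F\<^esub> y) ` Y j"
              using x Zc ke by (intro image_eqI[of _ _ "inv\<^bsub>F\<^esub> k (e j) \<otimes>\<^bsub>F\<^esub> x"]) (auto simp: Y_def)
          qed
        qed (auto simp: Y_def)
      qed
      have pre: "\<tau> -` prod_emb UNIV (\<lambda>_. U) J (Pi\<^sub>E J Z) \<inter> space M = prod_emb UNIV (\<lambda>_. U) J (Pi\<^sub>E J Y)"
      proof (rule Set.set_eqI)
        fix f
        have "(\<forall>i. \<tau> f i \<in> carrier F)" if "\<forall>i. f i \<in> carrier F" using that ke by (simp add: \<tau>_def)
        then show "f \<in> \<tau> -` prod_emb UNIV (\<lambda>_. U) J (Pi\<^sub>E J Z) \<inter> space M \<longleftrightarrow> f \<in> prod_emb UNIV (\<lambda>_. U) J (Pi\<^sub>E J Y)"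
          by (auto simp: prod_emb_def spM spU PiE_iff Y_def \<tau>_def)
      qed
      have sets: "prod_emb UNIV (\<lambda>_. U) J (Pi\<^sub>E J Z) \<in> sets M"
        unfolding M_def by (rule sets_PiM_I[OF J(1)]) (simp_all add: J(2))
      have "emeasure (distr M M \<tau>) (prod_emb UNIV (\<lambda>_. U) J (Pi\<^sub>E J Z)) =
        emeasure M (prod_emb UNIV (\<lambda>_. U) J (Pi\<^sub>E J Y))"
        by (simp add: emeasure_distr[OF \<tau>M sets] pre)
      also have "\<dots> = (\<Prod>j\<in>J. emeasure U (Y j))"
        unfolding M_def by (rule emeasure_PiM_emb) (auto simp: J sU Y_def)
      also have "\<dots> = (\<Prod>j\<in>J. emeasure U (Z j))"
        using J(2) card by (intro prod.cong refl) (simp add: em sU Y_def)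
      finally show "emeasure (distr M M \<tau>) (prod_emb UNIV (\<lambda>_. U) J (Pi\<^sub>E J Z)) = (\<Prod>j\<in>J. emeasure U (Z j))" .
    qed
    then have M\<tau>: "distr M M \<tau> = M" by (simp add: M_def)
    have eq: "k \<otimes>\<^bsub>Hom_group A F\<^esub> lift F f = lift F (\<tau> f)" if f: "f \<in> space M" for f
    proof -
      have \<tau>f: "\<tau> f \<in> space M" using f ke by (auto simp: spM \<tau>_def)
      have h: "k \<otimes>\<^bsub>Hom_group A F\<^esub> lift F f \<in> Homs" "lift F (\<tau> f) \<in> Homs"
        using mult_Homs_closed[OF k] lf(1)[OF f] lf(1)[OF \<tau>f] by auto
      show ?thesis
      proof (rule extensionalityI[of _ "carrier A"])
        show "k \<otimes>\<^bsub>Hom_group A F\<^esub> lift F f \<in> extensional (carrier A)" "lift F (\<tau> f) \<in> extensional (carrier A)"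
          using h by (auto simp: Homs_def)
        fix x assume x: "x \<in> carrier A"
        have hom: "k \<otimes>\<^bsub>Hom_group A F\<^esub> lift F f \<in> hom A F" "lift F (\<tau> f) \<in> hom A F"
          using h by (simp_all add: Homs_def)
        show "(k \<otimes>\<^bsub>Hom_group A F\<^esub> lift F f) x = lift F (\<tau> f) x"
          by (rule hom_eqI[OF F.is_group hom _ x])
             (simp add: mult_Homs lf(2)[OF f] lf(2)[OF \<tau>f], simp add: \<tau>_def)
      qed
    qed
    have "distr \<eta> Hom_borel (\<lambda>h. k \<otimes>\<^bsub>Hom_group A F\<^esub> h) = distr M Hom_borel (\<lambda>f. k \<otimes>\<^bsub>Hom_group A F\<^esub> lift F f)"
      unfolding \<eta>_def by (subst distr_distr[OF translation_measurable[OF k] lm]) (simp add: comp_def)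
    also have "\<dots> = distr M Hom_borel (\<lambda>f. lift F (\<tau> f))" by (rule distr_cong) (simp_all add: eq)
    also have "\<dots> = distr (distr M M \<tau>) Hom_borel (lift F)"
      by (subst distr_distr[OF lm \<tau>M]) (simp add: comp_def)
    finally show ?thesis by (simp add: M\<tau> \<eta>_def)
  qed
  have "prob_space \<eta>" unfolding \<eta>_def by (rule M.prob_space_distr[OF lm])
  then have "haar_prob (Hom_group A F) (Hom_topology A F) \<eta>"
    using inv by (simp add: haar_prob_def \<eta>_def)
  then show ?thesis by blast
qed

section \<open>Probabilities under a Haar measure\<close>

context
  fixes \<eta> assumes haar: "haar_prob (Hom_group A F) (Hom_topology A F) \<eta>"
begin

interpretation \<eta>: prob_space \<eta> using haar by (simp add: haar_prob_def)

lemma sets_haar: "sets \<eta> = sets Hom_borel"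
  using haar by (simp add: haar_prob_def)

lemma space_haar: "space \<eta> = Homs"
  using sets_eq_imp_space_eq[OF sets_haar] by simp

text \<open>Translations permute the patterns \<open>c\<close> of values transitively, so all
  patterns in \<open>mF m\<close> are equally likely, and they partition the whole space.\<close>

lemma haar_values:
  assumes I: "finite I" and c: "c \<in> I \<rightarrow> mF m"
  shows "measure \<eta> {h \<in> Homs. \<forall>i\<in>I. h (e i) [^]\<^bsub>F\<^esub> m = c i} = 1 / card (mF m) ^ card I"
proof -
  define B where "B = (\<lambda>c. {h \<in> Homs. \<forall>i\<in>I. h (e i) [^]\<^bsub>F\<^esub> m = c i})"
  let ?J = "I \<rightarrow>\<^sub>E mF m"
  have Bs: "B c \<in> sets \<eta>" for c
  proof -
    have "{h \<in> space \<eta>. \<forall>i\<in>I. h (e i) [^]\<^bsub>F\<^esub> m = c i} \<in> sets \<eta>"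
      by (rule sets.sets_Collect_finite_All[OF _ I])
         (simp add: sets_haar space_haar sets_Hom_value[OF e_closed, of "\<lambda>y. y [^]\<^bsub>F\<^esub> m = _"])
    then show ?thesis by (simp add: B_def space_haar)
  qed
  have mFc: "mF m \<subseteq> carrier F" by (rule F.multiples_subset) simp
  have eq: "measure \<eta> (B c) = measure \<eta> (B c')" if c: "c \<in> I \<rightarrow> mF m" "c' \<in> I \<rightarrow> mF m" for c c'
  proof -
    \<comment> \<open>\<open>c' i\<close> and \<open>c i\<close> differ by an element of
      \<open>mF m\<close>; its preimage \<open>f0 i\<close> under the \<open>m\<close>-th power map
      is the value at \<open>e i\<close> of the translating homomorphism \<open>k\<close>.\<close>
    have "\<exists>y\<in>carrier F. y [^]\<^bsub>F\<^esub> m = c' i \<otimes>\<^bsub>F\<^esub> inv\<^bsub>F\<^esub> c i" if "i \<in> I" for i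
    proof -
      note sg = F.subgroup_multiples[OF F.subgroup_self, of m]
      have "c' i \<otimes>\<^bsub>F\<^esub> inv\<^bsub>F\<^esub> c i \<in> mF m"
        using subgroup.m_closed[OF sg _ subgroup.m_inv_closed[OF sg]] c that by (auto simp: Pi_iff)
      then show ?thesis by (auto simp: mem_multiples)
    qed
    then obtain f0 where f0: "\<forall>i\<in>I. f0 i \<in> carrier F \<and> f0 i [^]\<^bsub>F\<^esub> m = c' i \<otimes>\<^bsub>F\<^esub> inv\<^bsub>F\<^esub> c i" by metis
    define f where "f = (\<lambda>i. if i \<in> I then f0 i else \<one>\<^bsub>F\<^esub>)"
    have f: "f i \<in> carrier F" for i using f0 by (simp add: f_def)
    define k where "k = lift F f"
    have k: "k \<in> Homs" "k (e i) = f i" for i unfolding k_def using lift_Homs[OF f] by auto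
    have m: "(\<lambda>h. k \<otimes>\<^bsub>Hom_group A F\<^esub> h) \<in> measurable \<eta> Hom_borel"
      using translation_measurable[OF k(1)] measurable_cong_sets[OF sets_haar refl] by blast
    have "(\<lambda>h. k \<otimes>\<^bsub>Hom_group A F\<^esub> h) -` B c' \<inter> space \<eta> = B c"
    proof (rule Set.set_eqI)
      fix h
      have "(f i \<otimes>\<^bsub>F\<^esub> h (e i)) [^]\<^bsub>F\<^esub> m = c' i \<longleftrightarrow> h (e i) [^]\<^bsub>F\<^esub> m = c i" if "h \<in> Homs" "i \<in> I" for i
      proof -
        have h: "h (e i) \<in> carrier F" using Homs_closed[OF that(1)] by simp
        have cc: "c i \<in> carrier F" "c' i \<in> carrier F" using c that(2) mFc by auto
        have "(f i \<otimes>\<^bsub>F\<^esub> h (e i)) [^]\<^bsub>F\<^esub> m = (c' i \<otimes>\<^bsub>F\<^esub> inv\<^bsub>F\<^esub> c i) \<otimes>\<^bsub>F\<^esub> h (e i) [^]\<^bsub>F\<^esub> m"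
          using f0 that(2) f[of i] h by (simp add: F.nat_pow_distrib f_def)
        also have "\<dots> = c' i \<otimes>\<^bsub>F\<^esub> (inv\<^bsub>F\<^esub> c i \<otimes>\<^bsub>F\<^esub> h (e i) [^]\<^bsub>F\<^esub> m)" using cc h by (simp add: F.m_assoc)
        finally have 1: "(f i \<otimes>\<^bsub>F\<^esub> h (e i)) [^]\<^bsub>F\<^esub> m = c' i \<otimes>\<^bsub>F\<^esub> (inv\<^bsub>F\<^esub> c i \<otimes>\<^bsub>F\<^esub> h (e i) [^]\<^bsub>F\<^esub> m)" .
        show ?thesis
        proof
          assume "h (e i) [^]\<^bsub>F\<^esub> m = c i"
          then show "(f i \<otimes>\<^bsub>F\<^esub> h (e i)) [^]\<^bsub>F\<^esub> m = c' i" using 1 cc by simp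
        next
          assume asm: "(f i \<otimes>\<^bsub>F\<^esub> h (e i)) [^]\<^bsub>F\<^esub> m = c' i"
          have d: "inv\<^bsub>F\<^esub> c i \<otimes>\<^bsub>F\<^esub> h (e i) [^]\<^bsub>F\<^esub> m \<in> carrier F" using cc h by simp
          have "c' i \<otimes>\<^bsub>F\<^esub> (inv\<^bsub>F\<^esub> c i \<otimes>\<^bsub>F\<^esub> h (e i) [^]\<^bsub>F\<^esub> m) = c' i \<otimes>\<^bsub>F\<^esub> \<one>\<^bsub>F\<^esub>"
            unfolding 1[symmetric] asm using cc by simp
          then have "inv\<^bsub>F\<^esub> c i \<otimes>\<^bsub>F\<^esub> h (e i) [^]\<^bsub>F\<^esub> m = \<one>\<^bsub>F\<^esub>"
            by (rule F.l_cancel[OF _ d F.one_closed cc(2)])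
          moreover have "h (e i) [^]\<^bsub>F\<^esub> m = c i \<otimes>\<^bsub>F\<^esub> (inv\<^bsub>F\<^esub> c i \<otimes>\<^bsub>F\<^esub> h (e i) [^]\<^bsub>F\<^esub> m)"
            using cc h by (simp add: F.m_assoc[symmetric])
          ultimately show "h (e i) [^]\<^bsub>F\<^esub> m = c i" using F.r_one[OF cc(1)] by metis
        qed
      qed
      then show "h \<in> (\<lambda>h. k \<otimes>\<^bsub>Hom_group A F\<^esub> h) -` B c' \<inter> space \<eta> \<longleftrightarrow> h \<in> B c"
        using mult_Homs_closed[OF k(1), of h] by (auto simp: B_def space_haar mult_Homs k(2))
    qed
    moreover have "distr \<eta> Hom_borel (\<lambda>h. k \<otimes>\<^bsub>Hom_group A F\<^esub> h) = \<eta>"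
      using haar k(1) by (simp add: haar_prob_def)
    ultimately show ?thesis using measure_distr[OF m, of "B c'"] Bs[of c'] by (simp add: sets_haar)
  qed
  have fin: "finite ?J" using finite_F mFc by (intro finite_PiE I) (auto intro: finite_subset)
  have "disjoint_family_on B ?J"
    unfolding disjoint_family_on_def
  proof (intro ballI impI)
    fix c c' assume c: "c \<in> ?J" "c' \<in> ?J" "c \<noteq> c'"
    then obtain i where "i \<in> I" "c i \<noteq> c' i" by (meson PiE_ext)
    then show "B c \<inter> B c' = {}" by (auto simp: B_def)
  qed
  then have "measure \<eta> (\<Union>c\<in>?J. B c) = (\<Sum>c\<in>?J. measure \<eta> (B c))"
    using Bs by (intro \<eta>.finite_measure_finite_Union[OF fin]) auto
  also have "\<dots> = (\<Sum>c'\<in>?J. measure \<eta> (B c))" 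
    by (rule sum.cong[OF refl], rule eq) (use c in auto)
  also have "\<dots> = card (mF m) ^ card I * measure \<eta> (B c)" by (simp add: card_PiE I)
  also have "(\<Union>c\<in>?J. B c) = space \<eta>"
  proof
    show "space \<eta> \<subseteq> (\<Union>c\<in>?J. B c)"
    proof
      fix h assume "h \<in> space \<eta>"
      then have h: "h \<in> Homs" by (simp add: space_haar)
      have "h \<in> B (\<lambda>i\<in>I. h (e i) [^]\<^bsub>F\<^esub> m)" using h by (simp add: B_def)
      moreover have "(\<lambda>i\<in>I. h (e i) [^]\<^bsub>F\<^esub> m) \<in> ?J" using Homs_closed[OF h] by (auto intro: multiplesI)
      ultimately show "h \<in> (\<Union>c\<in>?J. B c)" by blast
    qed
  qed (auto simp: B_def space_haar)
  finally have one: "real (card (mF m)) ^ card I * measure \<eta> (B c) = 1" using \<eta>.prob_space by simp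
  then have "real (card (mF m)) ^ card I \<noteq> 0" by (intro notI) simp
  then have "measure \<eta> (B c) = 1 / real (card (mF m)) ^ card I"
    using one by (metis nonzero_eq_divide_eq mult.commute)
  then show ?thesis unfolding B_def by simp
qed

text \<open>Counterpart of \<open>random_subgroup_formula\<close> for the Haar model. For each
  \<open>i < N\<close> there is exactly one \<open>w\<close> in \<open>W\<close> for which
  \<open>h (e i)\<close> and \<open>g w\<close> have the same \<open>m\<close>-th power. The
  resulting \<open>j\<close> is uniform by \<open>haar_values\<close>, and on
  \<open>m\<close>-multiples of the first \<open>N\<close> basis vectors \<open>h\<close> agrees
  with \<open>g\<close> composed with the endomorphism given by \<open>j\<close>.\<close>

lemma haar_containing:
  assumes g: "g \<in> hom A F" and W: "finite W" "W \<subseteq> carrier A"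
    and bij: "bij_betw (\<lambda>w. g w [^]\<^bsub>F\<^esub> m) W (mF m)"
    and S: "finite S" "S \<subseteq> multiples A m (span {..<N})"
  shows "measure \<eta> {h \<in> Homs. \<forall>s\<in>S. h s = \<one>\<^bsub>F\<^esub>} =
    card {j \<in> {..<N} \<rightarrow>\<^sub>E W. \<forall>s\<in>S. g (endo (\<lambda>i. if i < N then j i else \<one>) s) = \<one>\<^bsub>F\<^esub>} / card W ^ N"
proof -
  let ?J = "{..<N} \<rightarrow>\<^sub>E W"
  define \<theta> where "\<theta> = (\<lambda>j. endo (\<lambda>i. if i < N then j i else \<one>))"
  define B where "B = (\<lambda>j. {h \<in> Homs. \<forall>i\<in>{..<N}. h (e i) [^]\<^bsub>F\<^esub> m = g (j i) [^]\<^bsub>F\<^esub> m})"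
  have fin: "finite ?J" using W(1) by (intro finite_PiE) auto
  have cardW: "card W = card (mF m)" by (rule bij_betw_same_card[OF bij])
  have gh: "group_hom A F g" using g is_group F.is_group by (simp add: group_hom_def group_hom_axioms_def)
  have jc: "(if i < N then j i else \<one>) \<in> carrier A" if "j \<in> ?J" for i j
    using that W(2) by auto
  have \<theta>hom: "\<theta> j \<in> hom A A" and \<theta>e: "\<theta> j (e i) = (if i < N then j i else \<one>)" if "j \<in> ?J" for i j
    unfolding \<theta>_def by (rule endo(1)[OF jc[OF that]], rule endo(3)[OF jc[OF that]])
  have PB: "measure \<eta> (B j) = 1 / card W ^ N" if j: "j \<in> ?J" for j
  proof -
    have "(\<lambda>i. g (j i) [^]\<^bsub>F\<^esub> m) \<in> {..<N} \<rightarrow> mF m" using bij j by (auto simp: bij_betw_def)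
    from haar_values[OF _ this] show ?thesis by (simp add: B_def cardW)
  qed
  have Bs: "B j \<in> sets \<eta>" for j
  proof -
    have "{h \<in> space \<eta>. \<forall>i\<in>{..<N}. h (e i) [^]\<^bsub>F\<^esub> m = g (j i) [^]\<^bsub>F\<^esub> m} \<in> sets \<eta>"
      by (rule sets.sets_Collect_finite_All)
         (simp_all add: sets_haar space_haar sets_Hom_value[OF e_closed, of "\<lambda>y. y [^]\<^bsub>F\<^esub> m = _"])
    then show ?thesis by (simp add: B_def space_haar)
  qed
  have disj: "disjoint_family_on B ?J"
    unfolding disjoint_family_on_def
  proof (intro ballI impI)
    fix j j' assume j: "j \<in> ?J" "j' \<in> ?J" "j \<noteq> j'"
    then obtain i where i: "i \<in> {..<N}" "j i \<noteq> j' i" by (meson PiE_ext)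
    have "j i \<in> W" "j' i \<in> W" using j(1,2) i(1) by auto
    then have "g (j i) [^]\<^bsub>F\<^esub> m \<noteq> g (j' i) [^]\<^bsub>F\<^esub> m"
      using inj_onD[OF bij_betw_imp_inj_on[OF bij]] i(2) by blast
    then show "B j \<inter> B j' = {}" using i(1) unfolding B_def by force
  qed
  have key: "h s = g (\<theta> j s)" if j: "j \<in> ?J" and h: "h \<in> B j" and s: "s \<in> S" for h j s
  proof -
    obtain u where u: "u \<in> span {..<N}" "s = u [^] m" using subsetD[OF S(2) s] by (auto simp: mem_multiples)
    note uc = span_closed[OF u(1)]
    have hh: "group_hom A F h" using h HomsD by (simp add: B_def)
    have t: "group_hom A A (\<theta> j)" using \<theta>hom[OF j] is_group by (simp add: group_hom_def group_hom_axioms_def)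
    have c: "h x \<in> carrier F" "\<theta> j x \<in> carrier A" "g (\<theta> j x) \<in> carrier F" if "x \<in> carrier A" for x
      using that group_hom.hom_closed[OF hh] group_hom.hom_closed[OF t] group_hom.hom_closed[OF gh] by auto
    have 1: "(\<lambda>x. h x [^]\<^bsub>F\<^esub> m) \<in> hom A F"
      by (rule homI) (simp_all add: c group_hom.hom_mult[OF hh] F.nat_pow_distrib)
    have 2: "(\<lambda>x. g (\<theta> j x) [^]\<^bsub>F\<^esub> m) \<in> hom A F"
      by (rule homI) (simp_all add: c group_hom.hom_mult[OF t] group_hom.hom_mult[OF gh] F.nat_pow_distrib)
    have "h u [^]\<^bsub>F\<^esub> m = g (\<theta> j u) [^]\<^bsub>F\<^esub> m"
      by (rule hom_eq_on_span[OF F.is_group 1 2 _ u(1)]) (use h in \<open>simp add: B_def \<theta>e[OF j]\<close>)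
    then show ?thesis
      using uc c[OF uc] by (simp add: u(2) group_hom.hom_nat_pow[OF hh] group_hom.hom_nat_pow[OF t] group_hom.hom_nat_pow[OF gh])
  qed
  have "{h \<in> Homs. \<forall>s\<in>S. h s = \<one>\<^bsub>F\<^esub>} = (\<Union>j\<in>{j \<in> ?J. \<forall>s\<in>S. g (\<theta> j s) = \<one>\<^bsub>F\<^esub>}. B j)"
  proof
    show "(\<Union>j\<in>{j \<in> ?J. \<forall>s\<in>S. g (\<theta> j s) = \<one>\<^bsub>F\<^esub>}. B j) \<subseteq> {h \<in> Homs. \<forall>s\<in>S. h s = \<one>\<^bsub>F\<^esub>}"
      using key by (force simp: B_def)
    show "{h \<in> Homs. \<forall>s\<in>S. h s = \<one>\<^bsub>F\<^esub>} \<subseteq> (\<Union>j\<in>{j \<in> ?J. \<forall>s\<in>S. g (\<theta> j s) = \<one>\<^bsub>F\<^esub>}. B j)"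
    proof
      fix h assume h: "h \<in> {h \<in> Homs. \<forall>s\<in>S. h s = \<one>\<^bsub>F\<^esub>}"
      have "\<exists>w\<in>W. h (e i) [^]\<^bsub>F\<^esub> m = g w [^]\<^bsub>F\<^esub> m" for i
      proof -
        have "h (e i) [^]\<^bsub>F\<^esub> m \<in> mF m" using h Homs_closed by (auto intro: multiplesI)
        then show ?thesis using bij by (auto simp: bij_betw_def)
      qed
      then obtain w where w: "\<forall>i. w i \<in> W \<and> h (e i) [^]\<^bsub>F\<^esub> m = g (w i) [^]\<^bsub>F\<^esub> m" by metis
      define j where "j = restrict w {..<N}"
      have j: "j \<in> ?J" using w by (auto simp: j_def)
      have hB: "h \<in> B j" using h w by (simp add: B_def j_def)
      then have "\<forall>s\<in>S. g (\<theta> j s) = \<one>\<^bsub>F\<^esub>" using key[OF j hB] h by simp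
      then show "h \<in> (\<Union>j\<in>{j \<in> ?J. \<forall>s\<in>S. g (\<theta> j s) = \<one>\<^bsub>F\<^esub>}. B j)" using j hB by blast
    qed
  qed
  also have "measure \<eta> \<dots> = (\<Sum>j\<in>{j \<in> ?J. \<forall>s\<in>S. g (\<theta> j s) = \<one>\<^bsub>F\<^esub>}. measure \<eta> (B j))"
    by (rule \<eta>.finite_measure_finite_Union)
       (use fin Bs disj in \<open>auto simp: disjoint_family_on_def\<close>)
  also have "\<dots> = card {j \<in> ?J. \<forall>s\<in>S. g (\<theta> j s) = \<one>\<^bsub>F\<^esub>} / card W ^ N" using PB by simp
  finally show ?thesis by (simp add: \<theta>_def)
qed

end

definition random_subgroup :: "nat \<Rightarrow> ((nat \<Rightarrow> int) set \<Rightarrow> 'c) \<Rightarrow> (nat \<Rightarrow> int) set set"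
  where "random_subgroup m h = multiples A m (carrier A) \<inter> kernel A F h"

lemma mem_random_subgroup:
  "x \<in> random_subgroup m h \<longleftrightarrow> x \<in> multiples A m (carrier A) \<and> h x = \<one>\<^bsub>F\<^esub>"
  using multiples_subset[of "carrier A" m] by (auto simp: random_subgroup_def kernel_def)

lemma random_subgroup_subgroup:
  assumes "h \<in> Homs"
  shows "random_subgroup m h \<in> subgroups A"
  unfolding random_subgroup_def subgroups_def mem_Collect_eq
  by (intro subgroup_Int subgroup_multiples subgroup_self group_hom.subgroup_kernel HomsD assms)

lemma random_subgroup_measurable: "random_subgroup m \<in> measurable Hom_borel (borel_of (Sub A))"
proof (rule measurable_to_Sub)
  fix x assume x: "x \<in> carrier A"
  have "{h \<in> space Hom_borel. x \<in> random_subgroup m h} =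
    {h \<in> Homs. (\<lambda>y. x \<in> multiples A m (carrier A) \<and> y = \<one>\<^bsub>F\<^esub>) (h x)}" by (simp add: mem_random_subgroup)
  then show "{h \<in> space Hom_borel. x \<in> random_subgroup m h} \<in> sets Hom_borel"
    using sets_Hom_value[OF x, of "\<lambda>y. x \<in> multiples A m (carrier A) \<and> y = \<one>\<^bsub>F\<^esub>"] by simp
qed (use random_subgroup_subgroup in auto)

end

section \<open>Classification\<close>

lemma (in group) mult_inv_eq_one_iff:
  assumes "a \<in> carrier G" "b \<in> carrier G"
  shows "a \<otimes> inv b = \<one> \<longleftrightarrow> a = b"
proof
  assume "a \<otimes> inv b = \<one>"
  from inv_equality[OF this inv_closed[OF assms(2)] assms(1)] show "a = b" using assms(2) by simp
qed (use assms in simp)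

text \<open>Transported through the condition on elements of prime order, which avoids moving direct
  summands. As \<open>prime_order_mem_multiples\<close> assumes \<open>m > 0\<close>, the trivial
  groups over 0 are treated apart.\<close>

lemma is_over_cong:
  assumes G: "comm_group G" "finite (carrier G)" "is_over G m" and H: "comm_group H" and i: "f \<in> iso G H"
  shows "is_over H m"
proof -
  interpret G: comm_group G by fact
  interpret H: comm_group H by fact
  have fh: "group_hom G H f"
    using i G.is_group H.is_group by (simp add: iso_def group_hom_def group_hom_axioms_def)
  have im: "f ` carrier G = carrier H" and inj: "inj_on f (carrier G)" using i by (auto simp: iso_def bij_betw_def)
  have finH: "finite (carrier H)" using G(2) im by (metis finite_imageI)
  show ?thesis
  proof (cases "m = 0")
    case True
    have "carrier G = {\<one>\<^bsub>G\<^esub>}" using G(3) True G.is_over_0 by simp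
    then have "carrier H = {\<one>\<^bsub>H\<^esub>}" using im group_hom.hom_one[OF fh] by auto
    then show ?thesis by (simp add: is_over_def)
  next
    case False
    show ?thesis
    proof (rule H.is_over_of_prime_order[OF finH])
      fix p :: nat and x assume p: "prime p" and x: "x \<in> carrier H" "x [^]\<^bsub>H\<^esub> p = \<one>\<^bsub>H\<^esub>"
      obtain y where y: "y \<in> carrier G" "x = f y" using x(1) im by auto
      have "f (y [^]\<^bsub>G\<^esub> p) = f \<one>\<^bsub>G\<^esub>" using x(2) y by (simp add: group_hom.hom_nat_pow[OF fh] group_hom.hom_one[OF fh])
      then have "y [^]\<^bsub>G\<^esub> p = \<one>\<^bsub>G\<^esub>" using inj y(1) by (auto dest: inj_onD)
      then have "y \<in> multiples G m (carrier G)"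
        using G.prime_order_mem_multiples[OF G(2) _ G(3) p y(1)] False by simp
      then obtain z where z: "z \<in> carrier G" "y = z [^]\<^bsub>G\<^esub> m" by (auto simp: mem_multiples)
      have "x = f z [^]\<^bsub>H\<^esub> m" using y(2) z by (simp add: group_hom.hom_nat_pow[OF fh])
      then show "x \<in> multiples H m (carrier H)" using group_hom.hom_closed[OF fh z(1)] by (auto simp: mem_multiples)
    qed
  qed
qed

section \<open>The law determines \<open>m\<close> and the isomorphism class of
  \<open>F\<close>\<close>

context AAn_group
begin

definition realizes :: "(nat \<Rightarrow> int) set set measure \<Rightarrow> nat \<Rightarrow> nat monoid \<Rightarrow> bool"
  where "realizes lam m F \<longleftrightarrow> comm_group F \<and> finite (carrier F) \<and> is_over F m \<and>
    m dvd n \<and> multiples F n (carrier F) = {\<one>\<^bsub>F\<^esub>} \<and>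
    (\<exists>\<eta>. haar_prob (Hom_group A F) (Hom_topology A F) \<eta> \<and>
         distr \<eta> (borel_of (Sub A)) (\<lambda>h. multiples A m (carrier A) \<inter> kernel A F h) = lam)"

lemma realizes_Hom: "realizes lam m F \<Longrightarrow> Hom_AAn A n F"
  by (simp add: realizes_def Hom_AAn_def Hom_AAn_axioms_def AAn_group_axioms)

lemma realizes_measure_eq:
  assumes "realizes lam m F" and E: "E \<in> sets (borel_of (Sub A))"
  obtains \<eta> where "haar_prob (Hom_group A F) (Hom_topology A F) \<eta>"
    "measure lam E = measure \<eta> {h \<in> carrier (Hom_group A F). Hom_AAn.random_subgroup A F m h \<in> E}"
proof -
  interpret Hom_AAn A n F by (rule realizes_Hom[OF assms(1)])
  obtain \<eta> where \<eta>: "haar_prob (Hom_group A F) (Hom_topology A F) \<eta>"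
    and d: "distr \<eta> (borel_of (Sub A)) (random_subgroup m) = lam"
    using assms(1) unfolding realizes_def random_subgroup_def[abs_def] by blast
  have m: "random_subgroup m \<in> measurable \<eta> (borel_of (Sub A))"
    using random_subgroup_measurable measurable_cong_sets[OF sets_haar[OF \<eta>] refl] by blast
  have "random_subgroup m -` E \<inter> space \<eta> = {h \<in> Homs. random_subgroup m h \<in> E}"
    by (auto simp: space_haar[OF \<eta>])
  then have "measure lam E = measure \<eta> {h \<in> Homs. random_subgroup m h \<in> E}"
    using measure_distr[OF m E] d by simp
  with \<eta> show ?thesis by (rule that)
qed

text \<open>Membership of the power in the \<open>m\<close>-multiples is necessary. If it holds, the
  event that \<open>h (e 0)\<close> is trivial suffices, and it has probability
  \<open>1 / card (carrier F)\<close>. So \<open>m\<close> can be read off the law.\<close>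

lemma realizes_dvd_iff:
  assumes r: "realizes lam m F"
  shows "measure lam (containing A {e 0 [^] d}) > 0 \<longleftrightarrow> m dvd d"
proof -
  interpret Hom_AAn A n F by (rule realizes_Hom[OF r])
  have mn: "m dvd n" using r by (simp add: realizes_def)
  have E: "containing A {e 0 [^] d} \<in> sets (borel_of (Sub A))" by (rule sets_containing) auto
  obtain \<eta> where \<eta>: "haar_prob (Hom_group A F) (Hom_topology A F) \<eta>"
    and eq: "measure lam (containing A {e 0 [^] d}) = measure \<eta> {h \<in> Homs. random_subgroup m h \<in> containing A {e 0 [^] d}}"
    using realizes_measure_eq[OF r E] by blast
  interpret \<eta>: prob_space \<eta> using \<eta> by (simp add: haar_prob_def)
  show ?thesis
  proof
    assume "measure lam (containing A {e 0 [^] d}) > 0"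
    then have "{h \<in> Homs. random_subgroup m h \<in> containing A {e 0 [^] d}} \<noteq> {}" using eq by (intro notI) simp
    then have "e 0 [^] d \<in> multiples A m (carrier A)" by (auto simp: containing_def mem_random_subgroup)
    then show "m dvd d" by (rule e_pow_mem_multiples[OF mn])
  next
    assume "m dvd d"
    then obtain c where c: "d = c * m" by (metis dvd_def mult.commute)
    have mem: "e 0 [^] d \<in> multiples A m (carrier A)"
      unfolding c using nat_pow_pow[OF e_closed, of 0 c m] multiplesI[of "e 0 [^] c" "carrier A" A m] by simp
    have "mF 1 = carrier F" by (auto simp: multiples_def)
    then have "measure \<eta> {h \<in> Homs. \<forall>i\<in>{0}. h (e i) [^]\<^bsub>F\<^esub> (1::nat) = \<one>\<^bsub>F\<^esub>} = 1 / card (carrier F)"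
      using haar_values[OF \<eta>, of "{0}" "\<lambda>_. \<one>\<^bsub>F\<^esub>" 1] by simp
    then have "measure \<eta> {h \<in> Homs. \<forall>i\<in>{0}. h (e i) [^]\<^bsub>F\<^esub> (1::nat) = \<one>\<^bsub>F\<^esub>} > 0"
      using finite_F F.one_closed by (auto simp: card_gt_0_iff)
    also have "measure \<eta> {h \<in> Homs. \<forall>i\<in>{0}. h (e i) [^]\<^bsub>F\<^esub> (1::nat) = \<one>\<^bsub>F\<^esub>} \<le>
      measure \<eta> {h \<in> Homs. random_subgroup m h \<in> containing A {e 0 [^] d}}"
    proof (rule \<eta>.finite_measure_mono)
      show "{h \<in> Homs. \<forall>i\<in>{0}. h (e i) [^]\<^bsub>F\<^esub> (1::nat) = \<one>\<^bsub>F\<^esub>} \<subseteq>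
        {h \<in> Homs. random_subgroup m h \<in> containing A {e 0 [^] d}}"
      proof
        fix h assume h: "h \<in> {h \<in> Homs. \<forall>i\<in>{0}. h (e i) [^]\<^bsub>F\<^esub> (1::nat) = \<one>\<^bsub>F\<^esub>}"
        then have hH: "h \<in> Homs" and "h (e 0) = \<one>\<^bsub>F\<^esub>" using Homs_closed by auto
        then have "h (e 0 [^] d) = \<one>\<^bsub>F\<^esub>" by (simp add: group_hom.hom_nat_pow[OF HomsD[OF hH]])
        then show "h \<in> {h \<in> Homs. random_subgroup m h \<in> containing A {e 0 [^] d}}"
          using hH mem random_subgroup_subgroup[OF hH] by (simp add: containing_def mem_random_subgroup)
      qed
      have m: "random_subgroup m \<in> measurable \<eta> (borel_of (Sub A))"
        using random_subgroup_measurable measurable_cong_sets[OF sets_haar[OF \<eta>] refl] by blast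
      have "random_subgroup m -` containing A {e 0 [^] d} \<inter> space \<eta> = {h \<in> Homs. random_subgroup m h \<in> containing A {e 0 [^] d}}"
        by (auto simp: space_haar[OF \<eta>])
      then show "{h \<in> Homs. random_subgroup m h \<in> containing A {e 0 [^] d}} \<in> sets \<eta>"
        using measurable_sets[OF m E] by simp
    qed
    finally show "measure lam (containing A {e 0 [^] d}) > 0" using eq by simp
  qed
qed

text \<open>The basis vectors \<open>e\<^sub>x\<close>, \<open>x \<in> F \<subseteq> \<nat>\<close>, serve to describe the event that \<open>m e\<^sub>x \<mapsto> m x\<close> induces an
  isomorphism modulo the random subgroup; it has positive probability for \<open>F\<close>, hence for \<open>F'\<close>.\<close>

lemma realizes_hom:
  assumes r: "realizes lam m F" and r': "realizes lam m F'"
  shows "\<exists>k\<in>hom F F'. (\<forall>x\<in>carrier F. k x = \<one>\<^bsub>F'\<^esub> \<longleftrightarrow> x [^]\<^bsub>F\<^esub> m = \<one>\<^bsub>F\<^esub>) \<and>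
    k ` carrier F \<subseteq> multiples F' m (carrier F')"
proof -
  interpret FF: Hom_AAn A n F by (rule realizes_Hom[OF r])
  interpret F': Hom_AAn A n F' by (rule realizes_Hom[OF r'])
  \<comment> \<open>As the carrier of \<open>F\<close> consists of natural numbers, its elements can
    index basis vectors. That \<open>rel (x, y)\<close> lies in \<open>H\<close> says that modulo
    \<open>H\<close> the \<open>m\<close>-th powers of the \<open>e x\<close> multiply as in
    \<open>F\<close>.\<close>
  define rel where "rel = (\<lambda>(x, y). (e x \<otimes> e y \<otimes> inv (e (x \<otimes>\<^bsub>F\<^esub> y))) [^] m)"
  define T where "T = rel ` (carrier F \<times> carrier F) \<union> (\<lambda>x. e x [^] m) ` carrier F"
  define E where "E = {H \<in> subgroups A. (\<forall>x\<in>carrier F. \<forall>y\<in>carrier F. rel (x, y) \<in> H) \<and>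
    (\<forall>x\<in>carrier F. e x [^] m \<in> H \<longleftrightarrow> x [^]\<^bsub>F\<^esub> m = \<one>\<^bsub>F\<^esub>)}"
  have T: "finite T" "T \<subseteq> carrier A" using FF.finite_F by (auto simp: T_def rel_def)
  have "rel (x, y) \<in> T" "e x [^] m \<in> T" if "x \<in> carrier F" "y \<in> carrier F" for x y
    using that by (auto simp: T_def)
  then have "depends_on A T E" unfolding depends_on_def E_def by blast
  then have E: "E \<in> sets (borel_of (Sub A))" by (rule sets_depends_on[OF T])
  have mem: "e x [^] m \<in> multiples A m (carrier A)" "rel (x, y) \<in> multiples A m (carrier A)" for x y
    unfolding rel_def by (auto intro!: multiplesI)
  obtain \<eta> where \<eta>: "haar_prob (Hom_group A F) (Hom_topology A F) \<eta>"
    and eq: "measure lam E = measure \<eta> {h \<in> FF.Homs. FF.random_subgroup m h \<in> E}"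
    using realizes_measure_eq[OF r E] by blast
  interpret \<eta>: prob_space \<eta> using \<eta> by (simp add: haar_prob_def)
  \<comment> \<open>With exponent 1, \<open>haar_values\<close> prescribes the values of
    \<open>h\<close> themselves, here \<open>h (e x) = x\<close> for all \<open>x\<close> at
    once.\<close>
  have "FF.mF 1 = carrier F" by (auto simp: multiples_def)
  then have "measure \<eta> {h \<in> FF.Homs. \<forall>x\<in>carrier F. h (e x) [^]\<^bsub>F\<^esub> (1::nat) = x} = 1 / card (carrier F) ^ card (carrier F)"
    using FF.haar_values[OF \<eta> FF.finite_F, of "\<lambda>x. x" 1] by simp
  then have "measure \<eta> {h \<in> FF.Homs. \<forall>x\<in>carrier F. h (e x) [^]\<^bsub>F\<^esub> (1::nat) = x} > 0"
    using FF.finite_F FF.F.one_closed by (auto simp: card_gt_0_iff)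
  also have "measure \<eta> {h \<in> FF.Homs. \<forall>x\<in>carrier F. h (e x) [^]\<^bsub>F\<^esub> (1::nat) = x} \<le> measure \<eta> {h \<in> FF.Homs. FF.random_subgroup m h \<in> E}"
  proof (rule \<eta>.finite_measure_mono)
    show "{h \<in> FF.Homs. \<forall>x\<in>carrier F. h (e x) [^]\<^bsub>F\<^esub> (1::nat) = x} \<subseteq> {h \<in> FF.Homs. FF.random_subgroup m h \<in> E}"
    proof
      fix h assume h: "h \<in> {h \<in> FF.Homs. \<forall>x\<in>carrier F. h (e x) [^]\<^bsub>F\<^esub> (1::nat) = x}"
      then have hH: "h \<in> FF.Homs" by blast
      have hx: "h (e x) = x" if x: "x \<in> carrier F" for x
        using h x FF.Homs_closed[OF hH e_closed, of x] by auto
      note gh = FF.HomsD[OF hH]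
      have "h (rel (x, y)) = \<one>\<^bsub>F\<^esub>" if "x \<in> carrier F" "y \<in> carrier F" for x y
        using that hx by (simp add: rel_def group_hom.hom_nat_pow[OF gh] group_hom.hom_mult[OF gh] group_hom.hom_inv[OF gh])
      moreover have "h (e x [^] m) = x [^]\<^bsub>F\<^esub> m" if "x \<in> carrier F" for x
        using that hx by (simp add: group_hom.hom_nat_pow[OF gh])
      ultimately have "FF.random_subgroup m h \<in> E"
        using FF.random_subgroup_subgroup[OF hH] mem by (simp add: E_def FF.mem_random_subgroup)
      then show "h \<in> {h \<in> FF.Homs. FF.random_subgroup m h \<in> E}" using hH by simp
    qed
    have m: "FF.random_subgroup m \<in> measurable \<eta> (borel_of (Sub A))"
      using FF.random_subgroup_measurable measurable_cong_sets[OF FF.sets_haar[OF \<eta>] refl] by blast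
    have "FF.random_subgroup m -` E \<inter> space \<eta> = {h \<in> FF.Homs. FF.random_subgroup m h \<in> E}"
      by (auto simp: FF.space_haar[OF \<eta>])
    then show "{h \<in> FF.Homs. FF.random_subgroup m h \<in> E} \<in> sets \<eta>"
      using measurable_sets[OF m E] by simp
  qed
  finally have pos: "measure lam E > 0" using eq by simp
  obtain \<eta>' where eq': "measure lam E = measure \<eta>' {h \<in> F'.Homs. F'.random_subgroup m h \<in> E}"
    using realizes_measure_eq[OF r' E] by blast
  with pos have "{h \<in> F'.Homs. F'.random_subgroup m h \<in> E} \<noteq> {}" by (intro notI) simp
  then obtain h where h: "h \<in> F'.Homs" and hE: "F'.random_subgroup m h \<in> E" by blast
  note gh = F'.HomsD[OF h]
  have hc: "h (e x) \<in> carrier F'" for x by (rule F'.Homs_closed[OF h e_closed])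
  \<comment> \<open>Any \<open>h\<close> of the other model in the event works: the relations in
    \<open>H\<close> make \<open>k\<close> a homomorphism, and the second condition of
    \<open>E\<close> fixes its kernel.\<close>
  define k where "k = (\<lambda>x. h (e x) [^]\<^bsub>F'\<^esub> m)"
  have kc: "k x \<in> carrier F'" for x using hc by (simp add: k_def)
  have "k \<in> hom F F'"
  proof (rule homI)
    fix x y assume xy: "x \<in> carrier F" "y \<in> carrier F"
    then have "h (rel (x, y)) = \<one>\<^bsub>F'\<^esub>" using hE by (auto simp: E_def F'.mem_random_subgroup)
    then have "(k x \<otimes>\<^bsub>F'\<^esub> k y) \<otimes>\<^bsub>F'\<^esub> inv\<^bsub>F'\<^esub> k (x \<otimes>\<^bsub>F\<^esub> y) = \<one>\<^bsub>F'\<^esub>"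
      using hc by (simp add: rel_def k_def group_hom.hom_nat_pow[OF gh] group_hom.hom_mult[OF gh] group_hom.hom_inv[OF gh]
        F'.F.nat_pow_distrib F'.F.nat_pow_inv)
    then have "inv\<^bsub>F'\<^esub> (inv\<^bsub>F'\<^esub> k (x \<otimes>\<^bsub>F\<^esub> y)) = k x \<otimes>\<^bsub>F'\<^esub> k y" using kc by (intro F'.F.inv_equality) auto
    then show "k (x \<otimes>\<^bsub>F\<^esub> y) = k x \<otimes>\<^bsub>F'\<^esub> k y" using kc by simp
  qed (rule kc)
  moreover have "k x = \<one>\<^bsub>F'\<^esub> \<longleftrightarrow> x [^]\<^bsub>F\<^esub> m = \<one>\<^bsub>F\<^esub>" if x: "x \<in> carrier F" for x
  proof -
    have "e x [^] m \<in> F'.random_subgroup m h \<longleftrightarrow> x [^]\<^bsub>F\<^esub> m = \<one>\<^bsub>F\<^esub>" using hE x by (simp add: E_def)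
    then show ?thesis using mem(1)[of x] by (simp add: F'.mem_random_subgroup k_def group_hom.hom_nat_pow[OF gh])
  qed
  moreover have "k ` carrier F \<subseteq> multiples F' m (carrier F')" using hc by (auto simp: k_def intro: multiplesI)
  ultimately show ?thesis by blast
qed

text \<open>\<open>k\<close> and the \<open>m\<close>-th power map have the same kernel, hence the
  same fibres.\<close>

lemma card_image_eq_card_multiples:
  assumes F: "comm_group F" and F': "comm_group F'" and k: "k \<in> hom F F'"
    and ker: "\<forall>x\<in>carrier F. k x = \<one>\<^bsub>F'\<^esub> \<longleftrightarrow> x [^]\<^bsub>F\<^esub> m = \<one>\<^bsub>F\<^esub>"
  shows "card (k ` carrier F) = card (multiples F m (carrier F))"
proof -
  interpret F: comm_group F by fact
  interpret F': comm_group F' by fact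
  have kh: "group_hom F F' k" using k F.is_group F'.is_group by (simp add: group_hom_def group_hom_axioms_def)
  have eq: "k x = k y \<longleftrightarrow> x [^]\<^bsub>F\<^esub> m = y [^]\<^bsub>F\<^esub> m" if xy: "x \<in> carrier F" "y \<in> carrier F" for x y
  proof -
    have kc: "k x \<in> carrier F'" "k y \<in> carrier F'" using xy group_hom.hom_closed[OF kh] by auto
    have "k x = k y \<longleftrightarrow> k (x \<otimes>\<^bsub>F\<^esub> inv\<^bsub>F\<^esub> y) = \<one>\<^bsub>F'\<^esub>"
      using xy F'.mult_inv_eq_one_iff[OF kc] by (simp add: group_hom.hom_mult[OF kh] group_hom.hom_inv[OF kh])
    also have "\<dots> \<longleftrightarrow> (x \<otimes>\<^bsub>F\<^esub> inv\<^bsub>F\<^esub> y) [^]\<^bsub>F\<^esub> m = \<one>\<^bsub>F\<^esub>" using ker xy by simp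
    also have "\<dots> \<longleftrightarrow> x [^]\<^bsub>F\<^esub> m = y [^]\<^bsub>F\<^esub> m"
      using xy F.mult_inv_eq_one_iff[of "x [^]\<^bsub>F\<^esub> m" "y [^]\<^bsub>F\<^esub> m"] by (simp add: F.nat_pow_distrib F.nat_pow_inv)
    finally show ?thesis .
  qed
  define g where "g = (\<lambda>z. k (SOME x. x \<in> carrier F \<and> x [^]\<^bsub>F\<^esub> m = z))"
  have g: "g (x [^]\<^bsub>F\<^esub> m) = k x" if x: "x \<in> carrier F" for x
  proof -
    have "\<exists>y. y \<in> carrier F \<and> y [^]\<^bsub>F\<^esub> m = x [^]\<^bsub>F\<^esub> m" using x by blast
    from someI_ex[OF this] show ?thesis unfolding g_def using eq x by blast
  qed
  have "bij_betw g (multiples F m (carrier F)) (k ` carrier F)"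
  proof (rule bij_betw_imageI)
    show "inj_on g (multiples F m (carrier F))"
    proof (rule inj_onI)
      fix a b assume "a \<in> multiples F m (carrier F)" "b \<in> multiples F m (carrier F)" "g a = g b"
      then show "a = b" using g eq by (auto simp: mem_multiples)
    qed
    have "g ` multiples F m (carrier F) = (\<lambda>x. g (x [^]\<^bsub>F\<^esub> m)) ` carrier F" by (simp add: multiples_def image_image)
    also have "\<dots> = k ` carrier F" by (rule image_cong[OF refl g])
    finally show "g ` multiples F m (carrier F) = k ` carrier F" .
  qed
  then show ?thesis by (metis bij_betw_same_card)
qed

text \<open>Two natural numbers with the same multiples are equal, so \<open>m = m'\<close>. The
  homomorphisms from \<open>realizes_hom\<close> in both directions show that the groups of
  \<open>m\<close>-multiples have equal size, so \<open>k\<close> maps onto the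
  \<open>m\<close>-multiples of \<open>F'\<close>, which is the missing hypothesis of
  \<open>is_over_iso\<close>.\<close>

lemma realizes_unique:
  assumes r: "realizes lam m F" and r': "realizes lam m' F'"
  shows "m = m'" "iso_class F = iso_class F'"
proof -
  have "m dvd d \<longleftrightarrow> m' dvd d" for d using realizes_dvd_iff[OF r] realizes_dvd_iff[OF r'] by blast
  then show mm: "m = m'" by (metis dvd_antisym dvd_refl)
  have F: "comm_group F" "finite (carrier F)" "is_over F m"
    and F': "comm_group F'" "finite (carrier F')" "is_over F' m"
    using r r' mm by (auto simp: realizes_def)
  interpret F: comm_group F by fact
  interpret F': comm_group F' by fact
  have "F \<cong> F'"
  proof (cases "m = 0")
    case True
    have c: "carrier F = {\<one>\<^bsub>F\<^esub>}" "carrier F' = {\<one>\<^bsub>F'\<^esub>}" using True F(3) F'(3) F.is_over_0 F'.is_over_0 by auto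
    have "(\<lambda>x. \<one>\<^bsub>F'\<^esub>) \<in> iso F F'" unfolding iso_def bij_betw_def hom_def using c by auto
    then show ?thesis by (auto simp: is_iso_def)
  next
    case False
    obtain k where k: "k \<in> hom F F'" "\<forall>x\<in>carrier F. k x = \<one>\<^bsub>F'\<^esub> \<longleftrightarrow> x [^]\<^bsub>F\<^esub> m = \<one>\<^bsub>F\<^esub>"
      "k ` carrier F \<subseteq> multiples F' m (carrier F')"
      using realizes_hom[OF r r'[folded mm]] by blast
    obtain k' where k': "k' \<in> hom F' F" "\<forall>x\<in>carrier F'. k' x = \<one>\<^bsub>F\<^esub> \<longleftrightarrow> x [^]\<^bsub>F'\<^esub> m = \<one>\<^bsub>F'\<^esub>"
      "k' ` carrier F' \<subseteq> multiples F m (carrier F)"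
      using realizes_hom[OF r'[folded mm] r] by blast
    have fin: "finite (multiples F m (carrier F))" "finite (multiples F' m (carrier F'))"
      using F(2) F'(2) by (auto simp: multiples_def)
    have "card (multiples F' m (carrier F')) \<le> card (multiples F m (carrier F))"
      using card_image_eq_card_multiples[OF F'(1) F(1) k'(1,2)] card_mono[OF fin(1) k'(3)] by simp
    then have "card (multiples F' m (carrier F')) \<le> card (k ` carrier F)"
      using card_image_eq_card_multiples[OF F(1) F'(1) k(1,2)] by simp
    then have "k ` carrier F = multiples F' m (carrier F')" using card_seteq[OF fin(2) k(3)] by blast
    then show ?thesis using is_over_iso[OF F F' _ k(1)] k(2) False by simp
  qed
  then show "iso_class F = iso_class F'"
    unfolding iso_class_def using F.iso_sym iso_trans by blast
qed

end

section \<open>Every extreme law comes from a Haar model\<close>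

context ergodic_CRS
begin

text \<open>With \<open>H\<close> from \<open>random_subgroup_formula\<close> and \<open>F\<close> a
  copy of \<open>A Mod B\<close>, the quotient map \<open>g\<close> has kernel \<open>H\<close> on
  \<open>mA\<close> because \<open>mA \<inter> B = H\<close>. Hence the counting formulas for
  \<open>lam\<close> and for the Haar model count the same functions.\<close>

lemma exists_realization: "\<exists>F. realizes lam index F"
proof -
  obtain W H where W: "finite W" "W \<subseteq> carrier A" and tr: "transversal W H" and HmA: "H \<subseteq> mA"
    and formula: "\<And>N S. finite S \<Longrightarrow> S \<subseteq> multiples A index (span {..<N}) \<Longrightarrow>
      P (contain S) = card {j \<in> {..<N} \<rightarrow>\<^sub>E W. endo (\<lambda>i. if i < N then j i else \<one>) ` S \<subseteq> H} / card W ^ N"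
    using random_subgroup_formula by blast
  have sH: "subgroup H A" and sep: "H \<in> separated W" using tr by (auto simp: transversal_def separated_def subgroups_def)
  have cover: "mA \<subseteq> (\<lambda>w. w [^] index) ` W <#> H"
  proof
    fix y assume "y \<in> mA"
    then obtain x where x: "x \<in> carrier A" "y = x [^] index" by (auto simp: mem_multiples)
    obtain w where w: "w \<in> W" "(x \<otimes> inv w) [^] index \<in> H" using tr x(1) by (auto simp: transversal_def)
    have wc: "w \<in> carrier A" using w W by blast
    have "w \<otimes> (x \<otimes> inv w) = x \<otimes> (w \<otimes> inv w)" by (rule m_lcomm) (use x(1) wc in auto)
    then have "w \<otimes> (x \<otimes> inv w) = x" using x(1) wc by simp
    then have "y = w [^] index \<otimes> (x \<otimes> inv w) [^] index" using x wc by (simp flip: nat_pow_distrib)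
    then show "y \<in> (\<lambda>w. w [^] index) ` W <#> H" using w by (auto simp: mem_set_mult)
  qed
  have Wm: "finite ((\<lambda>w. w [^] index) ` W)" "(\<lambda>w. w [^] index) ` W \<subseteq> carrier A" using W by auto
  obtain B where B: "subgroup B A" "mA \<inter> B = H" "finite (carrier (A Mod B))" "is_over (A Mod B) index"
    using exists_over_quotient[OF sH HmA Wm cover] by blast
  have Q: "comm_group (A Mod B)" by (rule abelian_FactGroup[OF B(1)])
  interpret N: normal B A by (rule subgroup_imp_normal[OF B(1)])
  obtain F :: "nat monoid" where F: "comm_group F" "finite (carrier F)" "A Mod B \<cong> F"
    using finite_comm_group_iso_nat[OF Q B(3)] by blast
  obtain f where f: "f \<in> iso (A Mod B) F" using F(3) by (auto simp: is_iso_def)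
  have over: "is_over F index" by (rule is_over_cong[OF Q B(3,4) F(1) f])
  interpret FG: comm_group F by (rule F(1))
  define g where "g = (\<lambda>x. f (B #> x))"
  have g: "g \<in> hom A F"
    unfolding g_def using Group.hom_compose[OF N.r_coset_hom_Mod, of f F] f by (auto simp: iso_def comp_def)
  have gh: "group_hom A F g" using g is_group FG.is_group by (simp add: group_hom_def group_hom_axioms_def)
  have gim: "g ` carrier A = carrier F"
  proof -
    have "g ` carrier A = f ` carrier (A Mod B)" by (simp add: g_def carrier_FactGroup image_image)
    then show ?thesis using f by (simp add: iso_def bij_betw_def)
  qed
  have fh: "group_hom (A Mod B) F f"
    using f Q FG.is_group by (simp add: iso_def group_hom_def group_hom_axioms_def comm_group.axioms(2))
  have ker: "g x = \<one>\<^bsub>F\<^esub> \<longleftrightarrow> x \<in> B" if x: "x \<in> carrier A" for x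
  proof
    assume "x \<in> B"
    then have "B #> x = \<one>\<^bsub>A Mod B\<^esub>" using coset_join2[OF x B(1)] by simp
    then show "g x = \<one>\<^bsub>F\<^esub>" using group_hom.hom_one[OF fh] by (simp add: g_def)
  next
    assume "g x = \<one>\<^bsub>F\<^esub>"
    then have "f (B #> x) = f \<one>\<^bsub>A Mod B\<^esub>" using group_hom.hom_one[OF fh] by (simp add: g_def)
    moreover have "B #> x \<in> carrier (A Mod B)" using x by (auto simp: carrier_FactGroup)
    moreover have "\<one>\<^bsub>A Mod B\<^esub> \<in> carrier (A Mod B)" by (rule monoid.one_closed[OF group.is_monoid[OF N.factorgroup_is_group]])
    ultimately have "B #> x = B" using f by (auto simp: iso_def bij_betw_def dest: inj_onD)
    then show "x \<in> B" using rcos_self[OF x B(1)] by simp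
  qed
  have mF_ker: "g x [^]\<^bsub>F\<^esub> index = \<one>\<^bsub>F\<^esub> \<longleftrightarrow> x [^] index \<in> H" if x: "x \<in> carrier A" for x
    using ker[of "x [^] index"] x multiplesI[OF x, of A index] B(2)
    by (auto simp: group_hom.hom_nat_pow[OF gh])
  have diff: "g x [^]\<^bsub>F\<^esub> index = g y [^]\<^bsub>F\<^esub> index \<longleftrightarrow> (x \<otimes> inv y) [^] index \<in> H"
    if xy: "x \<in> carrier A" "y \<in> carrier A" for x y
  proof -
    have c: "g x \<in> carrier F" "g y \<in> carrier F" using xy group_hom.hom_closed[OF gh] by auto
    have "g (x \<otimes> inv y) [^]\<^bsub>F\<^esub> index = g x [^]\<^bsub>F\<^esub> index \<otimes>\<^bsub>F\<^esub> inv\<^bsub>F\<^esub> (g y [^]\<^bsub>F\<^esub> index)"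
      using xy c by (simp add: group_hom.hom_mult[OF gh] group_hom.hom_inv[OF gh] FG.nat_pow_distrib FG.nat_pow_inv)
    then have "g x [^]\<^bsub>F\<^esub> index = g y [^]\<^bsub>F\<^esub> index \<longleftrightarrow> g (x \<otimes> inv y) [^]\<^bsub>F\<^esub> index = \<one>\<^bsub>F\<^esub>"
      using FG.mult_inv_eq_one_iff[of "g x [^]\<^bsub>F\<^esub> index" "g y [^]\<^bsub>F\<^esub> index"] c by simp
    also have "\<dots> \<longleftrightarrow> (x \<otimes> inv y) [^] index \<in> H" by (rule mF_ker) (use xy in simp)
    finally show ?thesis .
  qed
  have expF: "multiples F n (carrier F) = {\<one>\<^bsub>F\<^esub>}"
  proof -
    have "y [^]\<^bsub>F\<^esub> n = \<one>\<^bsub>F\<^esub>" if y: "y \<in> carrier F" for y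
    proof -
      obtain x where x: "x \<in> carrier A" "y = g x" using y gim by blast
      then show ?thesis using group_hom.hom_nat_pow[OF gh x(1), of n] group_hom.hom_one[OF gh] by simp
    qed
    then show ?thesis using FG.one_closed by (auto simp: multiples_def)
  qed
  interpret HF: Hom_AAn A n F
    by (simp add: Hom_AAn_def Hom_AAn_axioms_def AAn_group_axioms F expF)
  obtain \<eta> where \<eta>: "haar_prob (Hom_group A F) (Hom_topology A F) \<eta>" using HF.haar_exists by blast
  interpret \<eta>: prob_space \<eta> using \<eta> by (simp add: haar_prob_def)
  \<comment> \<open>Injectivity is the separation of \<open>W\<close>, surjectivity the covering
    half of \<open>transversal\<close>; \<open>diff\<close> translates both.\<close>
  have bij: "bij_betw (\<lambda>w. g w [^]\<^bsub>F\<^esub> index) W (HF.mF index)"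
  proof (rule bij_betw_imageI)
    show "inj_on (\<lambda>w. g w [^]\<^bsub>F\<^esub> index) W"
    proof (rule inj_onI)
      fix w w' assume w: "w \<in> W" "w' \<in> W" "g w [^]\<^bsub>F\<^esub> index = g w' [^]\<^bsub>F\<^esub> index"
      then have "(w \<otimes> inv w') [^] index \<in> H" using diff W(2) by blast
      then show "w = w'" using sep w(1,2) unfolding separated_def by blast
    qed
    show "(\<lambda>w. g w [^]\<^bsub>F\<^esub> index) ` W = HF.mF index"
    proof
      show "(\<lambda>w. g w [^]\<^bsub>F\<^esub> index) ` W \<subseteq> HF.mF index"
        using W(2) group_hom.hom_closed[OF gh] by (auto intro!: multiplesI)
      show "HF.mF index \<subseteq> (\<lambda>w. g w [^]\<^bsub>F\<^esub> index) ` W"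
      proof
        fix y assume "y \<in> HF.mF index"
        then obtain z where "z \<in> carrier F" and y: "y = z [^]\<^bsub>F\<^esub> index" by (auto simp: mem_multiples)
        then obtain x where "x \<in> carrier A" "z = g x" using gim by blast
        then have x: "x \<in> carrier A" "y = g x [^]\<^bsub>F\<^esub> index" using y by simp_all
        then obtain w where w: "w \<in> W" "(x \<otimes> inv w) [^] index \<in> H" using tr by (auto simp: transversal_def)
        then have "y = g w [^]\<^bsub>F\<^esub> index" using diff[OF x(1), of w] W(2) x(2) by blast
        then show "y \<in> (\<lambda>w. g w [^]\<^bsub>F\<^esub> index) ` W" using w(1) by blast
      qed
    qed
  qed
  have m: "HF.random_subgroup index \<in> measurable \<eta> (borel_of (Sub A))"
    using HF.random_subgroup_measurable measurable_cong_sets[OF HF.sets_haar[OF \<eta>] refl] by blast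
  have "distr \<eta> (borel_of (Sub A)) (HF.random_subgroup index) = lam"
  proof (rule measure_eq_on_containing[OF \<eta>.prob_space_distr[OF m] _ lam.prob_space_axioms sets_lam])
    fix S assume S: "finite S" "S \<subseteq> carrier A"
    have d: "measure (distr \<eta> (borel_of (Sub A)) (HF.random_subgroup index)) (contain S) =
      measure \<eta> {h \<in> HF.Homs. HF.random_subgroup index h \<in> contain S}"
    proof -
      have "HF.random_subgroup index -` contain S \<inter> space \<eta> = {h \<in> HF.Homs. HF.random_subgroup index h \<in> contain S}"
        by (auto simp: HF.space_haar[OF \<eta>])
      then show ?thesis using measure_distr[OF m sets_containing[OF S]] by simp
    qed
    \<comment> \<open>If \<open>S\<close> leaves \<open>mA\<close>, both sides are 0. Otherwise
      \<open>S\<close> consists of \<open>index\<close>-th powers from a finite span, and both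
      formulas apply.\<close>
    show "measure (distr \<eta> (borel_of (Sub A)) (HF.random_subgroup index)) (contain S) = P (contain S)"
    proof (cases "S \<subseteq> mA")
      case True
      obtain U where U: "U \<subseteq> carrier A" "finite U" "S = (\<lambda>u. u [^] index) ` U"
        using finite_subset_image[OF S(1), of "\<lambda>u. u [^] index" "carrier A"] True by (auto simp: multiples_def)
      obtain N where N: "U \<subseteq> span {..<N}" using finite_subset_span[OF U(2,1)] by blast
      have SN: "S \<subseteq> multiples A index (span {..<N})" using U(3) N by (auto intro: multiplesI)
      have "{h \<in> HF.Homs. HF.random_subgroup index h \<in> contain S} = {h \<in> HF.Homs. \<forall>s\<in>S. h s = \<one>\<^bsub>F\<^esub>}"
        using True HF.random_subgroup_subgroup by (auto simp: containing_def HF.mem_random_subgroup subset_iff)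
      also have "measure \<eta> \<dots> = card {j \<in> {..<N} \<rightarrow>\<^sub>E W. \<forall>s\<in>S. g (endo (\<lambda>i. if i < N then j i else \<one>) s) = \<one>\<^bsub>F\<^esub>} / card W ^ N"
        by (rule HF.haar_containing[OF \<eta> g W bij S(1) SN])
      also have "{j \<in> {..<N} \<rightarrow>\<^sub>E W. \<forall>s\<in>S. g (endo (\<lambda>i. if i < N then j i else \<one>) s) = \<one>\<^bsub>F\<^esub>} =
        {j \<in> {..<N} \<rightarrow>\<^sub>E W. endo (\<lambda>i. if i < N then j i else \<one>) ` S \<subseteq> H}"
      proof (rule Collect_cong, rule conj_cong[OF refl])
        fix j assume j: "j \<in> {..<N} \<rightarrow>\<^sub>E W"
        have jc: "(if i < N then j i else \<one>) \<in> carrier A" for i using j W(2) by auto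
        note th = endo(1)[OF jc]
        have ths: "group_hom A A (endo (\<lambda>i. if i < N then j i else \<one>))"
          using th is_group by (simp add: group_hom_def group_hom_axioms_def)
        have "g (endo (\<lambda>i. if i < N then j i else \<one>) s) = \<one>\<^bsub>F\<^esub> \<longleftrightarrow> endo (\<lambda>i. if i < N then j i else \<one>) s \<in> H"
          if s: "s \<in> S" for s
        proof -
          obtain u where u: "u \<in> carrier A" "s = u [^] index" using s U by blast
          have "endo (\<lambda>i. if i < N then j i else \<one>) s = endo (\<lambda>i. if i < N then j i else \<one>) u [^] index"
            using group_hom.hom_nat_pow[OF ths u(1)] u(2) by simp
          moreover have "endo (\<lambda>i. if i < N then j i else \<one>) u \<in> carrier A" by (rule group_hom.hom_closed[OF ths u(1)])
          ultimately show ?thesis using mF_ker by (simp add: group_hom.hom_nat_pow[OF gh])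
        qed
        then show "(\<forall>s\<in>S. g (endo (\<lambda>i. if i < N then j i else \<one>) s) = \<one>\<^bsub>F\<^esub>) \<longleftrightarrow>
          endo (\<lambda>i. if i < N then j i else \<one>) ` S \<subseteq> H" by (simp add: image_subset_iff)
      qed
      finally show ?thesis using formula[OF S(1) SN] d by simp
    next
      case False
      then have "{h \<in> HF.Homs. HF.random_subgroup index h \<in> contain S} = {}"
        by (auto simp: containing_def HF.mem_random_subgroup)
      moreover have "P (contain S) = 0"
      proof -
        have "AE H in lam. H \<notin> contain S"
          using AE_subset_mA by (rule eventually_mono) (use False in \<open>auto simp: containing_def\<close>)
        then show ?thesis using lam.prob_eq_0[OF sets_lam_containing[OF S]] by simp
      qed
      ultimately show ?thesis unfolding d by (simp only: measure_empty)
    qed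
  qed simp
  moreover have "HF.random_subgroup index = (\<lambda>h. mA \<inter> kernel A F h)"
    by (rule ext) (rule HF.random_subgroup_def)
  ultimately have "\<exists>\<eta>. haar_prob (Hom_group A F) (Hom_topology A F) \<eta> \<and>
      distr \<eta> (borel_of (Sub A)) (\<lambda>h. mA \<inter> kernel A F h) = lam"
    using \<eta> by auto
  then show ?thesis unfolding realizes_def using F(1,2) over index_dvd expF by blast
qed

end

theorem theorem1p4:
  fixes n :: nat and lam :: "(nat \<Rightarrow> int) set set measure"
  assumes "lam \<in> CRSe (AAn n)"
  shows "\<exists>!p. \<exists>(m :: nat) (F :: nat monoid).
    p = (m, iso_class F) \<and>
    comm_group F \<and> finite (carrier F) \<and> is_over F m \<and>
    m dvd n \<and> multiples F n (carrier F) = {\<one>\<^bsub>F\<^esub>} \<and>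
    (\<exists>\<eta>. haar_prob (Hom_group (AAn n) F) (Hom_topology (AAn n) F) \<eta> \<and>
         distr \<eta> (borel_of (Sub (AAn n)))
           (\<lambda>h. multiples (AAn n) m (carrier (AAn n)) \<inter> kernel (AAn n) F h) = lam)"
proof -
  interpret AAn_group "AAn n" n by (rule AAn_group)
  interpret ergodic_CRS "AAn n" n lam by unfold_locales (rule assms)
  have eq: "(\<exists>m F. p = (m, iso_class F) \<and> realizes lam m F) \<longleftrightarrow> (\<exists>(m :: nat) (F :: nat monoid).
    p = (m, iso_class F) \<and>
    comm_group F \<and> finite (carrier F) \<and> is_over F m \<and>
    m dvd n \<and> multiples F n (carrier F) = {\<one>\<^bsub>F\<^esub>} \<and>
    (\<exists>\<eta>. haar_prob (Hom_group (AAn n) F) (Hom_topology (AAn n) F) \<eta> \<and>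
         distr \<eta> (borel_of (Sub (AAn n)))
           (\<lambda>h. multiples (AAn n) m (carrier (AAn n)) \<inter> kernel (AAn n) F h) = lam))" for p
    unfolding realizes_def by blast
  obtain F where F: "realizes lam index F" using exists_realization by blast
  have "\<exists>!p. \<exists>m F. p = (m, iso_class F) \<and> realizes lam m F"
  proof (rule ex1I[of _ "(index, iso_class F)"])
    fix p assume "\<exists>m F. p = (m, iso_class F) \<and> realizes lam m F"
    then show "p = (index, iso_class F)" using realizes_unique[OF F] by blast
  qed (use F in blast)
  then show ?thesis unfolding eq .
qed

end
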